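(* For compact complex manifolds, the pseudo-Hermitian-symplectic property is stable: any sufficiently small deformation of a compact pseudo-Hermitian-symplectic manifold is pseudo-Hermitian-symplectic. Therefore, any sufficiently small deformation of a (compact) pseudo-Kähler manifold is pseudo-Hermitian-symplectic.
   Context: A complex manifold $X=(M,J)$ is pseudo-Hermitian-symplectic if there exists a symplectic form $\Omega$ on $M$ whose component of bidegree $(1,1)$ with respect to $J$ is non-degenerate. $X$ is pseudo-Kähler if there is a symplectic form $F$ on $M$ of bidegree $(1,1)$ with respect to $J$. "Any sufficiently small deformation of $X$ has property $P$" means: for every holomorphic family of compact complex manifolds $\{X_{\mathbf t}\}_{\mathbf t\in\Delta}$ (the fibres of a proper holomorphic submersion onto a complex manifold $\Delta\ni0$) with $X_0=X$, the fibre $X_{\mathbf t}$ has property $P$ for all $\mathbf t$ close enough to $0$. *)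

theory Defs
  imports "HOL-Analysis.Analysis"
begin

section \<open>Complex manifolds and holomorphic maps\<close>

definition holomorphic_map_on ::
    "((complex, 'n::finite) vec \<Rightarrow> (complex, 'm::finite) vec) \<Rightarrow> (complex, 'n) vec set \<Rightarrow> bool" where
  "holomorphic_map_on f S \<longleftrightarrow>
     (\<forall>x\<in>S. \<exists>f'. (f has_derivative f') (at x) \<and> (\<forall>a v. f' (a *s v) = a *s f' v))"

text \<open>A chart is a pair of its domain and a coordinate map, whose values outside the domain
  are irrelevant. Manifolds need neither be connected nor carry a maximal atlas.\<close>

type_synonym ('p, 'n) chart = "'p set \<times> ('p \<Rightarrow> (complex, 'n) vec)"

record ('p, 'n) charted_space =
  mtop :: "'p topology"
  atlas :: "('p, 'n::finite) chart set"

definition chart_image :: "('p, 'n::finite) chart \<Rightarrow> (complex, 'n) vec set" where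
  "chart_image c = snd c ` fst c"

definition local_map ::
    "('p \<Rightarrow> 'q) \<Rightarrow> ('p, 'n::finite) chart \<Rightarrow> ('q, 'm::finite) chart \<Rightarrow> (complex, 'n) vec \<Rightarrow> (complex, 'm) vec" where
  "local_map f c d = snd d \<circ> f \<circ> inv_into (fst c) (snd c)"

definition local_domain ::
    "('p \<Rightarrow> 'q) \<Rightarrow> ('p, 'n::finite) chart \<Rightarrow> ('q, 'm::finite) chart \<Rightarrow> (complex, 'n) vec set" where
  "local_domain f c d = snd c ` (fst c \<inter> f -` fst d)"

definition topological_chart :: "'p topology \<Rightarrow> ('p, 'n::finite) chart \<Rightarrow> bool" where
  "topological_chart T c \<longleftrightarrow>
     openin T (fst c) \<and> open (chart_image c) \<and>
     homeomorphic_map (subtopology T (fst c)) (top_of_set (chart_image c)) (snd c)"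

definition complex_manifold :: "('p, 'n::finite) charted_space \<Rightarrow> bool" where
  "complex_manifold M \<longleftrightarrow>
     Hausdorff_space (mtop M) \<and> second_countable (mtop M) \<and>
     (\<forall>c\<in>atlas M. topological_chart (mtop M) c) \<and>
     \<Union>(fst ` atlas M) = topspace (mtop M) \<and>
     (\<forall>c\<in>atlas M. \<forall>d\<in>atlas M. holomorphic_map_on (local_map id c d) (local_domain id c d))"

definition compact_complex_manifold :: "('p, 'n::finite) charted_space \<Rightarrow> bool" where
  "compact_complex_manifold M \<longleftrightarrow> complex_manifold M \<and> compact_space (mtop M)"

definition holomorphic_map ::
    "('p, 'n::finite) charted_space \<Rightarrow> ('q, 'm::finite) charted_space \<Rightarrow> ('p \<Rightarrow> 'q) \<Rightarrow> bool" where
  "holomorphic_map M N f \<longleftrightarrow>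
     continuous_map (mtop M) (mtop N) f \<and>
     (\<forall>c\<in>atlas M. \<forall>d\<in>atlas N. holomorphic_map_on (local_map f c d) (local_domain f c d))"

definition biholomorphic ::
    "('p, 'n::finite) charted_space \<Rightarrow> ('q, 'm::finite) charted_space \<Rightarrow> bool" where
  "biholomorphic M N \<longleftrightarrow>
     complex_manifold M \<and> complex_manifold N \<and>
     (\<exists>f g. holomorphic_map M N f \<and> holomorphic_map N M g \<and>
        (\<forall>x\<in>topspace (mtop M). g (f x) = x) \<and> (\<forall>y\<in>topspace (mtop N). f (g y) = y))"

definition holomorphic_submersion ::
    "('p, 'n::finite) charted_space \<Rightarrow> ('q, 'm::finite) charted_space \<Rightarrow> ('p \<Rightarrow> 'q) \<Rightarrow> bool" where
  "holomorphic_submersion M N f \<longleftrightarrow>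
     holomorphic_map M N f \<and>
     (\<forall>c\<in>atlas M. \<forall>d\<in>atlas N. \<forall>x\<in>local_domain f c d.
        surj (frechet_derivative (local_map f c d) (at x)))"

text \<open>The structure induced on a subset \<open>S\<close> of \<open>M\<close>: its charts are the topological charts of \<open>S\<close>
  (in the subspace topology) whose inverses are holomorphic immersions into \<open>M\<close>.  If \<open>S\<close> is an
  embedded complex submanifold of dimension \<open>CARD('k)\<close>, this is its maximal holomorphic atlas.\<close>

definition induced_structure ::
    "('p, 'n::finite) charted_space \<Rightarrow> 'p set \<Rightarrow> ('p, 'k::finite) charted_space" where
  "induced_structure M S =
     \<lparr> mtop = subtopology (mtop M) S,
       atlas = {c. topological_chart (subtopology (mtop M) S) c \<and>
                   (\<forall>d\<in>atlas M. holomorphic_map_on (local_map id c d) (local_domain id c d) \<and>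
                      (\<forall>x\<in>local_domain id c d. inj (frechet_derivative (local_map id c d) (at x))))} \<rparr>"

definition fibre ::
    "('p, 'n::finite) charted_space \<Rightarrow> ('p \<Rightarrow> 'q) \<Rightarrow> 'q \<Rightarrow> ('p, 'k::finite) charted_space" where
  "fibre E \<pi> t = induced_structure E {x \<in> topspace (mtop E). \<pi> x = t}"

definition holomorphic_family ::
    "('p, 'n::finite) charted_space \<Rightarrow> ('q, 'm::finite) charted_space \<Rightarrow> ('p \<Rightarrow> 'q) \<Rightarrow> bool" where
  "holomorphic_family E D \<pi> \<longleftrightarrow>
     complex_manifold E \<and> complex_manifold D \<and> holomorphic_submersion E D \<pi> \<and>
     proper_map (mtop E) (mtop D) \<pi> \<and> \<pi> ` topspace (mtop E) = topspace (mtop D)"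

section \<open>Differential 2-forms\<close>

text \<open>\<open>Ck_on k f S\<close>: \<open>f\<close> is of class \<open>C\<^sup>k\<close>, in the real sense, on the open set \<open>S\<close>.\<close>

primrec Ck_on :: "nat \<Rightarrow> ('a::euclidean_space \<Rightarrow> 'b::real_normed_vector) \<Rightarrow> 'a set \<Rightarrow> bool" where
  "Ck_on 0 f S \<longleftrightarrow> continuous_on S f"
| "Ck_on (Suc k) f S \<longleftrightarrow>
     (\<exists>f'. (\<forall>x\<in>S. (f has_derivative f' x) (at x)) \<and> (\<forall>v. Ck_on k (\<lambda>x. f' x v) S))"

definition smooth_on :: "('a::euclidean_space \<Rightarrow> 'b::real_normed_vector) \<Rightarrow> 'a set \<Rightarrow> bool" where
  "smooth_on f S \<longleftrightarrow> (\<forall>k. Ck_on k f S)"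

text \<open>Tangent vectors of \<open>M\<close> at \<open>p\<close> are represented in each chart by the elements of the coordinate
  space. A real 2-form is the family of its coordinate representations: \<open>\<omega> c x u v\<close> is its value
  on the tangent vectors with coordinates \<open>u\<close>, \<open>v\<close> at the point with coordinates \<open>x\<close> in the
  chart \<open>c\<close>. The values for \<open>x \<notin> chart_image c\<close> are irrelevant.\<close>

type_synonym ('p, 'n) two_form =
  "('p, 'n) chart \<Rightarrow> (complex, 'n) vec \<Rightarrow> (complex, 'n) vec \<Rightarrow> (complex, 'n) vec \<Rightarrow> real"

definition smooth_two_form :: "('p, 'n::finite) charted_space \<Rightarrow> ('p, 'n) two_form \<Rightarrow> bool" where
  "smooth_two_form M \<omega> \<longleftrightarrow>
     (\<forall>c\<in>atlas M. \<forall>x\<in>chart_image c. bilinear (\<omega> c x) \<and> (\<forall>u. \<omega> c x u u = 0)) \<and>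
     (\<forall>c\<in>atlas M. \<forall>u v. smooth_on (\<lambda>x. \<omega> c x u v) (chart_image c)) \<and>
     (\<forall>c\<in>atlas M. \<forall>d\<in>atlas M. \<forall>x\<in>local_domain id c d. \<forall>u v.
        \<omega> c x u v = \<omega> d (local_map id c d x)
          (frechet_derivative (local_map id c d) (at x) u)
          (frechet_derivative (local_map id c d) (at x) v))"

text \<open>The coordinate expression of \<open>d\<omega>(u,v,w)\<close> on constant vector fields, whose Lie brackets vanish.\<close>

definition exterior_derivative ::
    "('a::euclidean_space \<Rightarrow> 'a \<Rightarrow> 'a \<Rightarrow> real) \<Rightarrow> 'a \<Rightarrow> 'a \<Rightarrow> 'a \<Rightarrow> 'a \<Rightarrow> real" where
  "exterior_derivative \<alpha> x u v w =
     frechet_derivative (\<lambda>y. \<alpha> y v w) (at x) u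
     - frechet_derivative (\<lambda>y. \<alpha> y u w) (at x) v
     + frechet_derivative (\<lambda>y. \<alpha> y u v) (at x) w"

definition nondegenerate :: "('a::zero \<Rightarrow> 'a \<Rightarrow> 'b::zero) \<Rightarrow> bool" where
  "nondegenerate \<beta> \<longleftrightarrow> (\<forall>u. (\<forall>v. \<beta> u v = 0) \<longrightarrow> u = 0)"

definition symplectic_form :: "('p, 'n::finite) charted_space \<Rightarrow> ('p, 'n) two_form \<Rightarrow> bool" where
  "symplectic_form M \<omega> \<longleftrightarrow>
     smooth_two_form M \<omega> \<and>
     (\<forall>c\<in>atlas M. \<forall>x\<in>chart_image c.
        nondegenerate (\<omega> c x) \<and> (\<forall>u v w. exterior_derivative (\<omega> c) x u v w = 0))"

section \<open>Bidegrees\<close>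

definition wedge :: "('a \<Rightarrow> complex) \<Rightarrow> ('a \<Rightarrow> complex) \<Rightarrow> 'a \<Rightarrow> 'a \<Rightarrow> complex" where
  "wedge \<xi> \<eta> u v = \<xi> u * \<eta> v - \<xi> v * \<eta> u"

definition dz :: "'n \<Rightarrow> (complex, 'n::finite) vec \<Rightarrow> complex" where
  "dz i v = v $ i"

definition dzbar :: "'n \<Rightarrow> (complex, 'n::finite) vec \<Rightarrow> complex" where
  "dzbar i v = cnj (v $ i)"

definition bidegree_2_0 :: "((complex, 'n::finite) vec \<Rightarrow> (complex, 'n) vec \<Rightarrow> complex) \<Rightarrow> bool" where
  "bidegree_2_0 \<beta> \<longleftrightarrow>
     (\<exists>a. \<forall>u v. \<beta> u v = (\<Sum>i\<in>UNIV. \<Sum>j\<in>UNIV. a i j * wedge (dz i) (dz j) u v))"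

definition bidegree_1_1 :: "((complex, 'n::finite) vec \<Rightarrow> (complex, 'n) vec \<Rightarrow> complex) \<Rightarrow> bool" where
  "bidegree_1_1 \<beta> \<longleftrightarrow>
     (\<exists>a. \<forall>u v. \<beta> u v = (\<Sum>i\<in>UNIV. \<Sum>j\<in>UNIV. a i j * wedge (dz i) (dzbar j) u v))"

definition bidegree_0_2 :: "((complex, 'n::finite) vec \<Rightarrow> (complex, 'n) vec \<Rightarrow> complex) \<Rightarrow> bool" where
  "bidegree_0_2 \<beta> \<longleftrightarrow>
     (\<exists>a. \<forall>u v. \<beta> u v = (\<Sum>i\<in>UNIV. \<Sum>j\<in>UNIV. a i j * wedge (dzbar i) (dzbar j) u v))"

definition bidegree_decomposition where
  "bidegree_decomposition \<alpha> \<beta>20 \<beta>11 \<beta>02 \<longleftrightarrow>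
     bidegree_2_0 \<beta>20 \<and> bidegree_1_1 \<beta>11 \<and> bidegree_0_2 \<beta>02 \<and>
     (\<forall>u v. \<alpha> u v = \<beta>20 u v + \<beta>11 u v + \<beta>02 u v)"

definition component_1_1 ::
    "((complex, 'n::finite) vec \<Rightarrow> (complex, 'n) vec \<Rightarrow> complex) \<Rightarrow>
     (complex, 'n) vec \<Rightarrow> (complex, 'n) vec \<Rightarrow> complex" where
  "component_1_1 \<alpha> = (THE \<beta>11. \<exists>\<beta>20 \<beta>02. bidegree_decomposition \<alpha> \<beta>20 \<beta>11 \<beta>02)"

abbreviation complexify :: "('a \<Rightarrow> 'a \<Rightarrow> real) \<Rightarrow> 'a \<Rightarrow> 'a \<Rightarrow> complex" where
  "complexify \<alpha> \<equiv> (\<lambda>u v. complex_of_real (\<alpha> u v))"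

text \<open>The bidegree decomposition of an alternating form exists and is unique, so \<^const>\<open>component_1_1\<close>
  is well defined.\<close>

lemma bidegree_2_0_scale:
  "bidegree_2_0 \<beta> \<Longrightarrow> \<beta> (\<i> *s u) (\<i> *s v) = - \<beta> u v"
  by (auto simp: bidegree_2_0_def wedge_def dz_def sum_negf[symmetric] algebra_simps
      intro!: sum.cong)

lemma bidegree_0_2_scale:
  "bidegree_0_2 \<beta> \<Longrightarrow> \<beta> (\<i> *s u) (\<i> *s v) = - \<beta> u v"
  by (auto simp: bidegree_0_2_def wedge_def dzbar_def sum_negf[symmetric] algebra_simps
      intro!: sum.cong)

lemma bidegree_1_1_scale:
  "bidegree_1_1 \<beta> \<Longrightarrow> \<beta> (\<i> *s u) (\<i> *s v) = \<beta> u v"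
  by (auto simp: bidegree_1_1_def wedge_def dz_def dzbar_def algebra_simps intro!: sum.cong)

lemma bidegree_decomposition_1_1_eq:
  assumes "bidegree_decomposition \<alpha> \<beta>20 \<beta>11 \<beta>02"
  shows "\<beta>11 u v = (\<alpha> u v + \<alpha> (\<i> *s u) (\<i> *s v)) / 2"
  using assms bidegree_2_0_scale[of \<beta>20 u v] bidegree_0_2_scale[of \<beta>02 u v]
    bidegree_1_1_scale[of \<beta>11 u v]
  by (simp add: bidegree_decomposition_def)

lemma real_linear_dz_expansion:
  fixes f :: "(complex, 'n::finite) vec \<Rightarrow> complex"
  assumes "linear f"
  shows "f u = (\<Sum>i\<in>UNIV. (f (axis i 1) - \<i> * f (axis i \<i>)) / 2 * dz i u
                        + (f (axis i 1) + \<i> * f (axis i \<i>)) / 2 * dzbar i u)"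
proof -
  have "u = (\<Sum>i\<in>UNIV. Re (u $ i) *\<^sub>R axis i 1 + Im (u $ i) *\<^sub>R axis i \<i>)"
  proof (subst vec_eq_iff, intro allI)
    fix k
    have "(\<Sum>i\<in>UNIV. Re (u $ i) *\<^sub>R axis i 1 + Im (u $ i) *\<^sub>R axis i \<i>) $ k =
          (\<Sum>i\<in>UNIV. if i = k then u $ k else 0)"
      unfolding sum_component by (intro sum.cong) (auto simp: axis_def complex_eq_iff)
    then show "u $ k = (\<Sum>i\<in>UNIV. Re (u $ i) *\<^sub>R axis i 1 + Im (u $ i) *\<^sub>R axis i \<i>) $ k"
      by simp
  qed
  then have "f u = f (\<Sum>i\<in>UNIV. Re (u $ i) *\<^sub>R axis i 1 + Im (u $ i) *\<^sub>R axis i \<i>)"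
    by simp
  also have "\<dots> = (\<Sum>i\<in>UNIV. Re (u $ i) *\<^sub>R f (axis i 1) + Im (u $ i) *\<^sub>R f (axis i \<i>))"
    by (simp add: linear_sum[OF assms] linear_add[OF assms] linear_cmul[OF assms])
  also have "\<dots> = (\<Sum>i\<in>UNIV. (f (axis i 1) - \<i> * f (axis i \<i>)) / 2 * dz i u
                        + (f (axis i 1) + \<i> * f (axis i \<i>)) / 2 * dzbar i u)"
    by (intro sum.cong refl) (simp add: dz_def dzbar_def complex_eq_iff field_simps)
  finally show ?thesis .
qed

lemma bidegree_decomposition_exists:
  assumes bil: "bilinear \<alpha>" and alt: "\<And>u. \<alpha> u u = 0"
  shows "\<exists>\<beta>20 \<beta>11 \<beta>02. bidegree_decomposition \<alpha> \<beta>20 \<beta>11 \<beta>02"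
proof -
  define P where "P f i = (f (axis i 1) - \<i> * f (axis i \<i>)) / 2"
    for f :: "(complex, 'a) vec \<Rightarrow> complex" and i
  define Q where "Q f i = (f (axis i 1) + \<i> * f (axis i \<i>)) / 2"
    for f :: "(complex, 'a) vec \<Rightarrow> complex" and i
  have lin: "linear (\<alpha> u)" "linear (\<lambda>u. \<alpha> u v)" for u v
    using bil by (auto simp: bilinear_def)
  have skew: "\<alpha> v u = - \<alpha> u v" for u v
  proof -
    have "\<alpha> (u + v) (u + v) = \<alpha> u u + \<alpha> v u + (\<alpha> u v + \<alpha> v v)"
      by (simp add: bilinear_ladd[OF bil] bilinear_radd[OF bil])
    then show ?thesis by (simp add: alt add_eq_0_iff)
  qed
  have exp: "f u = (\<Sum>i\<in>UNIV. P f i * dz i u + Q f i * dzbar i u)" if "linear f" for f u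
    unfolding P_def Q_def by (rule real_linear_dz_expansion[OF that])
  have ladd: "\<alpha> (u + u') w = \<alpha> u w + \<alpha> u' w" and lscale: "\<alpha> (r *\<^sub>R u) w = of_real r * \<alpha> u w"
    for u u' w r
    by (simp_all only: bilinear_ladd[OF bil] bilinear_lmul[OF bil]
        scaleR_conv_of_real[where 'a=complex])
  have lP: "linear (\<lambda>u. P (\<alpha> u) i)" for i
    unfolding P_def
    by (rule linearI) (simp_all only: ladd lscale scaleR_conv_of_real[where 'a=complex], simp_all add: field_simps)
  have lQ: "linear (\<lambda>u. Q (\<alpha> u) i)" for i
    unfolding Q_def
    by (rule linearI) (simp_all only: ladd lscale scaleR_conv_of_real[where 'a=complex], simp_all add: field_simps)
  define a where "a i j = P (\<lambda>u. P (\<alpha> u) j) i" for i j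
  define b where "b i j = P (\<lambda>u. Q (\<alpha> u) j) i" for i j
  define c where "c i j = Q (\<lambda>u. P (\<alpha> u) j) i" for i j
  define e where "e i j = Q (\<lambda>u. Q (\<alpha> u) j) i" for i j
  let ?z = dz and ?y = dzbar
  have pa: "P (\<alpha> u) j = (\<Sum>i\<in>UNIV. a i j * ?z i u + c i j * ?y i u)" for u j
    unfolding a_def c_def by (rule exp[OF lP])
  have qa: "Q (\<alpha> u) j = (\<Sum>i\<in>UNIV. b i j * ?z i u + e i j * ?y i u)" for u j
    unfolding b_def e_def by (rule exp[OF lQ])
  have main: "\<alpha> u v = (\<Sum>i\<in>UNIV. \<Sum>j\<in>UNIV. a i j * (?z i u * ?z j v) + b i j * (?z i u * ?y j v)
      + c i j * (?y i u * ?z j v) + e i j * (?y i u * ?y j v))" for u v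
  proof -
    have "\<alpha> u v = (\<Sum>j\<in>UNIV. P (\<alpha> u) j * ?z j v + Q (\<alpha> u) j * ?y j v)"
      by (rule exp[OF lin(1)])
    also have "\<dots> = (\<Sum>j\<in>UNIV. (\<Sum>i\<in>UNIV. a i j * ?z i u + c i j * ?y i u) * ?z j v
         + (\<Sum>i\<in>UNIV. b i j * ?z i u + e i j * ?y i u) * ?y j v)"
      by (simp only: pa qa)
    also have "\<dots> = (\<Sum>j\<in>UNIV. \<Sum>i\<in>UNIV. a i j * (?z i u * ?z j v) + b i j * (?z i u * ?y j v)
      + c i j * (?y i u * ?z j v) + e i j * (?y i u * ?y j v))"
      unfolding sum_distrib_right sum.distrib[symmetric]
      by (intro sum.cong refl) (simp add: algebra_simps)
    finally show ?thesis by (subst (asm) sum.swap)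
  qed
  have *: "\<alpha> u v = (\<alpha> u v - \<alpha> v u) / 2" for u v
    by (simp add: skew[of v u])
  have key: "\<alpha> u v = (\<Sum>i\<in>UNIV. \<Sum>j\<in>UNIV. a i j / 2 * wedge (?z i) (?z j) u v)
     + ((\<Sum>i\<in>UNIV. \<Sum>j\<in>UNIV. b i j / 2 * wedge (?z i) (?y j) u v)
       + (\<Sum>i\<in>UNIV. \<Sum>j\<in>UNIV. c i j / 2 * wedge (?y i) (?z j) u v))
     + (\<Sum>i\<in>UNIV. \<Sum>j\<in>UNIV. e i j / 2 * wedge (?y i) (?y j) u v)" for u v
    apply (subst *)
    apply (subst (1 2) main)
    unfolding sum_subtractf[symmetric] sum.distrib[symmetric] sum_divide_distrib
    by (intro sum.cong refl) (simp add: wedge_def field_simps)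
  have swap: "(\<Sum>i\<in>UNIV. \<Sum>j\<in>UNIV. c i j / 2 * wedge (?y i) (?z j) u v)
      = (\<Sum>i\<in>UNIV. \<Sum>j\<in>UNIV. - c j i / 2 * wedge (?z i) (?y j) u v)" for u v
    by (subst sum.swap) (intro sum.cong refl, simp add: wedge_def field_simps)
  have key11: "(\<Sum>i\<in>UNIV. \<Sum>j\<in>UNIV. b i j / 2 * wedge (?z i) (?y j) u v)
       + (\<Sum>i\<in>UNIV. \<Sum>j\<in>UNIV. c i j / 2 * wedge (?y i) (?z j) u v)
     = (\<Sum>i\<in>UNIV. \<Sum>j\<in>UNIV. (b i j / 2 - c j i / 2) * wedge (?z i) (?y j) u v)" for u v
    unfolding swap sum.distrib[symmetric] by (intro sum.cong refl) (simp add: field_simps)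
  define B20 where "B20 u v = (\<Sum>i\<in>UNIV. \<Sum>j\<in>UNIV. a i j / 2 * wedge (?z i) (?z j) u v)" for u v
  define B11 where
    "B11 u v = (\<Sum>i\<in>UNIV. \<Sum>j\<in>UNIV. (b i j / 2 - c j i / 2) * wedge (?z i) (?y j) u v)" for u v
  define B02 where "B02 u v = (\<Sum>i\<in>UNIV. \<Sum>j\<in>UNIV. e i j / 2 * wedge (?y i) (?y j) u v)" for u v
  have "bidegree_2_0 B20"
    unfolding bidegree_2_0_def B20_def by (rule exI[of _ "\<lambda>i j. a i j / 2"]) simp
  moreover have "bidegree_1_1 B11"
    unfolding bidegree_1_1_def B11_def by (rule exI[of _ "\<lambda>i j. b i j / 2 - c j i / 2"]) simp
  moreover have "bidegree_0_2 B02"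
    unfolding bidegree_0_2_def B02_def by (rule exI[of _ "\<lambda>i j. e i j / 2"]) simp
  moreover have "\<alpha> u v = B20 u v + B11 u v + B02 u v" for u v
    unfolding B20_def B11_def B02_def by (rule key[unfolded key11])
  ultimately show ?thesis
    unfolding bidegree_decomposition_def by blast
qed

lemma component_1_1_unique:
  assumes "bidegree_decomposition \<alpha> \<beta>20 \<beta>11 \<beta>02"
  shows "component_1_1 \<alpha> = \<beta>11"
  unfolding component_1_1_def
proof (rule the_equality)
  show "\<exists>\<beta>20 \<beta>02. bidegree_decomposition \<alpha> \<beta>20 \<beta>11 \<beta>02"
    using assms by blast
next
  fix \<beta> assume "\<exists>\<beta>20 \<beta>02. bidegree_decomposition \<alpha> \<beta>20 \<beta> \<beta>02"
  then show "\<beta> = \<beta>11"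
    using bidegree_decomposition_1_1_eq[OF assms] bidegree_decomposition_1_1_eq
    by (metis (no_types, lifting) ext)
qed

lemma component_1_1_bidegree_1_1:
  assumes "bidegree_1_1 \<alpha>"
  shows "component_1_1 \<alpha> = \<alpha>"
proof -
  have "bidegree_2_0 (\<lambda>u v. 0)" "bidegree_0_2 (\<lambda>u v. 0)"
    by (auto simp: bidegree_2_0_def bidegree_0_2_def intro!: exI[of _ "\<lambda>i j. 0"])
  then show ?thesis
    using assms
    by (intro component_1_1_unique[of _ "\<lambda>u v. 0" _ "\<lambda>u v. 0"])
      (simp add: bidegree_decomposition_def)
qed

section \<open>Pseudo-Hermitian-symplectic and pseudo-Kaehler manifolds\<close>

definition pseudo_Hermitian_symplectic :: "('p, 'n::finite) charted_space \<Rightarrow> bool" where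
  "pseudo_Hermitian_symplectic M \<longleftrightarrow>
     complex_manifold M \<and>
     (\<exists>\<Omega>. symplectic_form M \<Omega> \<and>
        (\<forall>c\<in>atlas M. \<forall>x\<in>chart_image c. nondegenerate (component_1_1 (complexify (\<Omega> c x)))))"

definition pseudo_Kaehler :: "('p, 'n::finite) charted_space \<Rightarrow> bool" where
  "pseudo_Kaehler M \<longleftrightarrow>
     complex_manifold M \<and>
     (\<exists>F. symplectic_form M F \<and>
        (\<forall>c\<in>atlas M. \<forall>x\<in>chart_image c. bidegree_1_1 (complexify (F c x))))"

end

theory Submission
  imports Defs "HOL-Complex_Analysis.Complex_Analysis" "HOL-Real_Asymp.Real_Asymp"
begin

text \<open>Let \<open>S\<close> be the fibre over \<open>t0\<close> and \<open>g\<close> its biholomorphic map to \<open>X\<close>. The usual argument trivialises the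
  family smoothly by Ehresmann's theorem, keeps the given symplectic form \<open>\<Omega>\<close> fixed, lets the complex
  structure vary, and observes that non-degeneracy of the form and of its (1,1)-component is open.
  Here the trivialisation is replaced by an extension of \<open>g\<close> to a smooth map \<open>R\<close> from a
  neighbourhood of \<open>S\<close> in the total space to \<open>X\<close>: the form \<open>R\<^sup>*\<Omega>\<close> is closed there, so its restriction to
  every fibre is a closed form of the correct type, and over \<open>t0\<close> this restriction is \<open>g\<^sup>*\<Omega>\<close>.

  The extension (\<open>smooth_extension\<close>) is built by induction over a finite cover of the compact
  set \<open>S\<close>. Locally \<open>g\<close> extends because the total space has coordinates adapted to the submersion
  (\<open>adapted_coordinates_exist\<close>, from the inverse function theorem): let the extension depend only on the
  coordinates along the fibre. Two extensions agree on \<open>S\<close>, hence near \<open>S\<close> they take values close to each other, in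
  a ball of a chart of \<open>X\<close>, and can be interpolated there with a smooth cutoff (\<open>extendable_step\<close>).

  Openness (\<open>strongly_nondegenerate_nearby_fibres\<close>) also rests on adapted coordinates: the charts which they
  induce on all nearby fibres turn the restrictions of \<open>R\<^sup>*\<Omega>\<close> into a single continuous family of bilinear forms
  on a fixed vector space, and the unit sphere of that space is compact. A change of holomorphic charts has a complex
  linear bijective derivative, so non-degeneracy in one chart of a fibre gives it in all of them. The
  good points form an open neighbourhood of \<open>S\<close>, and since the family is proper this neighbourhood contains all
  fibres close to \<open>S\<close>.

  Three analytic facts are proved on the way: complex differentiable maps of several variables are
  smooth, second derivatives of smooth maps are symmetric (which makes pulling back commute with the
  exterior derivative), and continuous lifts through immersions are differentiable. The last one makes the
  charts of a fibre compatible, since by definition those are only required to be holomorphic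
  immersions into the total space.

  A pseudo-Kaehler form equals its own (1,1)-component, so the second claim is a case of the first.\<close>

section \<open>Functions of class \<open>C\<^sup>k\<close>\<close>

abbreviation fderiv :: "('a::real_normed_vector \<Rightarrow> 'b::real_normed_vector) \<Rightarrow> 'a \<Rightarrow> 'a \<Rightarrow> 'b" where
  "fderiv f x \<equiv> frechet_derivative f (at x)"

lemma Ck_on_SucI:
  assumes "\<And>x. x \<in> S \<Longrightarrow> (f has_derivative f' x) (at x)" "\<And>v. Ck_on k (\<lambda>x. f' x v) S"
  shows "Ck_on (Suc k) f S"
  unfolding Ck_on.simps using assms by blast

lemma Ck_on_SucE:
  assumes "Ck_on (Suc k) f S"
  obtains f' where "\<And>x. x \<in> S \<Longrightarrow> (f has_derivative f' x) (at x)" "\<And>v. Ck_on k (\<lambda>x. f' x v) S"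
  using assms unfolding Ck_on.simps by blast

lemma Ck_on_cong:
  assumes "open S" "\<And>x. x \<in> S \<Longrightarrow> f x = g x" "Ck_on k f S"
  shows "Ck_on k g S"
proof (cases k)
  case 0
  then show ?thesis using assms by (auto cong: continuous_on_cong)
next
  case (Suc m)
  then obtain f' where f': "\<And>x. x\<in>S \<Longrightarrow> (f has_derivative f' x) (at x)" "\<And>v. Ck_on m (\<lambda>x. f' x v) S"
    using assms(3) unfolding Suc by (elim Ck_on_SucE) blast
  have "(g has_derivative f' x) (at x)" if "x \<in> S" for x
    using has_derivative_transform_within_open[OF f'(1)[OF that] assms(1) that] assms(2) by blast
  then show ?thesis unfolding Suc using f'(2) by (rule Ck_on_SucI)
qed

lemma Ck_on_Suc_iff:
  assumes "open S"
  shows "Ck_on (Suc k) f S \<longleftrightarrow>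
     (\<forall>x\<in>S. f differentiable at x) \<and> (\<forall>v. Ck_on k (\<lambda>x. fderiv f x v) S)"
    (is "?L \<longleftrightarrow> ?R")
proof
  assume ?L
  then obtain f' where f': "\<And>x. x\<in>S \<Longrightarrow> (f has_derivative f' x) (at x)" "\<And>v. Ck_on k (\<lambda>x. f' x v) S"
    by (elim Ck_on_SucE) blast
  have eq: "f' x = fderiv f x" if "x \<in> S" for x
    using f'(1)[OF that] by (rule frechet_derivative_at)
  have "Ck_on k (\<lambda>x. fderiv f x v) S" for v
    by (rule Ck_on_cong[OF assms _ f'(2)[of v]]) (simp add: eq)
  then show ?R using f'(1) by (auto simp: differentiable_def)
next
  assume ?R
  then show ?L
    by (intro Ck_on_SucI[where f' = "\<lambda>x. fderiv f x"])
      (auto simp: frechet_derivative_works)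
qed

lemma Ck_on_subset: "Ck_on k f S \<Longrightarrow> T \<subseteq> S \<Longrightarrow> Ck_on k f T"
proof (induction k arbitrary: f)
  case 0
  then show ?case by (auto intro: continuous_on_subset)
next
  case (Suc k)
  obtain f' where f': "\<And>x. x\<in>S \<Longrightarrow> (f has_derivative f' x) (at x)" "\<And>v. Ck_on k (\<lambda>x. f' x v) S"
    using Suc.prems(1) by (elim Ck_on_SucE) blast
  show ?case
    by (rule Ck_on_SucI[where f' = f']) (use f' Suc.IH Suc.prems(2) in blast)+
qed

lemma Ck_on_imp_continuous_on: "Ck_on k f S \<Longrightarrow> continuous_on S f"
proof (cases k)
  case (Suc m)
  assume "Ck_on k f S"
  then show ?thesis
    unfolding Suc by (elim Ck_on_SucE) (meson continuous_at_imp_continuous_on has_derivative_continuous)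
qed simp

lemma Ck_on_Suc_imp: "Ck_on (Suc k) f S \<Longrightarrow> Ck_on k f S"
proof (induction k arbitrary: f)
  case 0
  then show ?case by (simp only: Ck_on.simps(1) Ck_on_imp_continuous_on)
next
  case (Suc k)
  obtain f' where f': "\<And>x. x\<in>S \<Longrightarrow> (f has_derivative f' x) (at x)" "\<And>v. Ck_on (Suc k) (\<lambda>x. f' x v) S"
    using Suc.prems(1) by (elim Ck_on_SucE) blast
  show ?case
    by (rule Ck_on_SucI[where f' = f']) (use f' Suc.IH in blast)+
qed

lemma Ck_on_local:
  assumes "\<And>x. x \<in> S \<Longrightarrow> \<exists>N. open N \<and> x \<in> N \<and> Ck_on k f N"
  shows "Ck_on k f S"
  using assms
proof (induction k arbitrary: f)
  case 0
  show ?case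
    unfolding Ck_on.simps
  proof (rule continuous_at_imp_continuous_on, rule ballI)
    fix x assume "x \<in> S"
    with 0 obtain N where "open N" "x \<in> N" "continuous_on N f" by force
    then show "isCont f x" by (simp add: continuous_on_eq_continuous_at)
  qed
next
  case (Suc k)
  have "f differentiable at x" if x: "x \<in> S" for x
    using Suc.prems[OF x] by (auto simp: Ck_on_Suc_iff simp del: Ck_on.simps)
  moreover have "Ck_on k (\<lambda>x. fderiv f x v) S" for v
  proof (rule Suc.IH)
    fix x assume "x \<in> S"
    with Suc.prems obtain N where "open N" "x \<in> N" "Ck_on (Suc k) f N" by blast
    then show "\<exists>N. open N \<and> x \<in> N \<and> Ck_on k (\<lambda>x. fderiv f x v) N"
      using Ck_on_Suc_iff by blast
  qed
  ultimately show ?case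
    by (intro Ck_on_SucI[where f' = "\<lambda>x. fderiv f x"])
      (auto simp: frechet_derivative_works)
qed

lemma Ck_on_const: "Ck_on k (\<lambda>x. c) S"
proof (induction k arbitrary: c)
  case (Suc k)
  show ?case
    by (rule Ck_on_SucI[where f' = "\<lambda>x v. 0"]) (simp_all add: Suc.IH)
qed (auto simp: continuous_on_const)

lemma Ck_on_compose_bounded_linear:
  assumes "bounded_linear L" "Ck_on k f S"
  shows "Ck_on k (\<lambda>x. L (f x)) S"
  using assms(2)
proof (induction k arbitrary: f)
  case 0
  then show ?case by (auto intro: bounded_linear.continuous_on[OF assms(1)])
next
  case (Suc k)
  obtain f' where f': "\<And>x. x\<in>S \<Longrightarrow> (f has_derivative f' x) (at x)" "\<And>v. Ck_on k (\<lambda>x. f' x v) S"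
    using Suc.prems by (elim Ck_on_SucE) blast
  show ?case
    by (rule Ck_on_SucI[where f' = "\<lambda>x v. L (f' x v)"])
      (auto intro: bounded_linear.has_derivative[OF assms(1)] Suc.IH f')
qed

lemma Ck_on_bounded_linear:
  assumes "bounded_linear L"
  shows "Ck_on k L S"
proof (cases k)
  case 0
  then show ?thesis by (simp add: linear_continuous_on assms)
next
  case (Suc m)
  show ?thesis
    unfolding Suc
    by (rule Ck_on_SucI[where f' = "\<lambda>x. L"]) (auto intro: bounded_linear_imp_has_derivative assms Ck_on_const)
qed

lemma Ck_on_add:
  assumes "Ck_on k f S" "Ck_on k g S"
  shows "Ck_on k (\<lambda>x. f x + g x) S"
  using assms
proof (induction k arbitrary: f g)
  case 0
  then show ?case by (auto intro: continuous_on_add)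
next
  case (Suc k)
  obtain f' where f': "\<And>x. x\<in>S \<Longrightarrow> (f has_derivative f' x) (at x)" "\<And>v. Ck_on k (\<lambda>x. f' x v) S"
    using Suc.prems(1) by (elim Ck_on_SucE) blast
  obtain g' where g': "\<And>x. x\<in>S \<Longrightarrow> (g has_derivative g' x) (at x)" "\<And>v. Ck_on k (\<lambda>x. g' x v) S"
    using Suc.prems(2) by (elim Ck_on_SucE) blast
  show ?case
    by (rule Ck_on_SucI[where f' = "\<lambda>x v. f' x v + g' x v"]) (auto intro: has_derivative_add Suc.IH f' g')
qed

lemma Ck_on_sum:
  assumes "finite I" "\<And>i. i \<in> I \<Longrightarrow> Ck_on k (f i) S"
  shows "Ck_on k (\<lambda>x. \<Sum>i\<in>I. f i x) S"
  using assms by (induction I rule: finite_induct) (auto intro: Ck_on_const Ck_on_add)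

lemma Ck_on_bilinear:
  assumes "bounded_bilinear B" "Ck_on k f S" "Ck_on k g S"
  shows "Ck_on k (\<lambda>x. B (f x) (g x)) S"
  using assms(2,3)
proof (induction k arbitrary: f g)
  case 0
  then show ?case by (auto intro: bounded_bilinear.continuous_on[OF assms(1)])
next
  case (Suc k)
  obtain f' where f': "\<And>x. x\<in>S \<Longrightarrow> (f has_derivative f' x) (at x)" "\<And>v. Ck_on k (\<lambda>x. f' x v) S"
    using Suc.prems(1) by (elim Ck_on_SucE) blast
  obtain g' where g': "\<And>x. x\<in>S \<Longrightarrow> (g has_derivative g' x) (at x)" "\<And>v. Ck_on k (\<lambda>x. g' x v) S"
    using Suc.prems(2) by (elim Ck_on_SucE) blast
  have "((\<lambda>x. B (f x) (g x)) has_derivative (\<lambda>v. B (f x) (g' x v) + B (f' x v) (g x))) (at x)" if "x \<in> S" for x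
    by (rule bounded_bilinear.FDERIV[OF assms(1) f'(1)[OF that] g'(1)[OF that]])
  moreover have "Ck_on k (\<lambda>x. B (f x) (g' x v) + B (f' x v) (g x)) S" for v
    by (intro Ck_on_add Suc.IH f'(2) g'(2) Ck_on_Suc_imp[OF Suc.prems(1)] Ck_on_Suc_imp[OF Suc.prems(2)])
  ultimately show ?case by (rule Ck_on_SucI)
qed

text \<open>The derivative of the composition in direction \<open>v\<close> is expanded in a basis of the middle space: then only
  derivatives of \<open>g\<close> in fixed directions occur, and to these the induction hypothesis applies.\<close>

lemma Ck_on_compose:
  fixes f :: "'a::euclidean_space \<Rightarrow> 'b::euclidean_space" and g :: "'b \<Rightarrow> 'c::real_normed_vector"
  assumes "Ck_on k f S" "Ck_on k g T" "f ` S \<subseteq> T"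
  shows "Ck_on k (\<lambda>x. g (f x)) S"
  using assms(1,2)
proof (induction k arbitrary: g)
  case 0
  then show ?case using assms(3) by (auto intro: continuous_on_compose2)
next
  case (Suc k)
  obtain f' where f': "\<And>x. x\<in>S \<Longrightarrow> (f has_derivative f' x) (at x)" "\<And>v. Ck_on k (\<lambda>x. f' x v) S"
    using Suc.prems(1) by (elim Ck_on_SucE) blast
  obtain g' where g': "\<And>x. x\<in>T \<Longrightarrow> (g has_derivative g' x) (at x)" "\<And>v. Ck_on k (\<lambda>x. g' x v) T"
    using Suc.prems(2) by (elim Ck_on_SucE) blast
  define h where "h x v = (\<Sum>b\<in>Basis. (f' x v \<bullet> b) *\<^sub>R g' (f x) b)" for x v
  have "((\<lambda>x. g (f x)) has_derivative h x) (at x)" if x: "x \<in> S" for x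
  proof -
    have fx: "f x \<in> T" using x assms(3) by auto
    have lin: "linear (g' (f x))" using g'(1)[OF fx] has_derivative_linear by blast
    have "g' (f x) (f' x v) = h x v" for v
      unfolding h_def
      by (subst euclidean_representation[symmetric, of "f' x v"])
        (simp add: linear_sum[OF lin] linear_cmul[OF lin])
    then show ?thesis
      using has_derivative_compose[OF f'(1)[OF x] g'(1)[OF fx]] by simp
  qed
  moreover have "Ck_on k (\<lambda>x. h x v) S" for v
    unfolding h_def
    by (intro Ck_on_sum Ck_on_bilinear[OF bounded_bilinear_scaleR]
        Ck_on_compose_bounded_linear[OF bounded_linear_inner_left] f'(2) Suc.IH g'(2)
        Ck_on_Suc_imp[OF Suc.prems(1)] finite_Basis)
  ultimately show ?case by (rule Ck_on_SucI)
qed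

lemma bounded_linear_axis: "bounded_linear (axis i :: complex \<Rightarrow> (complex, 'm::finite) vec)"
  unfolding linear_conv_bounded_linear[symmetric]
  by (rule linearI) (auto simp: axis_def vec_eq_iff)

lemma vec_eq_sum_axis: "(v :: (complex, 'm::finite) vec) = (\<Sum>i\<in>UNIV. axis i (v $ i))"
proof (subst vec_eq_iff, intro allI)
  fix k
  have "(\<Sum>i\<in>UNIV. axis i (v $ i)) $ k = (\<Sum>i\<in>UNIV. if i = k then v $ i else 0)"
    unfolding sum_component by (intro sum.cong) (auto simp: axis_def)
  then show "v $ k = (\<Sum>i\<in>UNIV. axis i (v $ i)) $ k" by simp
qed

lemma Ck_on_vec:
  fixes f :: "'a::euclidean_space \<Rightarrow> (complex, 'm::finite) vec"
  assumes "\<And>i. Ck_on k (\<lambda>x. f x $ i) S"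
  shows "Ck_on k f S"
proof -
  have "Ck_on k (\<lambda>x. \<Sum>i\<in>UNIV. axis i (f x $ i)) S"
    by (intro Ck_on_sum Ck_on_compose_bounded_linear[OF bounded_linear_axis] assms) simp
  then show ?thesis by (simp only: vec_eq_sum_axis[symmetric])
qed

section \<open>Smooth functions\<close>

lemma smooth_onD: "smooth_on f S \<Longrightarrow> Ck_on k f S"
  by (simp add: smooth_on_def)

lemma smooth_on_cong: "open S \<Longrightarrow> (\<And>x. x \<in> S \<Longrightarrow> f x = g x) \<Longrightarrow> smooth_on f S \<Longrightarrow> smooth_on g S"
  unfolding smooth_on_def using Ck_on_cong by blast

lemma smooth_on_subset: "smooth_on f S \<Longrightarrow> T \<subseteq> S \<Longrightarrow> smooth_on f T"
  unfolding smooth_on_def using Ck_on_subset by blast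

lemma smooth_on_local:
  "(\<And>x. x \<in> S \<Longrightarrow> \<exists>N. open N \<and> x \<in> N \<and> smooth_on f N) \<Longrightarrow> smooth_on f S"
  unfolding smooth_on_def by (intro allI Ck_on_local) blast

lemma smooth_on_const: "smooth_on (\<lambda>x. c) S"
  by (simp add: smooth_on_def Ck_on_const)

lemma smooth_on_bounded_linear: "bounded_linear L \<Longrightarrow> smooth_on L S"
  by (simp add: smooth_on_def Ck_on_bounded_linear)

lemma smooth_on_compose_bounded_linear:
  "bounded_linear L \<Longrightarrow> smooth_on f S \<Longrightarrow> smooth_on (\<lambda>x. L (f x)) S"
  unfolding smooth_on_def by (rule allI, rule Ck_on_compose_bounded_linear, assumption, erule spec)

lemma smooth_on_add: "smooth_on f S \<Longrightarrow> smooth_on g S \<Longrightarrow> smooth_on (\<lambda>x. f x + g x) S"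
  by (simp add: smooth_on_def Ck_on_add)

lemma smooth_on_minus: "smooth_on f S \<Longrightarrow> smooth_on (\<lambda>x. - f x) S"
  by (rule smooth_on_compose_bounded_linear[OF bounded_linear_minus[OF bounded_linear_ident]])

lemma smooth_on_diff: "smooth_on f S \<Longrightarrow> smooth_on g S \<Longrightarrow> smooth_on (\<lambda>x. f x - g x) S"
  using smooth_on_add[OF _ smooth_on_minus[of g S], of f] by simp

lemma smooth_on_sum:
  "finite I \<Longrightarrow> (\<And>i. i \<in> I \<Longrightarrow> smooth_on (f i) S) \<Longrightarrow> smooth_on (\<lambda>x. \<Sum>i\<in>I. f i x) S"
  by (simp add: smooth_on_def Ck_on_sum)

lemma smooth_on_bilinear:
  "bounded_bilinear B \<Longrightarrow> smooth_on f S \<Longrightarrow> smooth_on g S \<Longrightarrow> smooth_on (\<lambda>x. B (f x) (g x)) S"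
  unfolding smooth_on_def by (rule allI, rule Ck_on_bilinear, assumption, erule spec, erule spec)

lemmas smooth_on_scaleR = smooth_on_bilinear[OF bounded_bilinear_scaleR]
lemmas smooth_on_mult = smooth_on_bilinear[OF bounded_bilinear_mult]
lemmas smooth_on_inner = smooth_on_bilinear[OF bounded_bilinear_inner]

lemma smooth_on_compose:
  fixes f :: "'a::euclidean_space \<Rightarrow> 'b::euclidean_space" and g :: "'b \<Rightarrow> 'c::real_normed_vector"
  assumes "smooth_on f S" "smooth_on g T" "f ` S \<subseteq> T"
  shows "smooth_on (\<lambda>x. g (f x)) S"
  unfolding smooth_on_def
  by (rule allI, rule Ck_on_compose[OF smooth_onD[OF assms(1)] smooth_onD[OF assms(2)] assms(3)])

lemma smooth_on_imp_continuous_on: "smooth_on f S \<Longrightarrow> continuous_on S f"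
  by (rule Ck_on_imp_continuous_on[OF smooth_onD])

lemma smooth_on_has_derivative:
  assumes "smooth_on f S" "x \<in> S"
  shows "(f has_derivative fderiv f x) (at x)"
proof -
  have "Ck_on (Suc 0) f S" using assms(1) by (rule smooth_onD)
  then obtain f' where "\<And>x. x \<in> S \<Longrightarrow> (f has_derivative f' x) (at x)" by (elim Ck_on_SucE) blast
  then show ?thesis using assms(2) by (metis frechet_derivative_at)
qed

lemma smooth_on_derivative:
  assumes "smooth_on f S" "open S"
  shows "smooth_on (\<lambda>x. fderiv f x v) S"
  unfolding smooth_on_def
proof
  fix k
  have "Ck_on (Suc k) f S" using assms(1) by (rule smooth_onD)
  then show "Ck_on k (\<lambda>x. fderiv f x v) S" using Ck_on_Suc_iff[OF assms(2)] by blast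
qed

text \<open>A family that contains, up to constant coefficients, the derivatives of its members consists of smooth
  functions; this is how iterated derivatives of explicit functions are controlled.\<close>

lemma smooth_on_family:
  fixes F :: "'i \<Rightarrow> real \<Rightarrow> real"
  assumes "\<And>i x. x \<in> S \<Longrightarrow> (F i has_field_derivative (a i * F (p i) x + b i * F (q i) x)) (at x)"
  shows "smooth_on (F i) S"
proof -
  have "Ck_on k (F i) S" for k
  proof (induction k arbitrary: i)
    case 0
    show ?case using assms by (auto intro!: continuous_at_imp_continuous_on DERIV_isCont)
  next
    case (Suc k)
    show ?case
    proof (rule Ck_on_SucI)
      show "(F i has_derivative (\<lambda>v. (a i * F (p i) x + b i * F (q i) x) * v)) (at x)" if "x \<in> S" for x
        using assms[OF that] by (simp add: has_field_derivative_def)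
      show "Ck_on k (\<lambda>x. (a i * F (p i) x + b i * F (q i) x) * v) S" for v
        by (intro Ck_on_bilinear[OF bounded_bilinear_mult] Ck_on_add Ck_on_const Suc.IH)
    qed
  qed
  then show ?thesis by (simp add: smooth_on_def)
qed

lemma smooth_on_inverse: "smooth_on (inverse :: real \<Rightarrow> real) {x. x > 0}"
proof -
  have "smooth_on (\<lambda>x. inverse x ^ Suc 0) {x::real. x > 0}"
  proof (rule smooth_on_family[where F = "\<lambda>j x. inverse x ^ Suc j" and i = 0
        and a = "\<lambda>j. - real (Suc j)" and p = Suc and b = "\<lambda>j. 0" and q = id])
    fix j and x :: real assume "x \<in> {x. x > 0}"
    then have inv: "(inverse has_field_derivative - (inverse x * inverse x)) (at x)"
      using DERIV_inverse[of x UNIV] by (simp add: power2_eq_square)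
    show "((\<lambda>x. inverse x ^ Suc j) has_field_derivative
         - real (Suc j) * inverse x ^ Suc (Suc j) + 0 * inverse x ^ Suc (id j)) (at x)"
      by (rule DERIV_cong[OF DERIV_power[OF inv, of "Suc j"]]) (simp add: algebra_simps)
  qed
  then show ?thesis by simp
qed

text \<open>The function \<open>exp (-1/x)\<close>, extended by \<open>0\<close>, is flat at \<open>0\<close>. Its products with the powers of \<open>1/x\<close> are
  included to obtain a family closed under differentiation.\<close>

definition flat_exp :: "nat \<Rightarrow> real \<Rightarrow> real" where
  "flat_exp j x = (if x > 0 then inverse x ^ j * exp (- inverse x) else 0)"

lemma flat_exp_derivative:
  "(flat_exp j has_field_derivative (- real j * flat_exp (Suc j) x + 1 * flat_exp (Suc (Suc j)) x)) (at x)"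
proof -
  consider "x > 0" | "x < 0" | "x = 0" by linarith
  then show ?thesis
  proof cases
    case 1
    have "((\<lambda>x. inverse x ^ j * exp (- inverse x)) has_field_derivative
        (- real j * flat_exp (Suc j) x + 1 * flat_exp (Suc (Suc j)) x)) (at x)"
    proof -
      have inv: "(inverse has_field_derivative - (inverse x * inverse x)) (at x)"
        using DERIV_inverse[of x UNIV] 1 by (simp add: power2_eq_square)
      have pow: "((\<lambda>x. inverse x ^ j) has_field_derivative - real j * inverse x ^ Suc j) (at x)"
      proof (cases j)
        case (Suc m)
        show ?thesis
          by (rule DERIV_cong[OF DERIV_power[OF inv, of j]]) (simp add: Suc algebra_simps)
      qed simp
      have ex: "((\<lambda>x. exp (- inverse x)) has_field_derivative exp (- inverse x) * (inverse x * inverse x)) (at x)"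
        by (rule DERIV_cong[OF DERIV_fun_exp[OF DERIV_minus[OF inv]]]) simp
      show ?thesis
        by (rule DERIV_cong[OF DERIV_mult[OF pow ex]]) (use 1 in \<open>simp add: flat_exp_def algebra_simps\<close>)
    qed
    then show ?thesis
    proof (rule has_field_derivative_transform_within_open[where S = "{0<..}"])
      show "inverse y ^ j * exp (- inverse y) = flat_exp j y" if "y \<in> {0<..}" for y
        using that by (simp add: flat_exp_def)
    qed (use 1 in auto)
  next
    case 2
    have "((\<lambda>x. 0) has_field_derivative
        (- real j * flat_exp (Suc j) x + 1 * flat_exp (Suc (Suc j)) x)) (at x)"
      using 2 by (simp add: flat_exp_def)
    then show ?thesis
    proof (rule has_field_derivative_transform_within_open[where S = "{..<0}"])
      show "0 = flat_exp j y" if "y \<in> {..<0}" for y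
        using that by (simp add: flat_exp_def)
    qed (use 2 in auto)
  next
    case 3
    have r: "((\<lambda>y. flat_exp j y / y) \<longlongrightarrow> 0) (at_right 0)"
    proof (rule Lim_transform_eventually)
      show "((\<lambda>y::real. (inverse y ^ j * exp (- inverse y)) / y) \<longlongrightarrow> 0) (at_right 0)"
        by real_asymp
      show "\<forall>\<^sub>F y in at_right 0. (inverse y ^ j * exp (- inverse y)) / y = flat_exp j y / y"
        by (simp add: eventually_at_filter flat_exp_def)
    qed
    have l: "((\<lambda>y. flat_exp j y / y) \<longlongrightarrow> 0) (at_left 0)"
    proof (rule Lim_transform_eventually)
      show "((\<lambda>y::real. 0::real) \<longlongrightarrow> 0) (at_left 0)" by simp
      show "\<forall>\<^sub>F y in at_left 0. 0 = flat_exp j y / y"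
        by (simp add: eventually_at_filter flat_exp_def)
    qed
    have "((\<lambda>y. flat_exp j y / y) \<longlongrightarrow> 0) (at 0)"
      by (rule filterlim_split_at[OF l r])
    then show ?thesis
      unfolding has_field_derivative_iff 3 by (simp add: flat_exp_def)
  qed
qed

lemma smooth_on_flat_exp: "smooth_on (flat_exp j) S"
  by (rule smooth_on_family[where F = flat_exp and a = "\<lambda>j. - real j" and p = Suc and b = "\<lambda>j. 1"
        and q = "\<lambda>j. Suc (Suc j)", OF flat_exp_derivative])

text \<open>A cutoff function: it is \<open>1\<close> up to \<open>a\<close> and \<open>0\<close> from \<open>b\<close> on.\<close>

definition smooth_step :: "real \<Rightarrow> real \<Rightarrow> real \<Rightarrow> real" where
  "smooth_step a b s = flat_exp 0 (b - s) / (flat_exp 0 (b - s) + flat_exp 0 (s - a))"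

lemma flat_exp_pos: "x > 0 \<Longrightarrow> flat_exp j x > 0"
  by (simp add: flat_exp_def)

lemma flat_exp_nonneg: "flat_exp j x \<ge> 0"
  by (simp add: flat_exp_def)

lemma smooth_step_denominator:
  assumes "a < b" shows "flat_exp 0 (b - s) + flat_exp 0 (s - a) > 0"
  using assms flat_exp_pos[of "b - s" 0] flat_exp_pos[of "s - a" 0] flat_exp_nonneg[of 0 "b - s"] flat_exp_nonneg[of 0 "s - a"]
  by (cases "s < b") linarith+

lemma smooth_step:
  assumes "a < b"
  shows "smooth_on (smooth_step a b) UNIV" "s \<le> a \<Longrightarrow> smooth_step a b s = 1" "b \<le> s \<Longrightarrow> smooth_step a b s = 0"
    "0 \<le> smooth_step a b s" "smooth_step a b s \<le> 1"
proof -
  note pos = smooth_step_denominator[OF assms]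
  have 1: "smooth_on (\<lambda>s. flat_exp 0 (b - s)) UNIV" "smooth_on (\<lambda>s. flat_exp 0 (s - a)) UNIV"
    by (rule smooth_on_compose[OF _ smooth_on_flat_exp[of 0 UNIV]];
      simp add: smooth_on_diff smooth_on_const smooth_on_bounded_linear[OF bounded_linear_ident])+
  then have "smooth_on (\<lambda>s. inverse (flat_exp 0 (b - s) + flat_exp 0 (s - a))) UNIV"
    by (intro smooth_on_compose[OF smooth_on_add[OF 1] smooth_on_inverse]) (use pos in auto)
  then show "smooth_on (smooth_step a b) UNIV"
    unfolding smooth_step_def[abs_def] divide_inverse by (rule smooth_on_mult[OF 1(1)])
  show "s \<le> a \<Longrightarrow> smooth_step a b s = 1" "b \<le> s \<Longrightarrow> smooth_step a b s = 0"
    using pos[of s] by (auto simp: smooth_step_def flat_exp_def)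
  show "0 \<le> smooth_step a b s" "smooth_step a b s \<le> 1"
    using pos[of s] flat_exp_nonneg[of 0 "b - s"] flat_exp_nonneg[of 0 "s - a"] by (auto simp: smooth_step_def)
qed

section \<open>Holomorphic maps are smooth\<close>

lemma bounded_linear_vector_smult: "bounded_linear (\<lambda>z::complex. z *s (v :: (complex, 'n::finite) vec))"
  unfolding linear_conv_bounded_linear[symmetric]
  by (rule linearI) (auto simp: vec_eq_iff algebra_simps)

lemma bounded_linear_vector_smult_right: "bounded_linear (\<lambda>v. (z::complex) *s (v :: (complex, 'n::finite) vec))"
  unfolding linear_conv_bounded_linear[symmetric]
  by (rule linearI) (auto simp: vec_eq_iff algebra_simps)

lemma continuous_on_vector_smult [continuous_intros]:
  fixes g :: "'b::topological_space \<Rightarrow> (complex, 'n::finite) vec"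
  assumes "continuous_on S f" "continuous_on S g"
  shows "continuous_on S (\<lambda>x. f x *s g x)"
  using continuous_on_vec_lambda[of S "\<lambda>i x. f x * g x $ i"] assms
  by (auto simp: vector_scalar_mult_def intro!: continuous_intros)

lemma norm_vector_smult: "norm (z *s (v :: (complex, 'n::finite) vec)) = norm z * norm v"
  by (simp add: norm_vec_def norm_mult L2_set_right_distrib)

text \<open>Complex differentiability for scalar functions. Unlike mere real differentiability this class is closed
  under directional derivatives, which is what makes its members smooth.\<close>

definition cdiff_on :: "((complex, 'n::finite) vec \<Rightarrow> complex) \<Rightarrow> (complex, 'n) vec set \<Rightarrow> bool" where
  "cdiff_on f S \<longleftrightarrow> (\<forall>x\<in>S. \<exists>f'. (f has_derivative f') (at x) \<and> (\<forall>a v. f' (a *s v) = a * f' v))"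

lemma cdiff_onD:
  assumes "cdiff_on f S" "x \<in> S"
  shows "(f has_derivative fderiv f x) (at x)"
    "fderiv f x (a *s v) = a * fderiv f x v"
proof -
  obtain f' where "(f has_derivative f') (at x)" "\<forall>a v. f' (a *s v) = a * f' v"
    using assms unfolding cdiff_on_def by blast
  moreover from this have "f' = fderiv f x" by (metis frechet_derivative_at)
  ultimately show "(f has_derivative fderiv f x) (at x)"
    "fderiv f x (a *s v) = a * fderiv f x v"
    by simp_all
qed

lemma cdiff_on_imp_continuous_on: "cdiff_on f S \<Longrightarrow> continuous_on S f"
  by (meson cdiff_onD(1) continuous_at_imp_continuous_on has_derivative_continuous)

text \<open>Cauchy's formula on the complex line through \<open>x\<close> in direction \<open>v\<close>.\<close>

lemma cdiff_on_Cauchy_derivative: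
  assumes f: "cdiff_on f S" and x: "\<And>z. norm z \<le> 1 \<Longrightarrow> x + z *s v \<in> S"
  shows "fderiv f x v =
    integral (cbox 0 1) (\<lambda>t::real. f (x + exp (2 * of_real pi * \<i> * of_real t) *s v) / exp (2 * of_real pi * \<i> * of_real t))"
proof -
  define g where "g z = f (x + z *s v)" for z
  have der: "(g has_field_derivative fderiv f (x + z *s v) v) (at z)" if "norm z \<le> 1" for z
  proof -
    have 1: "((\<lambda>z. x + z *s v) has_derivative (\<lambda>h. h *s v)) (at z)"
      using has_derivative_add[OF has_derivative_const[of x] bounded_linear_imp_has_derivative[OF bounded_linear_vector_smult[of v]]]
      by simp
    have "((\<lambda>z. f (x + z *s v)) has_derivative (\<lambda>h. fderiv f (x + z *s v) (h *s v))) (at z)"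
      by (rule has_derivative_compose[OF 1 cdiff_onD(1)[OF f x[OF that]]])
    moreover have "(\<lambda>h. fderiv f (x + z *s v) (h *s v)) = (*) (fderiv f (x + z *s v) v)"
      using cdiff_onD(2)[OF f x[OF that]] by (auto simp: mult.commute)
    ultimately show ?thesis unfolding has_field_derivative_def g_def by simp
  qed
  have "continuous_on (cball 0 1) g"
    by (intro continuous_at_imp_continuous_on ballI DERIV_isCont[OF der]) (simp add: dist_norm)
  moreover have "g holomorphic_on ball 0 1"
  proof (subst holomorphic_on_open, simp, intro ballI)
    fix z :: complex assume "z \<in> ball 0 1"
    then have "norm z \<le> 1" by (simp add: dist_norm)
    then show "\<exists>f'. (g has_field_derivative f') (at z)" using der by blast
  qed
  ultimately have "(g has_field_derivative (1 / (2 * of_real pi * \<i>) * contour_integral(circlepath 0 1) (\<lambda>u. g u / (u-0)^2))) (at 0)"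
    by (rule Cauchy_derivative_integral_circlepath(2)) simp
  moreover have "(g has_field_derivative fderiv f x v) (at 0)"
    using der[of 0] by simp
  ultimately have "fderiv f x v = 1 / (2 * of_real pi * \<i>) * contour_integral(circlepath 0 1) (\<lambda>u. g u / u^2)"
    using DERIV_unique by fastforce
  also have "\<dots> = integral {0..1} (\<lambda>t. 1 / (2 * of_real pi * \<i>) * (g (circlepath 0 1 t) / (circlepath 0 1 t)^2 * vector_derivative (circlepath 0 1) (at t)))"
    unfolding contour_integral_integral by (rule integral_mult_right[symmetric])
  also have "\<dots> = integral {0..1} (\<lambda>t. g (exp (2 * of_real pi * \<i> * of_real t)) / exp (2 * of_real pi * \<i> * of_real t))"
  proof (intro integral_cong)
    fix t :: real
    have vd: "vector_derivative (circlepath 0 1) (at t) = 2 * of_real pi * \<i> * exp (2 * of_real pi * \<i> * of_real t)"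
      by (simp add: vector_derivative_circlepath)
    have cp: "circlepath 0 1 t = exp (2 * of_real pi * \<i> * of_real t)"
      by (simp add: circlepath)
    define w where "w = exp (2 * of_real pi * \<i> * of_real t :: complex)"
    have "w \<noteq> 0" by (simp add: w_def)
    then show "1 / (2 * of_real pi * \<i>) * (g (circlepath 0 1 t) / (circlepath 0 1 t)^2 * vector_derivative (circlepath 0 1) (at t))
       = g (exp (2 * of_real pi * \<i> * of_real t)) / exp (2 * of_real pi * \<i> * of_real t)"
      unfolding vd cp w_def[symmetric] by (simp add: power2_eq_square field_simps)
  qed
  finally show ?thesis by (simp add: g_def)
qed

text \<open>After rescaling the direction, one radius serves for the complex discs around all centres near \<open>x0\<close>, so that
  Cauchy's formula can be differentiated with respect to the centre.\<close>

lemma open_contains_complex_discs: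
  fixes S :: "(complex, 'n::finite) vec set"
  assumes S: "open S" "x0 \<in> S"
  shows "\<exists>r>0. \<exists>c>0. \<forall>x\<in>ball x0 r. \<forall>z. norm z \<le> 1 \<longrightarrow> x + z *s (of_real c *s w) \<in> S"
proof -
  obtain R where R: "R > 0" "ball x0 R \<subseteq> S" using S openE by blast
  define a where "a = norm w + 1"
  have p: "a > 0" "norm w \<le> a" by (simp_all add: a_def add_nonneg_pos)
  define c where "c = R / (2 * a)"
  have c: "c > 0" using R p by (simp add: c_def)
  have "c * norm w \<le> c * a" using c p(2) by simp
  also have "\<dots> = R / 2" using p by (simp add: c_def)
  finally have cw: "c * norm w \<le> R / 2" .
  have "x + z *s (of_real c *s w) \<in> S" if "x \<in> ball x0 (R / 2)" "norm z \<le> 1" for x z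
  proof -
    have "norm (z *s (of_real c *s w)) \<le> norm (of_real c *s w)"
      using that(2) unfolding norm_vector_smult[of z] by (simp add: mult_left_le_one_le)
    also have "\<dots> \<le> R / 2" using c cw by (simp add: norm_vector_smult)
    finally have "dist x0 (x + z *s (of_real c *s w)) < R"
      using that(1) norm_triangle_ineq4[of "x0 - x" "z *s (of_real c *s w)"] by (simp add: dist_norm algebra_simps)
    then show ?thesis using R(2) by auto
  qed
  then show ?thesis using R(1) c by (intro exI[of _ "R / 2"] exI[of _ c] conjI) auto
qed

text \<open>Continuity of the derivative has to come first: Cauchy's formula expresses it through \<open>f\<close> itself, which is
  continuous, and differentiation under the integral sign requires it.\<close>

lemma cdiff_on_continuous_derivative:
  assumes f: "cdiff_on f S" and S: "open S"
  shows "continuous_on S (\<lambda>x. fderiv f x w)"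
proof (rule continuous_at_imp_continuous_on, rule ballI)
  fix x0 assume "x0 \<in> S"
  then obtain r c v where rc: "r > 0" "c > 0" and v_def: "v = of_real c *s w"
    and inS: "\<And>x z. x \<in> ball x0 r \<Longrightarrow> norm z \<le> 1 \<Longrightarrow> x + z *s v \<in> S"
    using open_contains_complex_discs[OF S, of x0 w] by metis
  note r = rc(1) and c = rc(2)
  have "continuous_on (ball x0 r) (\<lambda>x. integral (cbox 0 1) (\<lambda>t::real. f (x + exp (2 * of_real pi * \<i> * of_real t) *s v) / exp (2 * of_real pi * \<i> * of_real t)))"
  proof (rule integral_continuous_on_param, unfold case_prod_beta)
    show "continuous_on (ball x0 r \<times> cbox 0 1) (\<lambda>p. f (fst p + exp (2 * of_real pi * \<i> * of_real (snd p)) *s v) / exp (2 * of_real pi * \<i> * of_real (snd p)))"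
      by (intro continuous_intros continuous_on_compose2[OF cdiff_on_imp_continuous_on[OF f]]) (auto intro!: inS)
  qed
  then have "continuous_on (ball x0 r) (\<lambda>x. fderiv f x v)"
    by (rule continuous_on_eq) (rule cdiff_on_Cauchy_derivative[OF f, symmetric], erule (1) inS)
  then have "continuous_on (ball x0 r) (\<lambda>x. fderiv f x v / of_real c)"
    using c by (intro continuous_intros) auto
  moreover have "fderiv f x v / of_real c = fderiv f x w" if "x \<in> ball x0 r" for x
    using c cdiff_onD(2)[OF f, of x "of_real c" w] inS[OF that, of 0] by (simp add: v_def)
  ultimately have "continuous_on (ball x0 r) (\<lambda>x. fderiv f x w)"
    by (rule continuous_on_eq)
  then show "isCont (\<lambda>x. fderiv f x w) x0"
    using r(1) by (simp add: continuous_on_eq_continuous_at)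
qed

text \<open>Differentiating Cauchy's formula under the integral sign shows that directional derivatives
  are again complex differentiable.\<close>

lemma cdiff_on_directional_derivative:
  assumes f: "cdiff_on f S" and S: "open S"
  shows "cdiff_on (\<lambda>x. fderiv f x w) S"
  unfolding cdiff_on_def
proof
  fix x0 assume "x0 \<in> S"
  then obtain r c v where rc: "r > 0" "c > 0" and v_def: "v = of_real c *s w"
    and inS: "\<And>x z. x \<in> ball x0 r \<Longrightarrow> norm z \<le> 1 \<Longrightarrow> x + z *s v \<in> S"
    using open_contains_complex_discs[OF S, of x0 w] by metis
  note r = rc(1) and c = rc(2)
  define e where "e t = exp (2 * of_real pi * \<i> * of_real t)" for t :: real
  have ne: "norm (e t) = 1" "e t \<noteq> 0" for t by (simp_all add: e_def)
  have ce: "continuous_on A e" for A unfolding e_def by (intro continuous_intros)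
  define D where "D x t = Blinfun (\<lambda>u. fderiv f (x + e t *s v) u / e t)" for x t
  have D: "blinfun_apply (D x t) u = fderiv f (x + e t *s v) u / e t" if "x \<in> ball x0 r" for x t u
  proof -
    have "x + e t *s v \<in> S" by (rule inS[OF that]) (simp add: ne)
    then have "bounded_linear (fderiv f (x + e t *s v))"
      by (rule has_derivative_bounded_linear[OF cdiff_onD(1)[OF f]])
    then have "bounded_linear (\<lambda>u. fderiv f (x + e t *s v) u / e t)"
      by (rule bounded_linear_compose[OF bounded_linear_divide])
    then show ?thesis unfolding D_def by (simp add: bounded_linear_Blinfun_apply)
  qed
  let ?F = "\<lambda>x. integral (cbox 0 1) (\<lambda>t::real. f (x + e t *s v) / e t)"
  have ccomp: "continuous_on (ball x0 r \<times> cbox 0 1) (\<lambda>p. h (fst p + e (snd p) *s v) / e (snd p))"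
    if "continuous_on S h" for h
    using ne by (intro continuous_intros continuous_on_compose2[OF that] continuous_on_compose2[OF ce]) (auto intro!: inS)
  have Dc: "continuous_on (ball x0 r \<times> cbox 0 1) (\<lambda>(x, t). D x t)"
    unfolding case_prod_beta
  proof (rule continuous_on_blinfun_componentwise)
    fix i :: "(complex, 'a) vec"
    show "continuous_on (ball x0 r \<times> cbox 0 1) (\<lambda>p. blinfun_apply (D (fst p) (snd p)) i)"
      by (rule continuous_on_eq[OF ccomp[OF cdiff_on_continuous_derivative[OF f S, of i]]]) (auto simp: D)
  qed
  have "(?F has_derivative integral (cbox 0 1) (D x0)) (at x0 within ball x0 r)"
  proof (rule leibniz_rule[OF _ _ Dc])
    fix x t assume x: "x \<in> ball x0 r"
    have 1: "((\<lambda>x. x + e t *s v) has_derivative (\<lambda>h. h)) (at x)"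
      by (auto intro!: derivative_eq_intros)
    have "((\<lambda>x. f (x + e t *s v)) has_derivative fderiv f (x + e t *s v)) (at x)"
    proof -
      have "x + e t *s v \<in> S" by (rule inS[OF x]) (simp add: ne)
      from has_derivative_compose[OF 1 cdiff_onD(1)[OF f this]] show ?thesis .
    qed
    then have "((\<lambda>x. f (x + e t *s v) / e t) has_derivative (\<lambda>u. fderiv f (x + e t *s v) u / e t)) (at x)"
      by (rule bounded_linear.has_derivative[OF bounded_linear_divide])
    moreover have "blinfun_apply (D x t) = (\<lambda>u. fderiv f (x + e t *s v) u / e t)"
      using D[OF x] by auto
    ultimately show "((\<lambda>x. f (x + e t *s v) / e t) has_derivative blinfun_apply (D x t)) (at x within ball x0 r)"
      using has_derivative_at_withinI by auto
  next
    fix x assume x: "x \<in> ball x0 r"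
    have "continuous_on (cbox 0 1) (\<lambda>t. f (x + e t *s v) / e t)"
      using ne by (intro continuous_intros continuous_on_compose2[OF cdiff_on_imp_continuous_on[OF f]] ce) (auto intro!: inS[OF x])
    then show "(\<lambda>t. f (x + e t *s v) / e t) integrable_on cbox 0 1"
      by (rule integrable_continuous)
  qed (use r in auto)
  then have dF: "(?F has_derivative integral (cbox 0 1) (D x0)) (at x0)"
    using at_within_open[of x0 "ball x0 r"] r by simp
  have x0: "x0 \<in> ball x0 r" using r by simp
  have int: "D x0 integrable_on cbox 0 1"
  proof (rule integrable_continuous)
    have "continuous_on (cbox 0 1) (\<lambda>t. (\<lambda>(x, t). D x t) (x0, t))"
      by (rule continuous_on_compose2[OF Dc]) (use x0 in \<open>auto intro!: continuous_intros\<close>)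
    then show "continuous_on (cbox 0 1) (D x0)" by simp
  qed
  have app: "blinfun_apply (integral (cbox 0 1) (D x0)) u = integral (cbox 0 1) (\<lambda>t. fderiv f (x0 + e t *s v) u / e t)" for u
    unfolding blinfun_apply_integral[OF int] D[OF x0] ..
  have lin: "blinfun_apply (integral (cbox 0 1) (D x0)) (a *s u) = a * blinfun_apply (integral (cbox 0 1) (D x0)) u" for a u
  proof -
    have "integral (cbox 0 1) (\<lambda>t. fderiv f (x0 + e t *s v) (a *s u) / e t)
      = integral (cbox 0 1) (\<lambda>t. a * (fderiv f (x0 + e t *s v) u / e t))"
      using ne by (intro integral_cong) (simp add: cdiff_onD(2)[OF f inS[OF x0]])
    also have "\<dots> = a * integral (cbox 0 1) (\<lambda>t. fderiv f (x0 + e t *s v) u / e t)"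
      by (rule integral_mult_right)
    finally show ?thesis unfolding app .
  qed
  have eq: "?F x / of_real c = fderiv f x w" if "x \<in> ball x0 r" for x
  proof -
    have "?F x = fderiv f x v"
      unfolding e_def by (rule cdiff_on_Cauchy_derivative[OF f, symmetric]) (rule inS[OF that])
    also have "\<dots> = of_real c * fderiv f x w"
      using cdiff_onD(2)[OF f, of x "of_real c" w] inS[OF that, of 0] by (simp add: v_def)
    finally show ?thesis using c by simp
  qed
  have "((\<lambda>x. ?F x / of_real c) has_derivative (\<lambda>u. blinfun_apply (integral (cbox 0 1) (D x0)) u / of_real c)) (at x0)"
    by (rule bounded_linear.has_derivative[OF bounded_linear_divide dF])
  then have "((\<lambda>x. fderiv f x w) has_derivative (\<lambda>u. blinfun_apply (integral (cbox 0 1) (D x0)) u / of_real c)) (at x0)"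
    by (rule has_derivative_transform_within_open[OF _ open_ball x0 eq])
  then show "\<exists>f'. ((\<lambda>x. fderiv f x w) has_derivative f') (at x0) \<and> (\<forall>a v. f' (a *s v) = a * f' v)"
    by (intro exI conjI allI, assumption) (simp only: lin times_divide_eq_right)
qed

lemma cdiff_on_imp_smooth_on:
  assumes "cdiff_on f S" "open S"
  shows "smooth_on f S"
  unfolding smooth_on_def
proof
  fix k
  show "Ck_on k f S"
    using assms(1)
  proof (induction k arbitrary: f)
    case 0
    then show ?case by (simp add: cdiff_on_imp_continuous_on)
  next
    case (Suc k)
    show ?case
      by (rule Ck_on_SucI[OF cdiff_onD(1)[OF Suc.prems] Suc.IH[OF cdiff_on_directional_derivative[OF Suc.prems assms(2)]]])
  qed
qed

lemma holomorphic_map_onD: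
  assumes "holomorphic_map_on f S" "x \<in> S"
  shows "(f has_derivative fderiv f x) (at x)"
    "fderiv f x (a *s v) = a *s fderiv f x v"
proof -
  obtain f' where "(f has_derivative f') (at x)" "\<forall>a v. f' (a *s v) = a *s f' v"
    using assms unfolding holomorphic_map_on_def by blast
  moreover from this have "f' = fderiv f x" by (metis frechet_derivative_at)
  ultimately show "(f has_derivative fderiv f x) (at x)"
    "fderiv f x (a *s v) = a *s fderiv f x v"
    by simp_all
qed

lemma holomorphic_map_on_imp_smooth_on:
  assumes "holomorphic_map_on f S" "open S"
  shows "smooth_on f S"
proof -
  have "cdiff_on (\<lambda>x. f x $ i) S" for i
    unfolding cdiff_on_def
  proof
    fix x assume "x \<in> S"
    note h = holomorphic_map_onD[OF assms(1) this]
    have "((\<lambda>x. f x $ i) has_derivative (\<lambda>v. fderiv f x v $ i)) (at x)"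
      by (rule bounded_linear.has_derivative[OF bounded_linear_vec_nth h(1)])
    then show "\<exists>f'. ((\<lambda>x. f x $ i) has_derivative f') (at x) \<and> (\<forall>a v. f' (a *s v) = a * f' v)"
      by (intro exI conjI) (auto simp: h(2))
  qed
  then have "smooth_on (\<lambda>x. f x $ i) S" for i using cdiff_on_imp_smooth_on assms(2) by blast
  then show ?thesis unfolding smooth_on_def by (intro allI Ck_on_vec) blast
qed

section \<open>Symmetry of second derivatives\<close>

text \<open>The left-hand side is symmetric in \<open>u\<close> and \<open>v\<close>, while two applications of the mean value theorem evaluate it
  as a second derivative taken in a definite order.\<close>

lemma second_difference_quotient:
  fixes f :: "'a::euclidean_space \<Rightarrow> real"
  assumes f: "smooth_on f S" "open S" and s: "s > 0"
    and inS: "\<And>a b. 0 \<le> a \<Longrightarrow> a \<le> s \<Longrightarrow> 0 \<le> b \<Longrightarrow> b \<le> s \<Longrightarrow> x + a *\<^sub>R u + b *\<^sub>R v \<in> S"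
  obtains a b where "0 < a" "a < s" "0 < b" "b < s"
    "f (x + s *\<^sub>R u + s *\<^sub>R v) - f (x + s *\<^sub>R u) - f (x + s *\<^sub>R v) + f x
       = s * (s * fderiv (\<lambda>y. fderiv f y u) (x + a *\<^sub>R u + b *\<^sub>R v) v)"
proof -
  have line: "((\<lambda>a. h (y + a *\<^sub>R w)) has_real_derivative fderiv h (y + a *\<^sub>R w) w) (at a)"
    if "smooth_on h S" "y + a *\<^sub>R w \<in> S" for h :: "'a \<Rightarrow> real" and y w a
  proof -
    have 1: "((\<lambda>a. y + a *\<^sub>R w) has_derivative (\<lambda>h. h *\<^sub>R w)) (at a)"
      by (auto intro!: derivative_eq_intros)
    have hd: "(h has_derivative fderiv h (y + a *\<^sub>R w)) (at (y + a *\<^sub>R w))"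
      by (rule smooth_on_has_derivative[OF that])
    have "((\<lambda>a. h (y + a *\<^sub>R w)) has_derivative (\<lambda>c. fderiv h (y + a *\<^sub>R w) (c *\<^sub>R w))) (at a)"
      by (rule has_derivative_compose[OF 1 hd])
    moreover have "(\<lambda>c. fderiv h (y + a *\<^sub>R w) (c *\<^sub>R w)) = (*) (fderiv h (y + a *\<^sub>R w) w)"
      using linear_cmul[OF has_derivative_linear[OF hd]] by (auto simp: mult.commute)
    ultimately show ?thesis by (simp add: has_field_derivative_def)
  qed
  define Du where "Du y = fderiv f y u" for y
  have Du: "smooth_on Du S" unfolding Du_def by (rule smooth_on_derivative[OF f])
  have "\<exists>a. 0 < a \<and> a < s \<and> (f (x + s *\<^sub>R v + s *\<^sub>R u) - f (x + s *\<^sub>R u)) - (f (x + s *\<^sub>R v + 0 *\<^sub>R u) - f (x + 0 *\<^sub>R u)) = (s - 0) * (Du (x + s *\<^sub>R v + a *\<^sub>R u) - Du (x + a *\<^sub>R u))"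
  proof (rule MVT2[OF s])
    fix a assume "0 \<le> a" "a \<le> s"
    then show "((\<lambda>a. f (x + s *\<^sub>R v + a *\<^sub>R u) - f (x + a *\<^sub>R u)) has_real_derivative Du (x + s *\<^sub>R v + a *\<^sub>R u) - Du (x + a *\<^sub>R u)) (at a)"
      unfolding Du_def using inS[of a s] inS[of a 0] s by (intro DERIV_diff line f) (auto simp: algebra_simps)
  qed
  then obtain a where a: "0 < a" "a < s" "(f (x + s *\<^sub>R v + s *\<^sub>R u) - f (x + s *\<^sub>R u)) - (f (x + s *\<^sub>R v) - f x) = s * (Du (x + s *\<^sub>R v + a *\<^sub>R u) - Du (x + a *\<^sub>R u))"
    by auto
  have "\<exists>b. 0 < b \<and> b < s \<and> Du (x + a *\<^sub>R u + s *\<^sub>R v) - Du (x + a *\<^sub>R u + 0 *\<^sub>R v) = (s - 0) * fderiv Du (x + a *\<^sub>R u + b *\<^sub>R v) v"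
  proof (rule MVT2[OF s])
    fix b assume "0 \<le> b" "b \<le> s"
    then show "((\<lambda>b. Du (x + a *\<^sub>R u + b *\<^sub>R v)) has_real_derivative fderiv Du (x + a *\<^sub>R u + b *\<^sub>R v) v) (at b)"
      using inS[of a b] a by (intro line Du) auto
  qed
  then obtain b where b: "0 < b" "b < s" "Du (x + a *\<^sub>R u + s *\<^sub>R v) - Du (x + a *\<^sub>R u) = s * fderiv Du (x + a *\<^sub>R u + b *\<^sub>R v) v"
    by auto
  have sw: "x + s *\<^sub>R v + a *\<^sub>R u = x + a *\<^sub>R u + s *\<^sub>R v" "x + s *\<^sub>R v + s *\<^sub>R u = x + s *\<^sub>R u + s *\<^sub>R v"
    by (simp_all add: algebra_simps)
  show ?thesis
    by (rule that[of a b]) (use a b in \<open>auto simp: sw Du_def[abs_def]\<close>)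
qed

lemma second_derivative_symmetric_real:
  fixes f :: "'a::euclidean_space \<Rightarrow> real"
  assumes f: "smooth_on f S" "open S" and x: "x \<in> S"
  shows "fderiv (\<lambda>y. fderiv f y u) x v
       = fderiv (\<lambda>y. fderiv f y v) x u"
proof -
  define A where "A y = fderiv (\<lambda>y. fderiv f y u) y v" for y
  define B where "B y = fderiv (\<lambda>y. fderiv f y v) y u" for y
  have "continuous_on S A" "continuous_on S B"
    unfolding A_def B_def by (intro smooth_on_imp_continuous_on smooth_on_derivative f)+
  then have "isCont A x" "isCont B x" using f(2) x by (auto simp: continuous_on_eq_continuous_at)
  have "\<bar>A x - B x\<bar> \<le> e" if e: "e > 0" for e
  proof -
    obtain d1 where d1: "d1 > 0" "\<And>y. dist y x < d1 \<Longrightarrow> dist (A y) (A x) < e/2"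
      using \<open>isCont A x\<close> e unfolding continuous_at_eps_delta by (metis half_gt_zero)
    obtain d2 where d2: "d2 > 0" "\<And>y. dist y x < d2 \<Longrightarrow> dist (B y) (B x) < e/2"
      using \<open>isCont B x\<close> e unfolding continuous_at_eps_delta by (metis half_gt_zero)
    obtain d3 where d3: "d3 > 0" "ball x d3 \<subseteq> S" using f(2) x openE by blast
    define d where "d = min d1 (min d2 d3)"
    define s where "s = d / (2 * (norm u + norm v + 1))"
    have d: "d > 0" using d1 d2 d3 by (simp add: d_def)
    have p: "norm u + norm v + 1 > 0" by (simp add: add_nonneg_pos)
    have s: "s > 0" using d p by (simp add: s_def)
    have sd: "s * (norm u + norm v) < d"
    proof -
      have "s * (norm u + norm v) < s * (2 * (norm u + norm v + 1))"
        using s by (intro mult_strict_left_mono) (auto simp: add_nonneg_pos)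
      also have "\<dots> = d" unfolding s_def using p by (simp del: add_eq_0_iff)
      finally show ?thesis .
    qed
    have near: "dist (x + a *\<^sub>R u + b *\<^sub>R v) x < d" if "0 \<le> a" "a \<le> s" "0 \<le> b" "b \<le> s" for a b u' v'
    proof -
      have "dist (x + a *\<^sub>R u + b *\<^sub>R v) x = norm (a *\<^sub>R u + b *\<^sub>R v)" by (simp add: dist_norm algebra_simps)
      also have "\<dots> \<le> a * norm u + b * norm v" using that norm_triangle_ineq[of "a *\<^sub>R u" "b *\<^sub>R v"] by simp
      also have "\<dots> \<le> s * norm u + s * norm v" using that by (intro add_mono mult_right_mono) auto
      finally show ?thesis using sd by (simp add: algebra_simps)
    qed
    have inS: "x + a *\<^sub>R u + b *\<^sub>R v \<in> S" if "0 \<le> a" "a \<le> s" "0 \<le> b" "b \<le> s" for a b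
      using near[OF that] d3(2) by (auto simp: d_def dist_commute)
    have inS': "x + b *\<^sub>R v + a *\<^sub>R u \<in> S" if "0 \<le> b" "b \<le> s" "0 \<le> a" "a \<le> s" for a b
      using inS[OF that(3,4,1,2)] by (simp add: algebra_simps)
    obtain a b where 1: "0 < a" "a < s" "0 < b" "b < s"
      "f (x + s *\<^sub>R u + s *\<^sub>R v) - f (x + s *\<^sub>R u) - f (x + s *\<^sub>R v) + f x = s * (s * A (x + a *\<^sub>R u + b *\<^sub>R v))"
      unfolding A_def by (rule second_difference_quotient[OF f s inS])
    obtain b' a' where 2: "0 < b'" "b' < s" "0 < a'" "a' < s"
      "f (x + s *\<^sub>R v + s *\<^sub>R u) - f (x + s *\<^sub>R v) - f (x + s *\<^sub>R u) + f x = s * (s * B (x + b' *\<^sub>R v + a' *\<^sub>R u))"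
      unfolding B_def by (rule second_difference_quotient[OF f s inS'])
    have "f (x + s *\<^sub>R v + s *\<^sub>R u) = f (x + s *\<^sub>R u + s *\<^sub>R v)" by (simp add: algebra_simps)
    then have "s * (s * A (x + a *\<^sub>R u + b *\<^sub>R v)) = s * (s * B (x + b' *\<^sub>R v + a' *\<^sub>R u))"
      using 1(5) 2(5) by linarith
    then have eq: "A (x + a *\<^sub>R u + b *\<^sub>R v) = B (x + b' *\<^sub>R v + a' *\<^sub>R u)" using s by simp
    have "dist (A (x + a *\<^sub>R u + b *\<^sub>R v)) (A x) < e/2"
      using near[of a b] 1 by (intro d1(2)) (auto simp: d_def)
    moreover have "dist (B (x + a' *\<^sub>R u + b' *\<^sub>R v)) (B x) < e/2"
      using near[of a' b'] 2 by (intro d2(2)) (auto simp: d_def)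
    moreover have "x + a' *\<^sub>R u + b' *\<^sub>R v = x + b' *\<^sub>R v + a' *\<^sub>R u" by (simp add: algebra_simps)
    ultimately show ?thesis unfolding dist_real_def using eq by (smt (verit) field_sum_of_halves)
  qed
  then have "\<bar>A x - B x\<bar> \<le> 0" using field_le_epsilon[of "\<bar>A x - B x\<bar>" 0] by simp
  then show ?thesis by (simp add: A_def B_def)
qed

lemma second_derivative_symmetric:
  fixes f :: "'a::euclidean_space \<Rightarrow> 'b::euclidean_space"
  assumes f: "smooth_on f S" "open S" and x: "x \<in> S"
  shows "fderiv (\<lambda>y. fderiv f y u) x v
       = fderiv (\<lambda>y. fderiv f y v) x u"
proof (rule euclidean_eqI)
  fix b :: 'b
  have fb: "smooth_on (\<lambda>y. f y \<bullet> b) S"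
    by (rule smooth_on_compose_bounded_linear[OF bounded_linear_inner_left f(1)])
  have der: "fderiv (\<lambda>y. h y \<bullet> b) y w = fderiv h y w \<bullet> b"
    if "smooth_on h S" "y \<in> S" for h :: "'a \<Rightarrow> 'b" and y w
    using frechet_derivative_at[OF bounded_linear.has_derivative[OF bounded_linear_inner_left smooth_on_has_derivative[OF that]]]
    by metis
  have D2: "fderiv (\<lambda>y. fderiv f y u) x v \<bullet> b
      = fderiv (\<lambda>y. fderiv (\<lambda>y. f y \<bullet> b) y u) x v" for u v
  proof -
    have sm: "smooth_on (\<lambda>y. fderiv f y u) S" by (rule smooth_on_derivative[OF f])
    have "((\<lambda>y. fderiv f y u \<bullet> b) has_derivative
        (\<lambda>w. fderiv (\<lambda>y. fderiv f y u) x w \<bullet> b)) (at x)"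
      by (rule bounded_linear.has_derivative[OF bounded_linear_inner_left smooth_on_has_derivative[OF sm x]])
    then have "((\<lambda>y. fderiv (\<lambda>y. f y \<bullet> b) y u) has_derivative
        (\<lambda>w. fderiv (\<lambda>y. fderiv f y u) x w \<bullet> b)) (at x)"
      by (rule has_derivative_transform_within_open[OF _ f(2) x]) (simp add: der[OF f(1)])
    from frechet_derivative_at[OF this] show ?thesis by metis
  qed
  show "fderiv (\<lambda>y. fderiv f y u) x v \<bullet> b
     = fderiv (\<lambda>y. fderiv f y v) x u \<bullet> b"
    unfolding D2 by (rule second_derivative_symmetric_real[OF fb f(2) x])
qed

section \<open>Non-degenerate forms\<close>

lemma bilinear_expand:
  fixes \<gamma> :: "'a::euclidean_space \<Rightarrow> 'a \<Rightarrow> real"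
  assumes "bilinear \<gamma>"
  shows "\<gamma> u v = (\<Sum>a\<in>Basis. \<Sum>b\<in>Basis. (u \<bullet> a) * ((v \<bullet> b) * \<gamma> a b))"
proof -
  have lin: "linear (\<gamma> w)" "linear (\<lambda>w. \<gamma> w z)" for w z using assms by (auto simp: bilinear_def)
  have "\<gamma> u v = \<gamma> (\<Sum>a\<in>Basis. (u \<bullet> a) *\<^sub>R a) v" by (simp add: euclidean_representation)
  also have "\<dots> = (\<Sum>a\<in>Basis. (u \<bullet> a) * \<gamma> a v)"
    by (simp add: linear_sum[OF lin(2)] linear_cmul[OF lin(2)])
  also have "\<dots> = (\<Sum>a\<in>Basis. (u \<bullet> a) * (\<Sum>b\<in>Basis. (v \<bullet> b) * \<gamma> a b))"
  proof (intro sum.cong refl arg_cong[where f = "(*) _"])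
    fix a
    have "\<gamma> a v = \<gamma> a (\<Sum>b\<in>Basis. (v \<bullet> b) *\<^sub>R b)" by (simp add: euclidean_representation)
    then show "\<gamma> a v = (\<Sum>b\<in>Basis. (v \<bullet> b) * \<gamma> a b)" by (simp add: linear_sum[OF lin(1)] linear_cmul[OF lin(1)])
  qed
  finally show ?thesis by (simp add: sum_distrib_left)
qed

text \<open>On the unit sphere the form pairs every \<open>u\<close> non-trivially with some basis vector, that is, the sum \<open>q\<close> of squares
  is positive; by compactness of the sphere this persists for nearby parameters.\<close>

lemma nondegenerate_open:
  fixes \<gamma> :: "'y::topological_space \<Rightarrow> 'a::euclidean_space \<Rightarrow> 'a \<Rightarrow> real"
  assumes N: "open N" "y0 \<in> N" and bil: "\<And>y. y \<in> N \<Longrightarrow> bilinear (\<gamma> y)"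
    and cont: "\<And>u v. continuous_on N (\<lambda>y. \<gamma> y u v)" and nd: "nondegenerate (\<gamma> y0)"
  obtains N' where "open N'" "y0 \<in> N'" "N' \<subseteq> N" "\<And>y. y \<in> N' \<Longrightarrow> nondegenerate (\<gamma> y)"
proof -
  define q where "q p = (\<Sum>b\<in>Basis. (\<Sum>a\<in>Basis. (snd p \<bullet> a) * \<gamma> (fst p) a b)\<^sup>2)" for p :: "'y \<times> 'a"
  have q: "q (y, u) = (\<Sum>b\<in>Basis. (\<gamma> y u b)\<^sup>2)" if "y \<in> N" for y u
  proof -
    have lin: "linear (\<lambda>w. \<gamma> y w z)" for z using bil[OF that] by (auto simp: bilinear_def)
    have "\<gamma> y u b = (\<Sum>a\<in>Basis. (u \<bullet> a) * \<gamma> y a b)" for b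
    proof -
      have "\<gamma> y u b = \<gamma> y (\<Sum>a\<in>Basis. (u \<bullet> a) *\<^sub>R a) b" by (simp add: euclidean_representation)
      then show ?thesis by (simp add: linear_sum[OF lin] linear_cmul[OF lin])
    qed
    then show ?thesis by (simp add: q_def)
  qed
  have pos: "q (y, u) > 0 \<longleftrightarrow> (\<exists>v. \<gamma> y u v \<noteq> 0)" if "y \<in> N" for y u
  proof -
    have lin: "linear (\<gamma> y u)" using bil[OF that] by (auto simp: bilinear_def)
    have "q (y, u) > 0 \<longleftrightarrow> (\<exists>b\<in>Basis. \<gamma> y u b \<noteq> 0)"
      unfolding q[OF that] using sum_nonneg_eq_0_iff[of Basis "\<lambda>b. (\<gamma> y u b)\<^sup>2"] sum_nonneg[of Basis "\<lambda>b. (\<gamma> y u b)\<^sup>2"]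
      by (auto simp: less_le)
    also have "\<dots> \<longleftrightarrow> (\<exists>v. \<gamma> y u v \<noteq> 0)"
    proof
      assume "\<exists>v. \<gamma> y u v \<noteq> 0"
      then show "\<exists>b\<in>Basis. \<gamma> y u b \<noteq> 0"
        using linear_eq_stdbasis[OF lin linear_zero] by metis
    qed auto
    finally show ?thesis .
  qed
  have "continuous_on (N \<times> UNIV) q"
    unfolding q_def by (intro continuous_intros continuous_on_compose2[OF cont]) auto
  then have "open ((N \<times> UNIV) \<inter> q -` {0<..})"
    by (rule continuous_open_preimage) (use N in \<open>auto intro: open_Times\<close>)
  then have W: "open (q -` {0<..} \<inter> N \<times> UNIV)" by (simp only: Int_commute)
  have sub: "{y0} \<times> sphere 0 1 \<subseteq> q -` {0<..} \<inter> N \<times> UNIV"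
  proof
    fix p :: "'y \<times> 'a" assume "p \<in> {y0} \<times> sphere 0 1"
    then obtain u where p: "p = (y0, u)" and "norm u = 1" by (cases p) simp
    then have "u \<noteq> 0" by (metis norm_zero zero_neq_one)
    then have "\<exists>v. \<gamma> y0 u v \<noteq> 0" using nd unfolding nondegenerate_def by blast
    then have "q p > 0" unfolding p pos[OF N(2)] .
    then show "p \<in> q -` {0<..} \<inter> N \<times> UNIV" using N(2) p by simp
  qed
  obtain N' where N': "y0 \<in> N'" "open N'" "N' \<times> sphere 0 1 \<subseteq> q -` {0<..} \<inter> N \<times> UNIV"
    using Elementary_Topology.tube_lemma[OF compact_sphere W sub] by metis
  show ?thesis
  proof (rule that[of "N' \<inter> N"])
    fix y assume y: "y \<in> N' \<inter> N"
    show "nondegenerate (\<gamma> y)"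
      unfolding nondegenerate_def
    proof (intro allI impI, rule ccontr)
      fix u assume u: "\<forall>v. \<gamma> y u v = 0" "u \<noteq> 0"
      have "(y, u /\<^sub>R norm u) \<in> q -` {0<..} \<inter> N \<times> UNIV"
        by (rule subsetD[OF N'(3)]) (use y u(2) in simp)
      then have "q (y, u /\<^sub>R norm u) > 0" by simp
      then obtain v where "\<gamma> y (u /\<^sub>R norm u) v \<noteq> 0" using pos[of y] y by blast
      moreover have "\<gamma> y (u /\<^sub>R norm u) v = 0"
        using u(1) bil[of y] y by (simp add: bilinear_lmul)
      ultimately show False by simp
    qed
  qed (use N N' in auto)
qed

text \<open>The (1,1)-component is the part invariant under multiplication by \<open>\<i>\<close>. In this form, its non-degeneracy
  becomes that of a real bilinear form.\<close>

lemma component_1_1_real_form: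
  fixes \<alpha> :: "(complex, 'n::finite) vec \<Rightarrow> (complex, 'n) vec \<Rightarrow> real"
  assumes "bilinear \<alpha>" "\<And>u. \<alpha> u u = 0"
  shows "component_1_1 (complexify \<alpha>) u v = complex_of_real ((\<alpha> u v + \<alpha> (\<i> *s u) (\<i> *s v)) / 2)"
proof -
  have "bilinear (complexify \<alpha>)"
    using assms(1) unfolding bilinear_def by (auto simp: linear_iff scaleR_conv_of_real[where 'a=complex])
  then obtain b20 b11 b02 where d: "bidegree_decomposition (complexify \<alpha>) b20 b11 b02"
    using bidegree_decomposition_exists[of "complexify \<alpha>"] assms(2) by auto
  show ?thesis
    unfolding component_1_1_unique[OF d] bidegree_decomposition_1_1_eq[OF d] by simp
qed

lemma nondegenerate_component_1_1:
  fixes \<alpha> :: "(complex, 'n::finite) vec \<Rightarrow> (complex, 'n) vec \<Rightarrow> real"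
  assumes "bilinear \<alpha>" "\<And>u. \<alpha> u u = 0"
  shows "nondegenerate (component_1_1 (complexify \<alpha>)) \<longleftrightarrow> nondegenerate (\<lambda>u v. \<alpha> u v + \<alpha> (\<i> *s u) (\<i> *s v))"
proof -
  have "component_1_1 (complexify \<alpha>) u v = 0 \<longleftrightarrow> \<alpha> u v + \<alpha> (\<i> *s u) (\<i> *s v) = 0" for u v
    by (simp only: component_1_1_real_form[OF assms] of_real_eq_0_iff) simp
  then show ?thesis by (simp only: nondegenerate_def)
qed

section \<open>Charts and smooth maps\<close>

abbreviation chart_inv :: "('p, 'n::finite) chart \<Rightarrow> (complex, 'n) vec \<Rightarrow> 'p" where
  "chart_inv c \<equiv> inv_into (fst c) (snd c)"

lemma chart_inj:
  assumes "topological_chart T c" shows "inj_on (snd c) (fst c)"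
proof -
  have "fst c \<subseteq> topspace T" using assms openin_subset by (auto simp: topological_chart_def)
  then show ?thesis
    using assms homeomorphic_imp_injective_map by (fastforce simp: topological_chart_def Int_absorb1)
qed

lemma chart_inv_chart [simp]:
  assumes "topological_chart T c" "p \<in> fst c" shows "chart_inv c (snd c p) = p"
  by (rule inv_into_f_f[OF chart_inj[OF assms(1)] assms(2)])

lemma chart_chart_inv: "x \<in> chart_image c \<Longrightarrow> snd c (chart_inv c x) = x"
  unfolding chart_image_def by (rule f_inv_into_f)

lemma chart_inv_in: "x \<in> chart_image c \<Longrightarrow> chart_inv c x \<in> fst c"
  unfolding chart_image_def by (rule inv_into_into)

lemma chart_in_image: "p \<in> fst c \<Longrightarrow> snd c p \<in> chart_image c"
  unfolding chart_image_def by simp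

lemma chart_open_image:
  assumes c: "topological_chart T c" and U: "openin T U"
  shows "open (snd c ` (fst c \<inter> U))"
proof -
  have h: "homeomorphic_map (subtopology T (fst c)) (top_of_set (chart_image c)) (snd c)"
    and o: "open (chart_image c)"
    using c by (auto simp: topological_chart_def)
  have "openin (subtopology T (fst c)) (fst c \<inter> U)" using U by (auto simp: openin_subtopology)
  then have "openin (top_of_set (chart_image c)) (snd c ` (fst c \<inter> U))"
    using h homeomorphic_imp_open_map open_map_def by blast
  then show ?thesis using o by (simp add: openin_open_eq)
qed

lemma chart_open_vimage:
  assumes c: "topological_chart T c" and B: "open B"
  shows "openin T {p \<in> fst c. snd c p \<in> B}"
proof -
  have h: "homeomorphic_map (subtopology T (fst c)) (top_of_set (chart_image c)) (snd c)"
    and o: "openin T (fst c)"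
    using c by (auto simp: topological_chart_def)
  have "continuous_map (subtopology T (fst c)) (top_of_set (chart_image c)) (snd c)"
    using h by (rule homeomorphic_imp_continuous_map)
  moreover have "openin (top_of_set (chart_image c)) (chart_image c \<inter> B)" using B by auto
  ultimately have "openin (subtopology T (fst c)) {p \<in> topspace (subtopology T (fst c)). snd c p \<in> chart_image c \<inter> B}"
    by (rule openin_continuous_map_preimage)
  moreover have "{p \<in> topspace (subtopology T (fst c)). snd c p \<in> chart_image c \<inter> B} = {p \<in> fst c. snd c p \<in> B}"
    using openin_subset[OF o] by (auto simp: chart_image_def)
  ultimately show ?thesis using o by (simp add: openin_open_subtopology)
qed

lemma chart_in_topspace: "topological_chart T c \<Longrightarrow> p \<in> fst c \<Longrightarrow> p \<in> topspace T"
  by (meson openin_subset subsetD topological_chart_def)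

lemma complex_manifold_chart: "complex_manifold M \<Longrightarrow> c \<in> atlas M \<Longrightarrow> topological_chart (mtop M) c"
  by (simp add: complex_manifold_def)

lemma complex_manifold_obtain_chart:
  assumes "complex_manifold M" "p \<in> topspace (mtop M)"
  obtains c where "c \<in> atlas M" "p \<in> fst c"
  using assms unfolding complex_manifold_def by blast

lemma local_domain_open:
  assumes c: "topological_chart T c" and d: "topological_chart T' d" and f: "continuous_map T T' f"
  shows "open (local_domain f c d)"
proof -
  have "openin T {p \<in> topspace T. f p \<in> fst d}"
    using f d by (intro openin_continuous_map_preimage) (auto simp: topological_chart_def)
  then have "open (snd c ` (fst c \<inter> {p \<in> topspace T. f p \<in> fst d}))"
    by (rule chart_open_image[OF c])
  also have "fst c \<inter> {p \<in> topspace T. f p \<in> fst d} = fst c \<inter> f -` fst d"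
    using chart_in_topspace[OF c] by auto
  finally show ?thesis by (simp add: local_domain_def)
qed

lemma local_domain_iff:
  assumes "topological_chart T c"
  shows "x \<in> local_domain f c d \<longleftrightarrow> x \<in> chart_image c \<and> f (chart_inv c x) \<in> fst d"
  using assms by (auto simp: local_domain_def chart_image_def intro!: image_eqI[where x = "chart_inv c x"])

lemma local_map_chart:
  assumes "topological_chart T c" "p \<in> fst c"
  shows "local_map f c d (snd c p) = snd d (f p)"
  using assms by (simp add: local_map_def)

lemma local_map_compose:
  assumes "topological_chart T d" "f (chart_inv c x) \<in> fst d"
  shows "local_map g d e (local_map f c d x) = local_map (g \<circ> f) c e x"
  using assms by (simp add: local_map_def)

text \<open>Smoothness at a point, tested in one pair of charts. Smoothness of maps between manifolds only
  enters through germs, which lets maps be glued.\<close>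

definition smooth_at ::
    "('p \<Rightarrow> 'q) \<Rightarrow> 'p \<Rightarrow> ('p, 'n::finite) chart \<Rightarrow> ('q, 'm::finite) chart \<Rightarrow> bool" where
  "smooth_at R p c e \<longleftrightarrow> p \<in> fst c \<and> R p \<in> fst e \<and>
     (\<exists>N. open N \<and> snd c p \<in> N \<and> N \<subseteq> chart_image c \<and> (\<forall>x\<in>N. R (chart_inv c x) \<in> fst e) \<and>
        smooth_on (local_map R c e) N)"

lemma smooth_at_compose:
  assumes c: "topological_chart T c" and d: "topological_chart T' d"
    and f: "smooth_at f p c d" and g: "smooth_at g (f p) d e"
  shows "smooth_at (g \<circ> f) p c e"
proof -
  obtain N where N: "open N" "snd c p \<in> N" "N \<subseteq> chart_image c" "\<And>x. x\<in>N \<Longrightarrow> f (chart_inv c x) \<in> fst d"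
     "smooth_on (local_map f c d) N"
    using f unfolding smooth_at_def by blast
  obtain N' where N': "open N'" "snd d (f p) \<in> N'" "N' \<subseteq> chart_image d" "\<And>x. x\<in>N' \<Longrightarrow> g (chart_inv d x) \<in> fst e"
     "smooth_on (local_map g d e) N'"
    using g unfolding smooth_at_def by blast
  define N2 where "N2 = N \<inter> local_map f c d -` N'"
  have "open N2" unfolding N2_def
    by (rule continuous_open_preimage[OF smooth_on_imp_continuous_on[OF N(5)] N(1) N'(1)])
  moreover have "snd c p \<in> N2"
  proof -
    have "p \<in> fst c" using f by (simp add: smooth_at_def)
    then show ?thesis using N(2) N'(2) c by (simp add: N2_def local_map_def)
  qed
  moreover have "(g \<circ> f) (chart_inv c x) \<in> fst e" if "x \<in> N2" for x
  proof -
    have "chart_inv d (local_map f c d x) = f (chart_inv c x)"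
      using N(4)[of x] that d by (simp add: N2_def local_map_def)
    then show ?thesis using N'(4)[of "local_map f c d x"] that by (simp add: N2_def)
  qed
  moreover have "smooth_on (local_map (g \<circ> f) c e) N2"
  proof (rule smooth_on_cong[OF \<open>open N2\<close>])
    show "smooth_on (\<lambda>x. local_map g d e (local_map f c d x)) N2"
      by (rule smooth_on_compose[OF smooth_on_subset[OF N(5)] N'(5)]) (auto simp: N2_def)
    show "local_map g d e (local_map f c d x) = local_map (g \<circ> f) c e x" if "x \<in> N2" for x
      by (rule local_map_compose[OF d]) (use that N(4) in \<open>auto simp: N2_def\<close>)
  qed
  moreover have "N2 \<subseteq> chart_image c" using N(3) by (auto simp: N2_def)
  moreover have "p \<in> fst c" "(g \<circ> f) p \<in> fst e" using f g by (simp_all add: smooth_at_def)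
  ultimately show ?thesis unfolding smooth_at_def by blast
qed

lemma holomorphic_imp_smooth_at:
  assumes c: "topological_chart T c" and d: "topological_chart T' d" and f: "continuous_map T T' f"
    and hol: "holomorphic_map_on (local_map f c d) (local_domain f c d)"
    and p: "p \<in> fst c" "f p \<in> fst d"
  shows "smooth_at f p c d"
  unfolding smooth_at_def
proof (intro conjI p exI[of _ "local_domain f c d"])
  show o: "open (local_domain f c d)" by (rule local_domain_open[OF c d f])
  show "snd c p \<in> local_domain f c d" using p by (auto simp: local_domain_def)
  show "smooth_on (local_map f c d) (local_domain f c d)"
    by (rule holomorphic_map_on_imp_smooth_on[OF hol o])
qed (auto simp: local_domain_iff[OF c])

lemma smooth_at_transition:
  assumes "complex_manifold M" "c \<in> atlas M" "d \<in> atlas M" "p \<in> fst c" "p \<in> fst d"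
  shows "smooth_at id p c d"
  by (rule holomorphic_imp_smooth_at[where T = "mtop M" and T' = "mtop M"])
    (use assms in \<open>auto simp: complex_manifold_def\<close>)

lemma smooth_at_change_charts:
  assumes M: "complex_manifold M" "c \<in> atlas M" "c' \<in> atlas M" "p \<in> fst c'"
    and X: "complex_manifold X" "e \<in> atlas X" "e' \<in> atlas X" "R p \<in> fst e'"
    and R: "smooth_at R p c e"
  shows "smooth_at R p c' e'"
proof -
  note ch = complex_manifold_chart[OF M(1)] complex_manifold_chart[OF X(1)]
  have p: "p \<in> fst c" "R p \<in> fst e" using R by (auto simp: smooth_at_def)
  have "smooth_at (R \<circ> id) p c' e"
    by (rule smooth_at_compose[OF ch(1)[OF M(3)] ch(1)[OF M(2)] smooth_at_transition[OF M(1,3,2,4) p(1)]])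
      (simp add: R)
  then have "smooth_at R p c' e" by simp
  then have "smooth_at (id \<circ> R) p c' e'"
    by (rule smooth_at_compose[where f = R and g = id,
          OF ch(1)[OF M(3)] ch(2)[OF X(2)] _ smooth_at_transition[OF X(1,2,3) p(2) X(4)]])
  then show ?thesis by simp
qed

lemma smooth_at_cong:
  assumes c: "topological_chart T c" and U: "openin T U" "p \<in> U" "\<And>q. q \<in> U \<Longrightarrow> R q = R' q"
    and R: "smooth_at R p c e"
  shows "smooth_at R' p c e"
proof -
  obtain N where N: "open N" "snd c p \<in> N" "N \<subseteq> chart_image c" "\<And>x. x\<in>N \<Longrightarrow> R (chart_inv c x) \<in> fst e"
     "smooth_on (local_map R c e) N"
    using R unfolding smooth_at_def by blast
  have p: "p \<in> fst c" "R p \<in> fst e" using R by (auto simp: smooth_at_def)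
  define N2 where "N2 = N \<inter> snd c ` (fst c \<inter> U)"
  have o: "open N2" unfolding N2_def by (intro open_Int N(1) chart_open_image[OF c U(1)])
  have eq: "R (chart_inv c x) = R' (chart_inv c x)" if "x \<in> N2" for x
  proof -
    have "chart_inv c x \<in> U" using that c by (auto simp: N2_def)
    then show ?thesis by (rule U(3))
  qed
  have "smooth_on (local_map R' c e) N2"
    by (rule smooth_on_cong[OF o _ smooth_on_subset[OF N(5)]]) (auto simp: local_map_def eq, auto simp: N2_def)
  moreover have "R' (chart_inv c x) \<in> fst e" if "x \<in> N2" for x
    using N(4)[of x] eq[OF that] that by (simp add: N2_def)
  moreover have "snd c p \<in> N2" using N(2) p U(2) by (auto simp: N2_def)
  moreover have "N2 \<subseteq> chart_image c" using N(3) by (auto simp: N2_def)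
  moreover have "R' p \<in> fst e" using p(2) U by simp
  ultimately show ?thesis
    unfolding smooth_at_def using p(1) o by blast
qed

text \<open>Smoothness at a point contains continuity there, and holds at all nearby points.\<close>

lemma smooth_at_open_preimage:
  assumes c: "topological_chart T c" and R: "smooth_at R p c e" and B: "open B" "snd e (R p) \<in> B"
  obtains U where "openin T U" "p \<in> U" "U \<subseteq> fst c" "\<And>q. q \<in> U \<Longrightarrow> R q \<in> fst e \<and> snd e (R q) \<in> B \<and> smooth_at R q c e"
proof -
  obtain N where N: "open N" "snd c p \<in> N" "N \<subseteq> chart_image c" "\<And>x. x\<in>N \<Longrightarrow> R (chart_inv c x) \<in> fst e"
     "smooth_on (local_map R c e) N"
    using R unfolding smooth_at_def by blast
  have p: "p \<in> fst c" "R p \<in> fst e" using R by (auto simp: smooth_at_def)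
  define N2 where "N2 = N \<inter> local_map R c e -` B"
  have o: "open N2" unfolding N2_def
    by (rule continuous_open_preimage[OF smooth_on_imp_continuous_on[OF N(5)] N(1) B(1)])
  show ?thesis
  proof (rule that[of "{q \<in> fst c. snd c q \<in> N2}"])
    show "openin T {q \<in> fst c. snd c q \<in> N2}" by (rule chart_open_vimage[OF c o])
    show "p \<in> {q \<in> fst c. snd c q \<in> N2}" using p N(2) B(2) c by (simp add: N2_def local_map_def)
    fix q assume q: "q \<in> {q \<in> fst c. snd c q \<in> N2}"
    have inv: "chart_inv c (snd c q) = q" using chart_inv_chart[OF c] q by simp
    have Rq: "R q \<in> fst e" using N(4)[of "snd c q"] q inv by (simp add: N2_def)
    moreover have "snd e (R q) \<in> B" using q inv by (simp add: N2_def local_map_def)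
    moreover have "smooth_at R q c e"
      unfolding smooth_at_def
    proof (intro conjI exI[of _ N])
      show "q \<in> fst c" "snd c q \<in> N" using q by (simp_all add: N2_def)
    qed (use Rq N in auto)
    ultimately show "R q \<in> fst e \<and> snd e (R q) \<in> B \<and> smooth_at R q c e" by blast
  qed auto
qed

section \<open>Pulling back forms\<close>

lemma bilinear_form_has_derivative:
  fixes \<alpha> :: "'b::euclidean_space \<Rightarrow> 'c::euclidean_space \<Rightarrow> 'c \<Rightarrow> real" and h :: "'a::real_normed_vector \<Rightarrow> 'b"
  assumes W: "open W" "\<And>y. y \<in> W \<Longrightarrow> bilinear (\<alpha> y)"
    and \<alpha>: "\<And>u v. (\<lambda>y. \<alpha> y u v) differentiable at (h x)"
    and h: "(h has_derivative h') (at x)" "h x \<in> W"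
    and f: "(f has_derivative f') (at x)" and g: "(g has_derivative g') (at x)"
  shows "((\<lambda>y. \<alpha> (h y) (f y) (g y)) has_derivative
      (\<lambda>u. \<alpha> (h x) (f' u) (g x) + \<alpha> (h x) (f x) (g' u)
          + fderiv (\<lambda>z. \<alpha> z (f x) (g x)) (h x) (h' u))) (at x)"
proof -
  define A where "A a b = fderiv (\<lambda>z. \<alpha> z a b) (h x)" for a b
  have A: "((\<lambda>z. \<alpha> z a b) has_derivative A a b) (at (h x))" for a b
    unfolding A_def using \<alpha> frechet_derivative_works by blast
  have Ah: "((\<lambda>y. \<alpha> (h y) a b) has_derivative (\<lambda>u. A a b (h' u))) (at x)" for a b
    by (rule has_derivative_compose[OF h(1) A])
  have fa: "((\<lambda>y. f y \<bullet> a) has_derivative (\<lambda>u. f' u \<bullet> a)) (at x)" for a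
    by (rule bounded_linear.has_derivative[OF bounded_linear_inner_left f])
  have gb: "((\<lambda>y. g y \<bullet> b) has_derivative (\<lambda>u. g' u \<bullet> b)) (at x)" for b
    by (rule bounded_linear.has_derivative[OF bounded_linear_inner_left g])
  have AA: "A (f x) (g x) k = (\<Sum>a\<in>Basis. \<Sum>b\<in>Basis. (f x \<bullet> a) * ((g x \<bullet> b) * A a b k))" for k
  proof -
    have "((\<lambda>z. \<Sum>a\<in>Basis. \<Sum>b\<in>Basis. (f x \<bullet> a) * ((g x \<bullet> b) * \<alpha> z a b)) has_derivative
       (\<lambda>k. \<Sum>a\<in>Basis. \<Sum>b\<in>Basis. (f x \<bullet> a) * ((g x \<bullet> b) * A a b k))) (at (h x))"
      by (intro has_derivative_sum has_derivative_mult_right A)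
    then have "((\<lambda>z. \<alpha> z (f x) (g x)) has_derivative
       (\<lambda>k. \<Sum>a\<in>Basis. \<Sum>b\<in>Basis. (f x \<bullet> a) * ((g x \<bullet> b) * A a b k))) (at (h x))"
      by (rule has_derivative_transform_within_open[OF _ W(1) h(2)]) (rule bilinear_expand[OF W(2), symmetric])
    from has_derivative_unique[OF A this] show ?thesis by metis
  qed
  have "isCont h x" using h(1) by (rule has_derivative_continuous)
  then obtain d where d: "d > 0" "\<And>y. dist y x < d \<Longrightarrow> h y \<in> W"
    using W(1) h(2) unfolding continuous_at_eps_delta open_dist by metis
  have "((\<lambda>y. \<Sum>a\<in>Basis. \<Sum>b\<in>Basis. (f y \<bullet> a) * ((g y \<bullet> b) * \<alpha> (h y) a b)) has_derivative
     (\<lambda>u. \<Sum>a\<in>Basis. \<Sum>b\<in>Basis. (f x \<bullet> a) * ((g x \<bullet> b) * A a b (h' u) + (g' u \<bullet> b) * \<alpha> (h x) a b)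
        + (f' u \<bullet> a) * ((g x \<bullet> b) * \<alpha> (h x) a b))) (at x)"
    by (intro has_derivative_sum has_derivative_mult fa gb Ah)
  moreover have "(\<lambda>u. \<Sum>a\<in>Basis. \<Sum>b\<in>Basis. (f x \<bullet> a) * ((g x \<bullet> b) * A a b (h' u) + (g' u \<bullet> b) * \<alpha> (h x) a b)
        + (f' u \<bullet> a) * ((g x \<bullet> b) * \<alpha> (h x) a b)) =
     (\<lambda>u. \<alpha> (h x) (f' u) (g x) + \<alpha> (h x) (f x) (g' u) + A (f x) (g x) (h' u))"
    unfolding AA bilinear_expand[OF W(2)[OF h(2)], of "f' _"] bilinear_expand[OF W(2)[OF h(2)], of "f x"]
    by (rule ext) (simp add: sum.distrib algebra_simps)
  ultimately have "((\<lambda>y. \<Sum>a\<in>Basis. \<Sum>b\<in>Basis. (f y \<bullet> a) * ((g y \<bullet> b) * \<alpha> (h y) a b)) has_derivative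
     (\<lambda>u. \<alpha> (h x) (f' u) (g x) + \<alpha> (h x) (f x) (g' u) + A (f x) (g x) (h' u))) (at x)"
    by simp
  then show ?thesis
    unfolding A_def
    by (rule has_derivative_transform_within_open[of _ _ _ _ "ball x d"])
      (use d in \<open>auto intro!: bilinear_expand[symmetric] W(2) simp: dist_commute\<close>)
qed

lemma alternating_skew:
  fixes \<beta> :: "'a::real_vector \<Rightarrow> 'a \<Rightarrow> real"
  assumes bil: "bilinear \<beta>" and alt: "\<And>u. \<beta> u u = 0"
  shows "\<beta> v u = - \<beta> u v"
proof -
  have "\<beta> (u + v) (u + v) = \<beta> u u + \<beta> v u + (\<beta> u v + \<beta> v v)"
    by (simp add: bilinear_ladd[OF bil] bilinear_radd[OF bil])
  then show ?thesis by (simp add: alt add_eq_0_iff)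
qed

text \<open>The terms with second derivatives of the map cancel by symmetry, so pulling back commutes with
  the exterior derivative.\<close>

lemma exterior_derivative_pullback:
  fixes h :: "'a::euclidean_space \<Rightarrow> 'b::euclidean_space"
  assumes W: "open W" "\<And>y. y \<in> W \<Longrightarrow> bilinear (\<alpha> y)" "\<And>y u. y \<in> W \<Longrightarrow> \<alpha> y u u = 0"
    and \<alpha>: "\<And>u v. smooth_on (\<lambda>y. \<alpha> y u v) W"
    and h: "smooth_on h N" "open N" "h ` N \<subseteq> W" and x: "x \<in> N"
  shows "exterior_derivative (\<lambda>y u v. \<alpha> (h y) (fderiv h y u) (fderiv h y v)) x u v w =
     exterior_derivative \<alpha> (h x) (fderiv h x u) (fderiv h x v) (fderiv h x w)"
proof -
  let ?D = "\<lambda>u y. fderiv h y u"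
  define S where "S u v = fderiv (\<lambda>y. fderiv h y u) x v" for u v
  have S: "S u v = S v u" for u v
    unfolding S_def by (rule second_derivative_symmetric[OF h(1,2) x])
  have hx: "h x \<in> W" using h x by auto
  have d: "fderiv (\<lambda>y. \<alpha> (h y) (?D v y) (?D w y)) x u =
     \<alpha> (h x) (S v u) (?D w x) + \<alpha> (h x) (?D v x) (S w u)
          + fderiv (\<lambda>z. \<alpha> z (?D v x) (?D w x)) (h x) (?D u x)" for u v w
  proof -
    have Dd: "(?D v has_derivative S v) (at x)" for v
      unfolding S_def by (rule smooth_on_has_derivative[OF smooth_on_derivative[OF h(1,2)] x])
    have da: "(\<lambda>y. \<alpha> y u v) differentiable at (h x)" for u v
      using smooth_on_has_derivative[OF \<alpha> hx] by (rule differentiableI)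
    have "((\<lambda>y. \<alpha> (h y) (?D v y) (?D w y)) has_derivative
        (\<lambda>u. \<alpha> (h x) (S v u) (?D w x) + \<alpha> (h x) (?D v x) (S w u)
          + fderiv (\<lambda>z. \<alpha> z (?D v x) (?D w x)) (h x) (?D u x))) (at x)"
      by (rule bilinear_form_has_derivative[where \<alpha> = \<alpha> and h = h and f = "?D v" and g = "?D w"
            and f' = "S v" and g' = "S w" and h' = "fderiv h x",
            OF W(1,2) da smooth_on_has_derivative[OF h(1) x] hx Dd Dd])
    from frechet_derivative_at[OF this] show ?thesis by (rule fun_cong[symmetric])
  qed
  have sk: "\<alpha> (h x) a b = - \<alpha> (h x) b a" for a b
    by (rule alternating_skew[OF W(2,3)[OF hx]])
  show ?thesis
    unfolding exterior_derivative_def d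
    using S[of u v] S[of u w] S[of v w] sk[of "S u w" "?D v x"] by simp
qed

lemma smooth_on_bilinear_form:
  fixes \<alpha> :: "'b::euclidean_space \<Rightarrow> 'c::euclidean_space \<Rightarrow> 'c \<Rightarrow> real"
    and h :: "'a::euclidean_space \<Rightarrow> 'b"
  assumes W: "\<And>y. y \<in> W \<Longrightarrow> bilinear (\<alpha> y)" and \<alpha>: "\<And>u v. smooth_on (\<lambda>y. \<alpha> y u v) W"
    and h: "smooth_on h N" "open N" "h ` N \<subseteq> W" and f: "smooth_on f N" and g: "smooth_on g N"
  shows "smooth_on (\<lambda>x. \<alpha> (h x) (f x) (g x)) N"
proof (rule smooth_on_cong[OF h(2)])
  have fa: "smooth_on (\<lambda>y. f y \<bullet> a) N" for a
    by (rule smooth_on_compose_bounded_linear[OF bounded_linear_inner_left f])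
  have gb: "smooth_on (\<lambda>y. g y \<bullet> b) N" for b
    by (rule smooth_on_compose_bounded_linear[OF bounded_linear_inner_left g])
  have ah: "smooth_on (\<lambda>y. \<alpha> (h y) a b) N" for a b
    by (rule smooth_on_compose[where g = "\<lambda>y. \<alpha> y a b", OF h(1) \<alpha> h(3)])
  show "smooth_on (\<lambda>y. \<Sum>a\<in>Basis. \<Sum>b\<in>Basis. (f y \<bullet> a) * ((g y \<bullet> b) * \<alpha> (h y) a b)) N"
  proof (intro smooth_on_sum finite_Basis)
    fix a b
    show "smooth_on (\<lambda>y. (f y \<bullet> a) * ((g y \<bullet> b) * \<alpha> (h y) a b)) N"
      by (rule smooth_on_mult[OF fa[of a] smooth_on_mult[OF gb[of b] ah[of a b]]])
  qed
  show "(\<Sum>a\<in>Basis. \<Sum>b\<in>Basis. (f x \<bullet> a) * ((g x \<bullet> b) * \<alpha> (h x) a b)) = \<alpha> (h x) (f x) (g x)" if "x \<in> N" for x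
    by (rule bilinear_expand[symmetric], rule W) (use h that in auto)
qed

lemma frechet_derivative_cong_open:
  assumes "open N" "x \<in> N" "\<And>y. y \<in> N \<Longrightarrow> f y = g y"
  shows "fderiv f x = fderiv g x"
proof -
  have "(f has_derivative D) (at x) \<longleftrightarrow> (g has_derivative D) (at x)" for D
    using has_derivative_transform_within_open[OF _ assms(1,2)] assms(3) by metis
  then show ?thesis unfolding frechet_derivative_def by simp
qed

lemma exterior_derivative_cong_open:
  assumes "open N" "x \<in> N" "\<And>y u v. y \<in> N \<Longrightarrow> \<alpha> y u v = \<beta> y u v"
  shows "exterior_derivative \<alpha> x u v w = exterior_derivative \<beta> x u v w"
proof -
  have "fderiv (\<lambda>y. \<alpha> y a b) x = fderiv (\<lambda>y. \<beta> y a b) x" for a b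
    by (rule frechet_derivative_cong_open[OF assms(1,2)]) (rule assms(3))
  then show ?thesis by (simp add: exterior_derivative_def)
qed

definition smooth_near :: "('p, 'n::finite) charted_space \<Rightarrow> ('q, 'm::finite) charted_space \<Rightarrow> ('p \<Rightarrow> 'q) \<Rightarrow> 'p \<Rightarrow> bool" where
  "smooth_near M X R p \<longleftrightarrow> (\<exists>c\<in>atlas M. \<exists>e\<in>atlas X. smooth_at R p c e)"

lemma smooth_nearI: "c \<in> atlas M \<Longrightarrow> e \<in> atlas X \<Longrightarrow> smooth_at R p c e \<Longrightarrow> smooth_near M X R p"
  unfolding smooth_near_def by blast

lemma smooth_nearD:
  assumes "complex_manifold M" "complex_manifold X" "smooth_near M X R p" "c \<in> atlas M" "e \<in> atlas X" "p \<in> fst c" "R p \<in> fst e"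
  shows "smooth_at R p c e"
proof -
  obtain c' e' where "c' \<in> atlas M" "e' \<in> atlas X" "smooth_at R p c' e'"
    using assms(3) unfolding smooth_near_def by blast
  then show ?thesis
    using smooth_at_change_charts[where R = R and p = p, OF assms(1) _ assms(4,6) assms(2) _ assms(5,7)] by blast
qed

definition smooth_map :: "('p, 'n::finite) charted_space \<Rightarrow> ('q, 'm::finite) charted_space \<Rightarrow> ('p \<Rightarrow> 'q) \<Rightarrow> bool" where
  "smooth_map M X R \<longleftrightarrow> (\<forall>p\<in>topspace (mtop M). smooth_near M X R p)"

lemma smooth_mapD:
  assumes "complex_manifold M" "complex_manifold X" "smooth_map M X R" "c \<in> atlas M" "e \<in> atlas X" "p \<in> fst c" "R p \<in> fst e"
  shows "smooth_at R p c e"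
proof -
  have "p \<in> topspace (mtop M)"
    using assms(1,4,6) by (meson chart_in_topspace complex_manifold_chart)
  then have "smooth_near M X R p" using assms(3) by (simp add: smooth_map_def)
  from smooth_nearD[where R = R and p = p, OF assms(1,2) this assms(4-7)] show ?thesis .
qed

text \<open>The value is computed in an arbitrary chart of the target around the image point; by the transformation law
  of \<open>\<Omega>\<close> every such chart gives the same result, see \<open>pullback_form_eq\<close> below.\<close>

definition pullback_form ::
    "('x, 'm::finite) charted_space \<Rightarrow> ('x, 'm) two_form \<Rightarrow> ('p \<Rightarrow> 'x) \<Rightarrow> ('p, 'n::finite) two_form" where
  "pullback_form X \<Omega> R c x u v =
     (let e = (SOME e. e \<in> atlas X \<and> R (chart_inv c x) \<in> fst e);
          D = fderiv (local_map R c e) x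
      in \<Omega> e (local_map R c e x) (D u) (D v))"

lemma smooth_atD:
  assumes c: "topological_chart T c" and R: "smooth_at R p c e"
  shows "(local_map R c e has_derivative fderiv (local_map R c e) (snd c p)) (at (snd c p))"
proof -
  obtain N where "snd c p \<in> N" "smooth_on (local_map R c e) N"
    using R unfolding smooth_at_def by blast
  then show ?thesis by (rule smooth_on_has_derivative[rotated])
qed

lemma local_map_chain_rule:
  assumes c: "topological_chart T c" and d: "topological_chart T' d"
    and f: "smooth_at f p c d" and g: "smooth_at g (f p) d e"
  shows "fderiv (local_map (g \<circ> f) c e) (snd c p) v =
    fderiv (local_map g d e) (snd d (f p)) (fderiv (local_map f c d) (snd c p) v)"
proof -
  have p: "p \<in> fst c" using f by (simp add: smooth_at_def)
  have fp: "local_map f c d (snd c p) = snd d (f p)" by (rule local_map_chart[OF c p])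
  obtain N where N: "open N" "snd c p \<in> N" "\<And>x. x\<in>N \<Longrightarrow> f (chart_inv c x) \<in> fst d"
    using f unfolding smooth_at_def by blast
  have "((\<lambda>x. local_map g d e (local_map f c d x)) has_derivative
     (\<lambda>v. fderiv (local_map g d e) (snd d (f p)) (fderiv (local_map f c d) (snd c p) v))) (at (snd c p))"
    by (rule has_derivative_compose[OF smooth_atD[OF c f]]) (simp only: fp smooth_atD[OF d g])
  then have "(local_map (g \<circ> f) c e has_derivative
     (\<lambda>v. fderiv (local_map g d e) (snd d (f p)) (fderiv (local_map f c d) (snd c p) v))) (at (snd c p))"
    by (rule has_derivative_transform_within_open[OF _ N(1,2)]) (rule local_map_compose[where f = f and c = c, OF d N(3)])
  from frechet_derivative_at[OF this] show ?thesis by (rule fun_cong[symmetric])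
qed

lemma pullback_form_eq:
  assumes X: "complex_manifold X" "smooth_two_form X \<Omega>" and c: "topological_chart T c"
    and e: "e \<in> atlas X" and R: "smooth_at R p c e"
  shows "pullback_form X \<Omega> R c (snd c p) u v = \<Omega> e (snd e (R p))
     (fderiv (local_map R c e) (snd c p) u) (fderiv (local_map R c e) (snd c p) v)"
proof -
  have p: "p \<in> fst c" "R p \<in> fst e" using R by (auto simp: smooth_at_def)
  define e' where "e' = (SOME e. e \<in> atlas X \<and> R p \<in> fst e)"
  have e': "e' \<in> atlas X" "R p \<in> fst e'"
    using someI[of "\<lambda>e. e \<in> atlas X \<and> R p \<in> fst e" e] e p by (auto simp: e'_def)
  have che: "topological_chart (mtop X) e" "topological_chart (mtop X) e'"
    using X e e' by (auto intro: complex_manifold_chart)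
  let ?T = "local_map id e e'"
  have Tr: "smooth_at id (R p) e e'" by (rule smooth_at_transition[OF X(1) e e'(1) p(2) e'(2)])
  have chain: "fderiv (local_map R c e') (snd c p) v =
      fderiv ?T (snd e (R p)) (fderiv (local_map R c e) (snd c p) v)" for v
    using local_map_chain_rule[OF c che(1) R Tr, of v] by (simp only: id_comp)
  have inv: "chart_inv c (snd c p) = p" by (rule chart_inv_chart[OF c p(1)])
  have "pullback_form X \<Omega> R c (snd c p) u v = \<Omega> e' (snd e' (R p))
     (fderiv (local_map R c e') (snd c p) u) (fderiv (local_map R c e') (snd c p) v)"
    unfolding pullback_form_def inv e'_def[symmetric] Let_def local_map_chart[OF c p(1)] ..
  also have "\<dots> = \<Omega> e (snd e (R p))
     (fderiv (local_map R c e) (snd c p) u) (fderiv (local_map R c e) (snd c p) v)"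
  proof -
    have "snd e (R p) \<in> local_domain id e e'" using p e' by (auto simp: local_domain_def)
    then have "\<Omega> e (snd e (R p)) a b = \<Omega> e' (?T (snd e (R p))) (fderiv ?T (snd e (R p)) a) (fderiv ?T (snd e (R p)) b)" for a b
      using X(2) e e'(1) unfolding smooth_two_form_def by blast
    moreover have "?T (snd e (R p)) = snd e' (R p)" using local_map_chart[where f = id and d = e', OF che(1) p(2)] by simp
    ultimately show ?thesis by (simp add: chain)
  qed
  finally show ?thesis .
qed

text \<open>Near a point one chart \<open>e\<close> of the target can be kept fixed, which reduces smoothness and closedness to
  calculus in a vector space.\<close>

lemma pullback_form_local:
  assumes X: "complex_manifold X" "smooth_two_form X \<Omega>" and c: "topological_chart T c"
    and e: "e \<in> atlas X" and R: "smooth_at R p c e"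
  obtains N where "open N" "snd c p \<in> N" "smooth_on (local_map R c e) N" "local_map R c e ` N \<subseteq> chart_image e"
    "\<And>y u v. y \<in> N \<Longrightarrow> pullback_form X \<Omega> R c y u v = \<Omega> e (local_map R c e y)
       (fderiv (local_map R c e) y u) (fderiv (local_map R c e) y v)"
proof -
  obtain N where N: "open N" "snd c p \<in> N" "N \<subseteq> chart_image c" "\<And>x. x\<in>N \<Longrightarrow> R (chart_inv c x) \<in> fst e"
     "smooth_on (local_map R c e) N"
    using R unfolding smooth_at_def by blast
  show ?thesis
  proof (rule that[OF N(1,2,5)])
    show "local_map R c e ` N \<subseteq> chart_image e" using N(4) by (auto simp: local_map_def chart_image_def)
    fix y u v assume y: "y \<in> N"
    define q where "q = chart_inv c y"
    have y': "y \<in> chart_image c" using y N(3) by blast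
    have yq: "y = snd c q" unfolding q_def by (rule chart_chart_inv[OF y', symmetric])
    have "smooth_at R q c e"
      unfolding smooth_at_def
    proof (intro conjI exI[of _ N])
      show "q \<in> fst c" unfolding q_def by (rule chart_inv_in[OF y'])
      show "R q \<in> fst e" unfolding q_def by (rule N(4)[OF y])
      show "snd c q \<in> N" using y yq by simp
    qed (use N in auto)
    from pullback_form_eq[OF X c e this, of u v]
    show "pullback_form X \<Omega> R c y u v = \<Omega> e (local_map R c e y)
       (fderiv (local_map R c e) y u) (fderiv (local_map R c e) y v)"
      unfolding yq[symmetric] by (simp add: local_map_def q_def)
  qed
qed

lemma bilinear_compose_linear:
  assumes "bilinear \<beta>" "linear f"
  shows "bilinear (\<lambda>u v. \<beta> (f u) (f v))"
  using assms unfolding bilinear_def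
  by (auto intro: linear_compose[OF assms(2), unfolded o_def])

lemma pullback_form_alternating:
  assumes X: "complex_manifold X" "smooth_two_form X \<Omega>" and c: "topological_chart T c"
    and e: "e \<in> atlas X" and R: "smooth_at R p c e"
  shows "bilinear (pullback_form X \<Omega> R c (snd c p))" "pullback_form X \<Omega> R c (snd c p) u u = 0"
proof -
  have p: "p \<in> fst c" "R p \<in> fst e" using R by (auto simp: smooth_at_def)
  have "snd e (R p) \<in> chart_image e" by (rule chart_in_image[OF p(2)])
  then have W: "bilinear (\<Omega> e (snd e (R p)))" "\<And>u. \<Omega> e (snd e (R p)) u u = 0"
    using X(2) e unfolding smooth_two_form_def by blast+
  have "linear (fderiv (local_map R c e) (snd c p))"
    using smooth_atD[OF c R] by (rule has_derivative_linear)
  from bilinear_compose_linear[OF W(1) this]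
  show "bilinear (pullback_form X \<Omega> R c (snd c p))"
    by (simp add: pullback_form_eq[OF X c e R, abs_def])
  show "pullback_form X \<Omega> R c (snd c p) u u = 0"
    by (simp add: pullback_form_eq[OF X c e R] W(2))
qed

lemma smooth_two_form_pullback:
  assumes M: "complex_manifold M" and X: "complex_manifold X" "smooth_two_form X \<Omega>"
    and R: "smooth_map M X R"
  shows "smooth_two_form M (pullback_form X \<Omega> R)"
proof -
  have chart: "\<exists>e\<in>atlas X. smooth_at R p c e" if "c \<in> atlas M" "p \<in> fst c" for c p
  proof -
    have "p \<in> topspace (mtop M)" using M that by (meson chart_in_topspace complex_manifold_chart)
    then obtain e where "e \<in> atlas X" "R p \<in> fst e"
      using R unfolding smooth_map_def smooth_near_def smooth_at_def by blast
    then show ?thesis using smooth_mapD[OF M X(1) R that(1) _ that(2)] by blast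
  qed
  note ch = complex_manifold_chart[OF M]
  show ?thesis
    unfolding smooth_two_form_def
  proof (intro conjI ballI allI)
    fix c x assume c: "c \<in> atlas M" and "x \<in> chart_image c"
    then obtain p where p: "p \<in> fst c" "x = snd c p" by (auto simp: chart_image_def)
    obtain e where e: "e \<in> atlas X" "smooth_at R p c e" using chart[OF c p(1)] by blast
    show "bilinear (pullback_form X \<Omega> R c x)" "pullback_form X \<Omega> R c x u u = 0" for u
      unfolding p(2) by (rule pullback_form_alternating[OF X ch[OF c] e])+
  next
    fix c u v assume c: "c \<in> atlas M"
    show "smooth_on (\<lambda>x. pullback_form X \<Omega> R c x u v) (chart_image c)"
    proof (rule smooth_on_local)
      fix x assume "x \<in> chart_image c"
      then obtain p where p: "p \<in> fst c" "x = snd c p" by (auto simp: chart_image_def)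
      obtain e where e: "e \<in> atlas X" "smooth_at R p c e" using chart[OF c p(1)] by blast
      let ?h = "local_map R c e"
      obtain N where N: "open N" "snd c p \<in> N" "smooth_on ?h N" "?h ` N \<subseteq> chart_image e"
        "\<And>y u v. y \<in> N \<Longrightarrow> pullback_form X \<Omega> R c y u v = \<Omega> e (?h y) (fderiv ?h y u) (fderiv ?h y v)"
        using pullback_form_local[OF X ch[OF c] e] by metis
      have bil: "bilinear (\<Omega> e y)" if "y \<in> chart_image e" for y
        using X(2) e(1) that unfolding smooth_two_form_def by blast
      have sm: "smooth_on (\<lambda>y. \<Omega> e y u v) (chart_image e)" for u v
        using X(2) e(1) unfolding smooth_two_form_def by blast
      have "smooth_on (\<lambda>y. \<Omega> e (?h y) (fderiv ?h y u) (fderiv ?h y v)) N"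
        by (rule smooth_on_bilinear_form[where \<alpha> = "\<Omega> e" and h = ?h, OF bil sm N(3,1,4)
              smooth_on_derivative[OF N(3,1)] smooth_on_derivative[OF N(3,1)]])
      then have "smooth_on (\<lambda>x. pullback_form X \<Omega> R c x u v) N"
        by (rule smooth_on_cong[OF N(1), rotated]) (simp add: N(5))
      then show "\<exists>N. open N \<and> x \<in> N \<and> smooth_on (\<lambda>x. pullback_form X \<Omega> R c x u v) N"
        using N(1,2) p(2) by blast
    qed
  next
    fix c d x u v assume c: "c \<in> atlas M" and d: "d \<in> atlas M" and "x \<in> local_domain id c d"
    then obtain p where p: "p \<in> fst c" "p \<in> fst d" "x = snd c p" by (auto simp: local_domain_def)
    obtain e where e: "e \<in> atlas X" "smooth_at R p c e" using chart[OF c p(1)] by blast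
    have Rp: "R p \<in> fst e" using e by (simp add: smooth_at_def)
    have Rd: "smooth_at R p d e" by (rule smooth_mapD[OF M X(1) R d e(1) p(2) Rp])
    have tr: "smooth_at id p c d" by (rule smooth_at_transition[OF M c d p(1,2)])
    have chain: "fderiv (local_map R c e) (snd c p) v =
      fderiv (local_map R d e) (snd d p) (fderiv (local_map id c d) (snd c p) v)" for v
      using local_map_chain_rule[OF ch[OF c] ch[OF d] tr, of R e v] Rd by (simp only: comp_id id_apply)
    have T: "local_map id c d (snd c p) = snd d p" using local_map_chart[where f = id and d = d, OF ch[OF c] p(1)] by simp
    show "pullback_form X \<Omega> R c x u v = pullback_form X \<Omega> R d (local_map id c d x)
        (fderiv (local_map id c d) x u) (fderiv (local_map id c d) x v)"
      unfolding p(3) T pullback_form_eq[OF X ch[OF c] e] pullback_form_eq[OF X ch[OF d] e(1) Rd] chain ..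
  qed
qed

lemma exterior_derivative_pullback_form:
  assumes X: "complex_manifold X" "symplectic_form X \<Omega>" and c: "topological_chart T c"
    and e: "e \<in> atlas X" and R: "smooth_at R p c e"
  shows "exterior_derivative (pullback_form X \<Omega> R c) (snd c p) u v w = 0"
proof -
  have Om: "smooth_two_form X \<Omega>" using X(2) by (simp add: symplectic_form_def)
  let ?h = "local_map R c e"
  obtain N where N: "open N" "snd c p \<in> N" "smooth_on ?h N" "?h ` N \<subseteq> chart_image e"
    "\<And>y u v. y \<in> N \<Longrightarrow> pullback_form X \<Omega> R c y u v = \<Omega> e (?h y) (fderiv ?h y u) (fderiv ?h y v)"
    using pullback_form_local[OF X(1) Om c e R] by metis
  have W: "open (chart_image e)"
    using complex_manifold_chart[OF X(1) e] by (simp add: topological_chart_def)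
  have bil: "bilinear (\<Omega> e y)" "\<Omega> e y u u = 0" if "y \<in> chart_image e" for y u
    using Om e(1) that unfolding smooth_two_form_def by blast+
  have sm: "smooth_on (\<lambda>y. \<Omega> e y u v) (chart_image e)" for u v
    using Om e(1) unfolding smooth_two_form_def by blast
  have "exterior_derivative (pullback_form X \<Omega> R c) (snd c p) u v w =
     exterior_derivative (\<lambda>y u v. \<Omega> e (?h y) (fderiv ?h y u) (fderiv ?h y v)) (snd c p) u v w"
    by (rule exterior_derivative_cong_open[OF N(1,2)]) (rule N(5))
  also have "\<dots> = exterior_derivative (\<Omega> e) (?h (snd c p)) (fderiv ?h (snd c p) u)
       (fderiv ?h (snd c p) v) (fderiv ?h (snd c p) w)"
    by (rule exterior_derivative_pullback[where \<alpha> = "\<Omega> e" and h = ?h, OF W bil sm N(3,1,4,2)])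
  also have "\<dots> = 0"
    using X(2) e N(2,4) unfolding symplectic_form_def by blast
  finally show ?thesis .
qed

section \<open>Non-degeneracy in holomorphic charts\<close>

text \<open>The pointwise condition on a pseudo-Hermitian-symplectic form.\<close>

definition strongly_nondegenerate :: "((complex, 'n::finite) vec \<Rightarrow> (complex, 'n) vec \<Rightarrow> real) \<Rightarrow> bool" where
  "strongly_nondegenerate \<beta> \<longleftrightarrow> nondegenerate \<beta> \<and> nondegenerate (component_1_1 (complexify \<beta>))"

lemma strongly_nondegenerate_iff:
  assumes "bilinear \<beta>" "\<And>u. \<beta> u u = 0"
  shows "strongly_nondegenerate \<beta> \<longleftrightarrow> nondegenerate \<beta> \<and> nondegenerate (\<lambda>u v. \<beta> u v + \<beta> (\<i> *s u) (\<i> *s v))"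
  unfolding strongly_nondegenerate_def nondegenerate_component_1_1[OF assms] ..

lemma nondegenerate_compose:
  assumes "nondegenerate \<beta>" "linear f" "bij f"
  shows "nondegenerate (\<lambda>u v. \<beta> (f u) (f v))"
  unfolding nondegenerate_def
proof (intro allI impI)
  fix u assume u: "\<forall>v. \<beta> (f u) (f v) = 0"
  have "\<beta> (f u) w = 0" for w
  proof -
    obtain v where "w = f v" using bij_is_surj[OF assms(3)] by (metis surjD)
    then show ?thesis using u by simp
  qed
  then have "f u = f 0" using assms(1) linear_0[OF assms(2)] unfolding nondegenerate_def by metis
  then show "u = 0" using bij_is_inj[OF assms(3)] by (simp add: inj_eq)
qed

lemma strongly_nondegenerate_compose:
  assumes b: "bilinear \<beta>" "\<And>u. \<beta> u u = 0" and f: "linear f" "bij f" "\<And>u. f (\<i> *s u) = \<i> *s f u"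
    and g: "strongly_nondegenerate \<beta>"
  shows "strongly_nondegenerate (\<lambda>u v. \<beta> (f u) (f v))"
proof -
  have "nondegenerate (\<lambda>u v. \<beta> (f u) (f v))"
    using g nondegenerate_compose[OF _ f(1,2)] unfolding strongly_nondegenerate_def by blast
  moreover have "nondegenerate (\<lambda>u v. \<beta> (f u) (f v) + \<beta> (\<i> *s f u) (\<i> *s f v))"
    using g nondegenerate_compose[where \<beta> = "\<lambda>u v. \<beta> u v + \<beta> (\<i> *s u) (\<i> *s v)", OF _ f(1,2)] unfolding strongly_nondegenerate_iff[OF b] by blast
  ultimately show ?thesis
    by (subst strongly_nondegenerate_iff[OF bilinear_compose_linear[OF b(1) f(1)]]) (simp_all add: b(2) f(3))
qed

lemma strongly_nondegenerate_open:
  fixes \<beta> :: "'y::topological_space \<Rightarrow> (complex, 'n::finite) vec \<Rightarrow> (complex, 'n) vec \<Rightarrow> real"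
  assumes N: "open N" "y0 \<in> N" and b: "\<And>y. y \<in> N \<Longrightarrow> bilinear (\<beta> y)" "\<And>y u. y \<in> N \<Longrightarrow> \<beta> y u u = 0"
    and cont: "\<And>u v. continuous_on N (\<lambda>y. \<beta> y u v)" and g: "strongly_nondegenerate (\<beta> y0)"
  obtains N' where "open N'" "y0 \<in> N'" "N' \<subseteq> N" "\<And>y. y \<in> N' \<Longrightarrow> strongly_nondegenerate (\<beta> y)"
proof -
  define \<gamma> where "\<gamma> y u v = \<beta> y u v + \<beta> y (\<i> *s u) (\<i> *s v)" for y u v
  have \<gamma>: "\<gamma> y = (\<lambda>u v. \<beta> y u v + \<beta> y (\<i> *s u) (\<i> *s v))" for y by (simp add: \<gamma>_def[abs_def])
  have i: "linear (\<lambda>u. \<i> *s u :: (complex, 'n) vec)"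
    using bounded_linear_vector_smult_right by (rule bounded_linear.linear)
  have bil: "bilinear (\<gamma> y)" if "y \<in> N" for y
    unfolding \<gamma> using b(1)[OF that] bilinear_compose_linear[OF b(1)[OF that] i]
    unfolding bilinear_def by (auto intro: linear_compose_add)
  have g0: "nondegenerate (\<beta> y0)" "nondegenerate (\<gamma> y0)"
    using g unfolding \<gamma> strongly_nondegenerate_iff[OF b[OF N(2)]] by blast+
  obtain N1 where N1: "open N1" "y0 \<in> N1" "N1 \<subseteq> N" "\<And>y. y \<in> N1 \<Longrightarrow> nondegenerate (\<beta> y)"
    using nondegenerate_open[of N y0 \<beta>, OF N b(1) cont g0(1)] by metis
  have c2: "continuous_on N (\<lambda>y. \<gamma> y u v)" for u v unfolding \<gamma>_def by (intro continuous_on_add cont)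
  obtain N2 where N2: "open N2" "y0 \<in> N2" "N2 \<subseteq> N" "\<And>y. y \<in> N2 \<Longrightarrow> nondegenerate (\<gamma> y)"
    using nondegenerate_open[of N y0 \<gamma>, OF N bil c2 g0(2)] by metis
  show ?thesis
  proof (rule that[of "N1 \<inter> N2"])
    fix y assume y: "y \<in> N1 \<inter> N2"
    then have yN: "y \<in> N" using N1 by blast
    show "strongly_nondegenerate (\<beta> y)" unfolding strongly_nondegenerate_iff[OF b[OF yN]] \<gamma>[symmetric] using N1(4) N2(4) y by blast
  qed (use N1 N2 in auto)
qed

lemma holomorphic_mapD:
  assumes "holomorphic_map M N f" "c \<in> atlas M" "d \<in> atlas N"
  shows "holomorphic_map_on (local_map f c d) (local_domain f c d)"
  using assms by (simp add: holomorphic_map_def)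

lemma holomorphic_map_smooth_at:
  assumes "complex_manifold M" "complex_manifold N" "holomorphic_map M N f" "c \<in> atlas M" "d \<in> atlas N" "p \<in> fst c" "f p \<in> fst d"
  shows "smooth_at f p c d"
  by (rule holomorphic_imp_smooth_at[where T = "mtop M" and T' = "mtop N"])
    (use assms complex_manifold_chart[OF assms(1,4)] complex_manifold_chart[OF assms(2,5)] in
      \<open>simp_all add: holomorphic_map_def\<close>)

lemma holomorphic_map_id: "complex_manifold M \<Longrightarrow> holomorphic_map M M id"
  by (simp add: holomorphic_map_def complex_manifold_def)

lemma bij_derivative_of_biholomorphic:
  fixes M :: "('p, 'n::finite) charted_space" and N :: "('q, 'n) charted_space"
  assumes M: "complex_manifold M" and N: "complex_manifold N"
    and f: "holomorphic_map M N f" and g: "holomorphic_map N M g"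
    and gf: "\<And>q. q \<in> topspace (mtop M) \<Longrightarrow> g (f q) = q"
    and c: "c \<in> atlas M" and d: "d \<in> atlas N" and p: "p \<in> fst c" "f p \<in> fst d"
  shows "linear (fderiv (local_map f c d) (snd c p))"
    "bij (fderiv (local_map f c d) (snd c p))"
    "fderiv (local_map f c d) (snd c p) (a *s u) = a *s fderiv (local_map f c d) (snd c p) u"
proof -
  note ch = complex_manifold_chart[OF M c] complex_manifold_chart[OF N d]
  let ?D = "fderiv (local_map f c d) (snd c p)"
  have dom: "snd c p \<in> local_domain f c d" using p by (auto simp: local_domain_def)
  show lin: "linear ?D"
    using holomorphic_map_onD(1)[OF holomorphic_mapD[OF f c d] dom] by (rule has_derivative_linear)
  show "?D (a *s u) = a *s ?D u"
    by (rule holomorphic_map_onD(2)[OF holomorphic_mapD[OF f c d] dom])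
  have pM: "p \<in> topspace (mtop M)" by (rule chart_in_topspace[OF ch(1) p(1)])
  have sf: "smooth_at f p c d" by (rule holomorphic_map_smooth_at[OF M N f c d p])
  have sg: "smooth_at g (f p) d c" by (rule holomorphic_map_smooth_at[OF N M g d c p(2)]) (simp add: gf[OF pM] p(1))
  have "?D u = ?D v \<Longrightarrow> u = v" for u v
  proof -
    assume eq: "?D u = ?D v"
    have "(local_map (g \<circ> f) c c has_derivative (\<lambda>u. u)) (at (snd c p))"
    proof (rule has_derivative_transform_within_open[OF has_derivative_ident])
      show "open (chart_image c)" using ch(1) by (simp add: topological_chart_def)
      show "snd c p \<in> chart_image c" by (rule chart_in_image[OF p(1)])
      fix y assume y: "y \<in> chart_image c"
      have "chart_inv c y \<in> topspace (mtop M)"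
        by (rule chart_in_topspace[OF ch(1) chart_inv_in[OF y]])
      then show "y = local_map (g \<circ> f) c c y"
        using gf chart_chart_inv[OF y] by (simp add: local_map_def)
    qed
    from frechet_derivative_at[OF this]
    have "fderiv (local_map (g \<circ> f) c c) (snd c p) w = w" for w by metis
    then show "u = v"
      unfolding local_map_chain_rule[OF ch sf sg] using eq by metis
  qed
  then have "inj ?D" by (rule injI)
  then show "bij ?D" using linear_injective_imp_surjective[OF lin] by (simp add: bij_def)
qed

lemma strongly_nondegenerate_change_chart:
  assumes M: "complex_manifold M" and \<omega>: "smooth_two_form M \<omega>" and cd: "c \<in> atlas M" "d \<in> atlas M"
    and p: "p \<in> fst c" "p \<in> fst d" and g: "strongly_nondegenerate (\<omega> d (snd d p))"
  shows "strongly_nondegenerate (\<omega> c (snd c p))"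
proof -
  let ?D = "fderiv (local_map id c d) (snd c p)"
  note D = bij_derivative_of_biholomorphic[OF M M holomorphic_map_id[OF M] holomorphic_map_id[OF M] _ cd p(1), simplified, OF p(2)]
  have "snd c p \<in> local_domain id c d" using p by (auto simp: local_domain_def)
  then have "\<omega> c (snd c p) u v = \<omega> d (local_map id c d (snd c p)) (?D u) (?D v)" for u v
    using \<omega> cd unfolding smooth_two_form_def by blast
  moreover have "local_map id c d (snd c p) = snd d p"
    using local_map_chart[where f = id and d = d, OF complex_manifold_chart[OF M cd(1)] p(1)] by simp
  moreover have "bilinear (\<omega> d (snd d p))" "\<And>u. \<omega> d (snd d p) u u = 0"
    using \<omega> cd(2) chart_in_image[OF p(2)] unfolding smooth_two_form_def by blast+
  ultimately have "strongly_nondegenerate (\<lambda>u v. \<omega> d (snd d p) (?D u) (?D v))"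
      "\<omega> c (snd c p) = (\<lambda>u v. \<omega> d (snd d p) (?D u) (?D v))"
    by (auto intro!: strongly_nondegenerate_compose[OF _ _ D(1,2) D(3) g])
  then show ?thesis by simp
qed

section \<open>Structures induced on subsets\<close>

text \<open>Composing with a linear left inverse of the derivative of \<open>G'\<close>, one may assume that \<open>G'\<close> has derivative
  the identity at the point. Then distances between values of \<open>T\<close> are controlled by those between values of \<open>G\<close>,
  so \<open>T\<close> is Lipschitz at \<open>x\<close> and inherits the linear approximation of \<open>G\<close>.\<close>

lemma has_derivative_lift:
  fixes G' :: "'b::euclidean_space \<Rightarrow> 'c::euclidean_space" and T :: "'a::euclidean_space \<Rightarrow> 'b"
  assumes G: "(G has_derivative B) (at x)" and G': "(G' has_derivative A) (at (T x))" and inj: "inj A"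
    and T: "isCont T x" and N: "open N" "x \<in> N" "\<And>y. y \<in> N \<Longrightarrow> G' (T y) = G y"
  obtains T' where "(T has_derivative T') (at x)" "\<And>v. A (T' v) = B v"
proof -
  have linA: "linear A" using G' by (rule has_derivative_linear)
  obtain L where L: "linear L" "L \<circ> A = id"
    using linear_injective_left_inverse[OF linA inj] by blast
  have LA: "L (A v) = v" for v using L(2) by (metis comp_apply id_apply)
  have bL: "bounded_linear L" using L(1) by (simp add: linear_conv_bounded_linear)
  have H: "((\<lambda>y. L (G' y)) has_derivative (\<lambda>v. v)) (at (T x))"
    using bounded_linear.has_derivative[OF bL G'] by (simp add: LA)
  have K: "((\<lambda>y. L (G y)) has_derivative (\<lambda>v. L (B v))) (at x)"
    by (rule bounded_linear.has_derivative[OF bL G])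
  define K' where "K' = (\<lambda>v. L (B v))"
  have bK: "bounded_linear K'" unfolding K'_def using K by (rule has_derivative_bounded_linear)
  obtain C where C: "C > 0" "\<And>v. norm (K' v) \<le> norm v * C" using bounded_linear.pos_bounded[OF bK] by blast
  have estH: "\<exists>d>0. \<forall>y. norm (y - T x) < d \<longrightarrow> norm (L (G' y) - L (G' (T x)) - (y - T x)) \<le> e * norm (y - T x)" if "e > 0" for e
    using H that unfolding has_derivative_at_alt by blast
  have estK: "\<exists>d>0. \<forall>y. norm (y - x) < d \<longrightarrow> norm (L (G y) - L (G x) - K' (y - x)) \<le> e * norm (y - x)" if "e > 0" for e
    using K that unfolding has_derivative_at_alt K'_def by blast
  have "(T has_derivative K') (at x)"
    unfolding has_derivative_at_alt
  proof (intro conjI allI impI bK)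
    fix e :: real assume e: "e > 0"
    \<comment> \<open>The bound \<open>1/2\<close> lets the term \<open>e1 * norm (T y - T x)\<close> be absorbed, which shows that \<open>T\<close> is Lipschitz at \<open>x\<close>
      with constant \<open>2 * C + 1\<close>; the second bound then yields the error \<open>e\<close>.\<close>
    define e1 where "e1 = min (1/2) (e / (2 * C + 4))"
    have e1: "e1 > 0" using e C by (simp add: e1_def)
    have e1_half: "e1 \<le> 1/2" unfolding e1_def by (rule min.cobounded1)
    have e1': "e1 * (2 * C + 4) \<le> e"
    proof -
      have "e1 * (2 * C + 4) \<le> e / (2 * C + 4) * (2 * C + 4)"
        using C by (intro mult_right_mono) (auto simp: e1_def)
      then show ?thesis using C by simp
    qed
    obtain d1 where d1: "d1 > 0" "\<And>y. norm (y - T x) < d1 \<Longrightarrow> norm (L (G' y) - L (G' (T x)) - (y - T x)) \<le> e1 * norm (y - T x)"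
      using estH[OF e1(1)] by blast
    obtain d2 where d2: "d2 > 0" "\<And>y. norm (y - x) < d2 \<Longrightarrow> norm (L (G y) - L (G x) - K' (y - x)) \<le> e1 * norm (y - x)"
      using estK[OF e1(1)] by blast
    obtain d3 where d3: "d3 > 0" "\<And>y. norm (y - x) < d3 \<Longrightarrow> norm (T y - T x) < d1"
      using T d1(1) unfolding continuous_at_eps_delta dist_norm by blast
    obtain d4 where d4: "d4 > 0" "ball x d4 \<subseteq> N" using N openE by blast
    show "\<exists>d>0. \<forall>y. norm (y - x) < d \<longrightarrow> norm (T y - T x - K' (y - x)) \<le> e * norm (y - x)"
    proof (intro exI[of _ "min d2 (min d3 d4)"] conjI allI impI)
      fix y assume y: "norm (y - x) < min d2 (min d3 d4)"
      have "y \<in> N" using y d4(2) by (auto simp: dist_norm norm_minus_commute)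
      then have Gy: "L (G' (T y)) = L (G y)" using N(3) by simp
      have Gx: "L (G' (T x)) = L (G x)" using N by simp
      have h: "norm (L (G y) - L (G x) - (T y - T x)) \<le> e1 * norm (T y - T x)"
        using d1(2)[of "T y"] d3(2)[of y] y by (simp add: Gy Gx)
      have k: "norm (L (G y) - L (G x) - K' (y - x)) \<le> e1 * norm (y - x)"
        using d2(2) y by simp
      define a where "a = norm (T y - T x)"
      define b where "b = norm (y - x)"
      have b0: "b \<ge> 0" "a \<ge> 0" by (simp_all add: a_def b_def)
      have t1: "norm (T y - T x - K' (y - x)) \<le> e1 * a + e1 * b"
      proof -
        have "T y - T x - K' (y - x) = (L (G y) - L (G x) - K' (y - x)) - (L (G y) - L (G x) - (T y - T x))" by simp
        then have "norm (T y - T x - K' (y - x)) \<le> norm (L (G y) - L (G x) - K' (y - x)) + norm (L (G y) - L (G x) - (T y - T x))"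
          by (metis norm_triangle_ineq4)
        then show ?thesis using h k unfolding a_def b_def by linarith
      qed
      have "a \<le> norm (T y - T x - K' (y - x)) + norm (K' (y - x))"
        unfolding a_def using norm_triangle_ineq[of "T y - T x - K' (y - x)" "K' (y - x)"] by simp
      also have "\<dots> \<le> e1 * a + e1 * b + b * C" using t1 C(2)[of "y - x"] by (simp add: b_def)
      also have "\<dots> \<le> 1/2 * a + 1/2 * b + b * C"
        using e1_half b0 by (intro add_mono mult_right_mono order_refl) auto
      finally have "a \<le> (2 * C + 1) * b" by (simp add: algebra_simps)
      then have "e1 * a + e1 * b \<le> e1 * ((2 * C + 1) * b) + e1 * b" using e1 by simp
      also have "\<dots> = e1 * (2 * C + 2) * b" by (simp add: algebra_simps)
      also have "\<dots> \<le> e * b"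
      proof (rule mult_right_mono[OF _ b0(1)])
        have "e1 * (2 * C + 2) \<le> e1 * (2 * C + 4)" using e1 by (intro mult_left_mono) auto
        then show "e1 * (2 * C + 2) \<le> e" using e1' by linarith
      qed
      finally show "norm (T y - T x - K' (y - x)) \<le> e * norm (y - x)" using t1 by (simp add: b_def)
    qed (use d2 d3 d4 in auto)
  qed
  moreover have "A (K' v) = B v" for v
  proof -
    have "((\<lambda>y. G' (T y)) has_derivative (\<lambda>v. A (K' v))) (at x)"
      by (rule has_derivative_compose[OF calculation G'])
    then have "(G has_derivative (\<lambda>v. A (K' v))) (at x)"
      by (rule has_derivative_transform_within_open[OF _ N(1,2)]) (rule N(3))
    from has_derivative_unique[OF G this] show ?thesis by metis
  qed
  ultimately show ?thesis using that by blast
qed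

lemma induced_structure_simps [simp]:
  "mtop (induced_structure M S) = subtopology (mtop M) S"
  "c \<in> atlas (induced_structure M S) \<longleftrightarrow> topological_chart (subtopology (mtop M) S) c \<and>
      (\<forall>d\<in>atlas M. holomorphic_map_on (local_map id c d) (local_domain id c d) \<and>
        (\<forall>x\<in>local_domain id c d. inj (fderiv (local_map id c d) x)))"
  by (simp_all add: induced_structure_def)

lemma local_map_id_continuous:
  assumes c: "topological_chart T c" and d: "topological_chart T d"
  shows "open (local_domain id c d)" "continuous_on (local_domain id c d) (local_map id c d)"
proof -
  show o: "open (local_domain id c d)" by (rule local_domain_open[OF c d]) simp
  show "continuous_on (local_domain id c d) (local_map id c d)"
    unfolding continuous_on_open_vimage[OF o]
  proof (intro allI impI)
    fix B :: "(complex, 'c) vec set" assume B: "open B"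
    have "open (snd c ` (fst c \<inter> {q \<in> fst d. snd d q \<in> B}))"
      by (rule chart_open_image[OF c chart_open_vimage[OF d B]])
    also have "snd c ` (fst c \<inter> {q \<in> fst d. snd d q \<in> B}) = local_map id c d -` B \<inter> local_domain id c d"
      using c by (auto simp: local_domain_def local_map_def)
    finally show "open (local_map id c d -` B \<inter> local_domain id c d)" .
  qed
qed

text \<open>Both charts are immersions into \<open>M\<close>, and the transition map is the lift of one through the other.\<close>

lemma induced_structure_transition_holomorphic:
  fixes M :: "('p, 'n::finite) charted_space" and c d :: "('p, 'k::finite) chart"
  assumes M: "complex_manifold M" and c: "c \<in> atlas (induced_structure M S)" and d: "d \<in> atlas (induced_structure M S)"
  shows "holomorphic_map_on (local_map id c d) (local_domain id c d)"
  unfolding holomorphic_map_on_def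
proof
  fix x assume x: "x \<in> local_domain id c d"
  then obtain p where p: "p \<in> fst c" "p \<in> fst d" "x = snd c p" by (auto simp: local_domain_def)
  have ch: "topological_chart (subtopology (mtop M) S) c" "topological_chart (subtopology (mtop M) S) d"
    using c d by simp_all
  have "p \<in> topspace (mtop M)" using chart_in_topspace[OF ch(1) p(1)] by simp
  then obtain e where e: "e \<in> atlas M" "p \<in> fst e" using complex_manifold_obtain_chart[OF M] by blast
  have xe: "snd c p \<in> local_domain id c e" "snd d p \<in> local_domain id d e"
    using p e by (auto simp: local_domain_def)
  let ?G = "local_map id c e" and ?G' = "local_map id d e" and ?T = "local_map id c d"
  have hG: "holomorphic_map_on ?G (local_domain id c e)" and hG': "holomorphic_map_on ?G' (local_domain id d e)"
    and inj: "inj (fderiv ?G' (snd d p))"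
    using c d e xe by auto
  have Tx: "?T (snd c p) = snd d p" using local_map_chart[where f = id and d = d, OF ch(1) p(1)] by simp
  obtain T' where T': "(?T has_derivative T') (at (snd c p))"
    "\<And>v. fderiv ?G' (snd d p) (T' v) = fderiv ?G (snd c p) v"
  proof (rule has_derivative_lift[where T = ?T and x = "snd c p" and N = "local_domain id c d"])
    show "(?G has_derivative fderiv ?G (snd c p)) (at (snd c p))"
      by (rule holomorphic_map_onD(1)[OF hG xe(1)])
    show "(?G' has_derivative fderiv ?G' (snd d p)) (at (?T (snd c p)))"
      unfolding Tx by (rule holomorphic_map_onD(1)[OF hG' xe(2)])
    show "isCont ?T (snd c p)"
      using local_map_id_continuous[OF ch] x p(3) by (auto simp: continuous_on_eq_continuous_at)
    show "?G' (?T y) = ?G y" if "y \<in> local_domain id c d" for y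
    proof -
      have "id (chart_inv c y) \<in> fst d" using that unfolding local_domain_iff[OF ch(1)] by blast
      from local_map_compose[where f = id and c = c and x = y and g = id and e = e, OF ch(2) this] show ?thesis by simp
    qed
  qed (use local_map_id_continuous[OF ch] x p(3) inj in auto)
  have "T' (a *s v) = a *s T' v" for a v
  proof -
    have "fderiv ?G' (snd d p) (T' (a *s v)) = fderiv ?G' (snd d p) (a *s T' v)"
      unfolding T'(2) holomorphic_map_onD(2)[OF hG xe(1)] holomorphic_map_onD(2)[OF hG' xe(2)] ..
    then show ?thesis using inj by (simp add: inj_eq)
  qed
  then show "\<exists>f'. (?T has_derivative f') (at x) \<and> (\<forall>a v. f' (a *s v) = a *s f' v)"
    using T'(1) p(3) by blast
qed

lemma complex_manifold_induced_structure:
  fixes M :: "('p, 'n::finite) charted_space"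
  assumes M: "complex_manifold M"
    and cover: "\<And>p. p \<in> topspace (mtop M) \<inter> S \<Longrightarrow>
      \<exists>c\<in>atlas (induced_structure M S :: ('p, 'k::finite) charted_space). p \<in> fst c"
  shows "complex_manifold (induced_structure M S :: ('p, 'k) charted_space)"
    (is "complex_manifold ?N")
  unfolding complex_manifold_def
proof (intro conjI ballI)
  show "Hausdorff_space (mtop (?N))" "second_countable (mtop (?N))"
    using M by (simp_all add: complex_manifold_def Hausdorff_space_subtopology second_countable_subtopology)
  show "topological_chart (mtop (?N)) c" if "c \<in> atlas (induced_structure M S)" for c :: "('p, 'k) chart"
    using that by simp
  show "holomorphic_map_on (local_map id c d) (local_domain id c d)"
    if "c \<in> atlas (induced_structure M S)" "d \<in> atlas (induced_structure M S)" for c d :: "('p, 'k) chart"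
    by (rule induced_structure_transition_holomorphic[OF M that])
  show "\<Union> (fst ` atlas (?N)) = topspace (mtop (?N))"
  proof
    show "\<Union> (fst ` atlas (?N)) \<subseteq> topspace (mtop (?N))"
      using chart_in_topspace by fastforce
    show "topspace (mtop (?N)) \<subseteq> \<Union> (fst ` atlas (?N))"
      using cover by (auto simp del: induced_structure_simps(2))
  qed
qed

lemma smooth_at_inclusion:
  assumes M: "complex_manifold M" and c: "c \<in> atlas (induced_structure M S)" and d: "d \<in> atlas M"
    and p: "p \<in> fst c" "p \<in> fst d"
  shows "smooth_at id p c d"
  by (rule holomorphic_imp_smooth_at[where T = "subtopology (mtop M) S" and T' = "mtop M"])
    (use assms complex_manifold_chart[OF M d] in \<open>simp_all add: continuous_map_id_subt\<close>)

lemma smooth_at_restrict: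
  assumes E: "complex_manifold E" and a: "a \<in> atlas (induced_structure E S)" "p \<in> fst a"
    and d: "d \<in> atlas E" and R: "smooth_at R p d e"
  shows "smooth_at R p a e"
proof -
  have pd: "p \<in> fst d" using R by (simp add: smooth_at_def)
  have cha: "topological_chart (subtopology (mtop E) S) a" using a(1) by simp
  have "smooth_at (R \<circ> id) p a e"
    by (rule smooth_at_compose[where f = id and g = R,
          OF cha complex_manifold_chart[OF E d] smooth_at_inclusion[OF E a(1) d a(2) pd]]) (simp add: R)
  then show ?thesis by simp
qed

section \<open>Charts adapted to the fibres of a submersion\<close>

lemma chart_inv_continuous_map:
  assumes c: "topological_chart T c"
  shows "continuous_map (top_of_set (chart_image c)) T (chart_inv c)"
  unfolding continuous_map_def
proof (intro conjI allI impI)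
  show "chart_inv c \<in> topspace (top_of_set (chart_image c)) \<rightarrow> topspace T"
    using chart_in_topspace[OF c chart_inv_in] by auto
  fix O' assume O': "openin T O'"
  have "open (snd c ` (fst c \<inter> O'))" by (rule chart_open_image[OF c O'])
  moreover have "{x \<in> topspace (top_of_set (chart_image c)). chart_inv c x \<in> O'} = snd c ` (fst c \<inter> O')"
    using c by (auto simp: chart_chart_inv chart_inv_in chart_in_image intro!: image_eqI[where x = "chart_inv c _"] chart_chart_inv[symmetric])
  ultimately show "openin (top_of_set (chart_image c)) {x \<in> topspace (top_of_set (chart_image c)). chart_inv c x \<in> O'}"
    by (metis (no_types, lifting) image_mono inf_le1 chart_image_def open_subset)
qed

lemma chart_continuous_map:
  assumes c: "topological_chart T c"
  shows "continuous_map (subtopology T (fst c)) euclidean (snd c)"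
proof -
  have "continuous_map (subtopology T (fst c)) (top_of_set (chart_image c)) (snd c)"
    using c homeomorphic_imp_continuous_map by (auto simp: topological_chart_def)
  then show ?thesis by (simp add: continuous_map_in_subtopology)
qed

text \<open>Near a point of the total space, \<open>\<Phi> x = B (F x) + C (L x)\<close> is a holomorphic coordinate whose first
  summand labels the fibre: \<open>F\<close> is the projection in charts, \<open>B\<close> splits its derivative at the point, and
  \<open>C\<close> and \<open>L\<close> identify the kernel of that derivative with the model space of the fibre. \<open>\<Psi>\<close> inverts \<open>\<Phi>\<close>.\<close>

locale adapted_coordinates =
  fixes E :: "('p, 'k::finite) charted_space" and D :: "('q, 'm::finite) charted_space"
    and \<pi> :: "'p \<Rightarrow> 'q" and d :: "('p, 'k) chart" and q :: "('q, 'm) chart"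
    and U V :: "(complex, 'k) vec set" and B :: "(complex, 'm) vec \<Rightarrow> (complex, 'k) vec"
    and C :: "(complex, 'n::finite) vec \<Rightarrow> (complex, 'k) vec" and L :: "(complex, 'k) vec \<Rightarrow> (complex, 'n) vec"
    and \<Psi> :: "(complex, 'k) vec \<Rightarrow> (complex, 'k) vec"
  assumes E: "complex_manifold E" and D: "complex_manifold D" and \<pi>: "holomorphic_map E D \<pi>"
    and d: "d \<in> atlas E" and q: "q \<in> atlas D"
    and U: "open U" "U \<subseteq> local_domain \<pi> d q" and V: "open V"
    and B: "linear B" and C: "linear C" "inj C" "\<And>a v. C (a *s v) = a *s C v" and L: "linear L"
    and L_scale: "\<And>a v. L (a *s v) = a *s L v"
    and \<Phi>: "\<And>x. x \<in> U \<Longrightarrow> B (local_map \<pi> d q x) + C (L x) \<in> V"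
      "\<And>x. x \<in> U \<Longrightarrow> \<Psi> (B (local_map \<pi> d q x) + C (L x)) = x"
    and \<Psi>: "\<And>y. y \<in> V \<Longrightarrow> \<Psi> y \<in> U"
      "\<And>\<tau> u. B \<tau> + C u \<in> V \<Longrightarrow> local_map \<pi> d q (\<Psi> (B \<tau> + C u)) = \<tau> \<and> L (\<Psi> (B \<tau> + C u)) = u"
    and \<Psi>_hol: "holomorphic_map_on \<Psi> V" and \<Psi>_inj: "\<And>y. y \<in> V \<Longrightarrow> inj (fderiv \<Psi> y)"
begin

lemma chd: "topological_chart (mtop E) d" by (rule complex_manifold_chart[OF E d])
lemma chq: "topological_chart (mtop D) q" by (rule complex_manifold_chart[OF D q])

lemma U_image: "U \<subseteq> chart_image d"
  using U(2) by (auto simp: local_domain_def chart_image_def)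

definition \<Phi>_map where "\<Phi>_map p = B (snd q (\<pi> p)) + C (L (snd d p))"

text \<open>The chart of the fibre over \<open>t\<close> obtained by restricting the fibre coordinate \<open>L\<close>. The fibre coordinate
  is the same linear map for all \<open>t\<close>; only the domain moves.\<close>

definition slice :: "'q \<Rightarrow> ('p, 'n) chart" where
  "slice t = ({p \<in> fst d. snd d p \<in> U \<and> \<pi> p = t}, \<lambda>p. L (snd d p))"

lemma coordinates_of_point: assumes "p \<in> fst d" "snd d p \<in> U"
  shows "\<pi> p \<in> fst q" "local_map \<pi> d q (snd d p) = snd q (\<pi> p)" "\<Phi>_map p \<in> V" "\<Psi> (\<Phi>_map p) = snd d p"
proof -
  show "\<pi> p \<in> fst q"
    using assms U(2) chart_inv_chart[OF chd assms(1)] local_domain_iff[OF chd, of "snd d p" \<pi> q] by auto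
  show lm: "local_map \<pi> d q (snd d p) = snd q (\<pi> p)" by (rule local_map_chart[OF chd assms(1)])
  show "\<Phi>_map p \<in> V" "\<Psi> (\<Phi>_map p) = snd d p"
    using \<Phi>[OF assms(2)] unfolding lm \<Phi>_map_def by blast+
qed

lemma point_of_coordinates:
  assumes t: "t \<in> fst q" and y: "B (snd q t) + C u \<in> V"
  defines "p \<equiv> chart_inv d (\<Psi> (B (snd q t) + C u))"
  shows "p \<in> fst d" "snd d p = \<Psi> (B (snd q t) + C u)" "snd d p \<in> U" "\<pi> p = t" "L (snd d p) = u" "p \<in> fst (slice t)"
proof -
  let ?x = "\<Psi> (B (snd q t) + C u)"
  have xU: "?x \<in> U" by (rule \<Psi>(1)[OF y])
  then have xd: "?x \<in> chart_image d" using U_image by blast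
  show p: "p \<in> fst d" unfolding p_def by (rule chart_inv_in[OF xd])
  show sp: "snd d p = ?x" unfolding p_def by (rule chart_chart_inv[OF xd])
  show pU: "snd d p \<in> U" using xU sp by simp
  have "snd q (\<pi> p) = snd q t"
    using coordinates_of_point(2)[OF p pU] \<Psi>(2)[OF y] unfolding sp by simp
  then show pt: "\<pi> p = t" using chart_inj[OF chq] coordinates_of_point(1)[OF p pU] t by (meson inj_onD)
  show "L (snd d p) = u" using \<Psi>(2)[OF y] unfolding sp by simp
  show "p \<in> fst (slice t)" using p pU pt by (simp add: slice_def)
qed

text \<open>In coordinates, \<open>\<Phi>\<close> maps the points of \<open>U\<close> over \<open>t\<close> onto the part of the affine subspace \<open>B (q t) + range C\<close> inside \<open>V\<close>.\<close>

lemma slice_image: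
  assumes t: "t \<in> fst q"
  shows "chart_image (slice t) = {u. B (snd q t) + C u \<in> V}"
proof
  show "chart_image (slice t) \<subseteq> {u. B (snd q t) + C u \<in> V}"
    using coordinates_of_point(3) by (auto simp: chart_image_def slice_def \<Phi>_map_def)
  show "{u. B (snd q t) + C u \<in> V} \<subseteq> chart_image (slice t)"
  proof
    fix u assume "u \<in> {u. B (snd q t) + C u \<in> V}"
    then have y: "B (snd q t) + C u \<in> V" by simp
    show "u \<in> chart_image (slice t)"
      using point_of_coordinates(5,6)[OF t y] unfolding chart_image_def
      by (intro image_eqI[where x = "chart_inv d (\<Psi> (B (snd q t) + C u))"]) (simp_all add: slice_def)
  qed
qed

lemma slice_image_open:
  assumes t: "t \<in> fst q" shows "open (chart_image (slice t))"
proof -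
  have "continuous_on UNIV (\<lambda>u. B (snd q t) + C u)"
    by (intro continuous_intros linear_continuous_on) (simp add: C(1) linear_conv_bounded_linear[symmetric])
  from open_vimage[OF V this] show ?thesis
    unfolding slice_image[OF t] by (simp add: vimage_def)
qed

abbreviation Fib where "Fib t \<equiv> {x \<in> topspace (mtop E). \<pi> x = t}"

lemma slice_topological_chart:
  assumes t: "t \<in> fst q"
  shows "topological_chart (subtopology (mtop E) (Fib t)) (slice t)"
    "u \<in> chart_image (slice t) \<Longrightarrow> chart_inv (slice t) u = chart_inv d (\<Psi> (B (snd q t) + C u))"
proof -
  let ?g = "\<lambda>u. chart_inv d (\<Psi> (B (snd q t) + C u))"
  let ?T = "subtopology (mtop E) (Fib t)"
  have sub: "fst (slice t) \<subseteq> Fib t"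
    using chart_in_topspace[OF chd] by (auto simp: slice_def)
  have op: "openin ?T (fst (slice t))"
  proof -
    have "openin (mtop E) {p \<in> fst d. snd d p \<in> U}" by (rule chart_open_vimage[OF chd U(1)])
    moreover have "fst (slice t) = {p \<in> fst d. snd d p \<in> U} \<inter> Fib t"
      using sub by (auto simp: slice_def)
    ultimately show ?thesis by (auto simp: openin_subtopology)
  qed
  have gf: "?g (snd (slice t) p) = p" if "p \<in> fst (slice t)" for p
  proof -
    have p: "p \<in> fst d" "snd d p \<in> U" "\<pi> p = t" using that by (auto simp: slice_def)
    show ?thesis
      using coordinates_of_point(4)[OF p(1,2)] chart_inv_chart[OF chd p(1)] p(3) by (simp add: slice_def \<Phi>_map_def)
  qed
  have fg: "?g u \<in> fst (slice t)" "snd (slice t) (?g u) = u" if "u \<in> chart_image (slice t)" for u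
  proof -
    have y: "B (snd q t) + C u \<in> V" using that unfolding slice_image[OF t] by simp
    show "?g u \<in> fst (slice t)" by (rule point_of_coordinates(6)[OF t y])
    show "snd (slice t) (?g u) = u" using point_of_coordinates(5)[OF t y] by (simp add: slice_def)
  qed
  have cf: "continuous_map (subtopology ?T (fst (slice t))) (top_of_set (chart_image (slice t))) (snd (slice t))"
  proof -
    have "continuous_map (subtopology (mtop E) (fst (slice t))) euclidean (snd d)"
      by (rule continuous_map_from_subtopology_mono[OF chart_continuous_map[OF chd]]) (auto simp: slice_def)
    moreover have "continuous_map euclidean euclidean L"
      using linear_continuous_on[of L UNIV] L by (simp add: linear_conv_bounded_linear)
    ultimately have "continuous_map (subtopology (mtop E) (fst (slice t))) euclidean (L \<circ> snd d)"
      by (rule continuous_map_compose)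
    moreover have "subtopology ?T (fst (slice t)) = subtopology (mtop E) (fst (slice t))"
      using sub by (simp add: subtopology_subtopology Int_absorb1)
    ultimately show ?thesis
      by (auto simp: continuous_map_in_subtopology o_def slice_def chart_image_def)
  qed
  have cg: "continuous_map (top_of_set (chart_image (slice t))) (subtopology ?T (fst (slice t))) ?g"
  proof -
    have "continuous_on (chart_image (slice t)) (\<lambda>u. \<Psi> (B (snd q t) + C u))"
    proof (rule continuous_on_compose2[of V \<Psi>])
      show "continuous_on V \<Psi>"
        by (rule smooth_on_imp_continuous_on[OF holomorphic_map_on_imp_smooth_on[OF \<Psi>_hol V]])
      show "continuous_on (chart_image (slice t)) (\<lambda>u. B (snd q t) + C u)"
        by (intro continuous_intros linear_continuous_on) (simp add: C(1) linear_conv_bounded_linear[symmetric])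
    qed (auto simp: slice_image[OF t])
    then have "continuous_map (top_of_set (chart_image (slice t))) (top_of_set (chart_image d)) (\<lambda>u. \<Psi> (B (snd q t) + C u))"
      using \<Psi>(1) U_image by (auto simp: continuous_map_in_subtopology slice_image[OF t])
    from continuous_map_compose[OF this chart_inv_continuous_map[OF chd]]
    have "continuous_map (top_of_set (chart_image (slice t))) (mtop E) ?g" by (simp add: o_def)
    then show ?thesis using fg(1) sub by (auto simp: continuous_map_in_subtopology)
  qed
  have "homeomorphic_maps (subtopology ?T (fst (slice t))) (top_of_set (chart_image (slice t))) (snd (slice t)) ?g"
    unfolding homeomorphic_maps_def using cf cg gf fg by auto
  then show tc: "topological_chart ?T (slice t)"
    unfolding topological_chart_def using op slice_image_open[OF t] homeomorphic_map_maps by blast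
  show "chart_inv (slice t) u = ?g u" if "u \<in> chart_image (slice t)"
    using chart_inv_chart[OF tc fg(1)[OF that]] fg(2)[OF that] by simp
qed

lemma slice_in_atlas:
  assumes t: "t \<in> fst q"
  shows "slice t \<in> atlas (fibre E \<pi> t)"
  unfolding fibre_def
proof (subst induced_structure_simps(2), intro conjI ballI)
  show tc: "topological_chart (subtopology (mtop E) (Fib t)) (slice t)" by (rule slice_topological_chart[OF t])
  fix d' assume d': "d' \<in> atlas E"
  have main: "\<exists>f'. (local_map id (slice t) d' has_derivative f') (at u) \<and> (\<forall>a v. f' (a *s v) = a *s f' v) \<and> inj f'"
    if u: "u \<in> local_domain id (slice t) d'" for u
  proof -
    let ?y = "\<lambda>u. B (snd q t) + C u"
    have uim: "u \<in> chart_image (slice t)" and ud': "chart_inv (slice t) u \<in> fst d'"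
      using u unfolding local_domain_iff[OF tc] by auto
    have yV: "?y u \<in> V" using uim unfolding slice_image[OF t] by simp
    define p where "p = chart_inv d (\<Psi> (?y u))"
    note fV = point_of_coordinates[OF t yV, folded p_def]
    have pd': "p \<in> fst d'" using ud' slice_topological_chart(2)[OF t uim] by (simp add: p_def)
    have hol: "holomorphic_map E E id" by (rule holomorphic_map_id[OF E])
    have xd: "\<Psi> (?y u) \<in> local_domain id d d'"
      unfolding local_domain_def fV(2)[symmetric] using fV(1) pd' by (intro imageI) simp
    note T = holomorphic_map_onD[OF holomorphic_mapD[OF hol d d'] xd]
    note P = holomorphic_map_onD[OF \<Psi>_hol yV]
    have y': "(?y has_derivative C) (at u)"
      using has_derivative_add[OF has_derivative_const[of "B (snd q t)"] linear_imp_has_derivative[OF C(1)]] by simp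
    let ?f' = "\<lambda>v. fderiv (local_map id d d') (\<Psi> (?y u)) (fderiv \<Psi> (?y u) (C v))"
    have "((\<lambda>u. local_map id d d' (\<Psi> (?y u))) has_derivative ?f') (at u)"
      by (rule has_derivative_compose[OF has_derivative_compose[OF y' P(1)] T(1)])
    then have "(local_map id (slice t) d' has_derivative ?f') (at u)"
    proof (rule has_derivative_transform_within_open[OF _ slice_image_open[OF t] uim])
      fix w assume w: "w \<in> chart_image (slice t)"
      then show "local_map id d d' (\<Psi> (?y w)) = local_map id (slice t) d' w"
        using slice_topological_chart(2)[OF t w] by (simp add: local_map_def)
    qed
    moreover have "?f' (a *s v) = a *s ?f' v" for a v by (simp add: C(3) P(2) T(2))
    moreover have "inj ?f'"
    proof -
      have "bij (fderiv (local_map id d d') (snd d p))"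
        by (rule bij_derivative_of_biholomorphic(2)[OF E E hol hol _ d d' fV(1)]) (use pd' in auto)
      then have i: "inj (fderiv (local_map id d d') (\<Psi> (?y u)))"
        unfolding fV(2) by (rule bij_is_inj)
      show ?thesis
        by (rule injI) (metis i \<Psi>_inj[OF yV] C(2) injD)
    qed
    ultimately show ?thesis by blast
  qed
  show "holomorphic_map_on (local_map id (slice t) d') (local_domain id (slice t) d')"
    unfolding holomorphic_map_on_def using main by blast
  show "inj (fderiv (local_map id (slice t) d') u)" if "u \<in> local_domain id (slice t) d'" for u
    using main[OF that] frechet_derivative_at by metis
qed

end

lemma scaleR_eq_smult: "r *\<^sub>R (x :: (complex, 'i::finite) vec) = of_real r *s x"
  by (simp add: vec_eq_iff scaleR_conv_of_real[where 'a=complex])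

lemma complex_linear_iff:
  fixes f :: "(complex, 'k::finite) vec \<Rightarrow> (complex, 'm::finite) vec"
  shows "Vector_Spaces.linear (*s) (*s) f \<longleftrightarrow> linear f \<and> (\<forall>a v. f (a *s v) = a *s f v)"
  unfolding Vector_Spaces.linear_iff[of "(*s)" "(*s)"]
  by (auto simp: scaleR_eq_smult vec.vector_space_axioms intro!: linearI dest: linear_add)

lemma complex_linear_right_inverse:
  fixes A :: "(complex, 'k::finite) vec \<Rightarrow> (complex, 'm::finite) vec"
  assumes "linear A" "\<And>a v. A (a *s v) = a *s A v" "surj A"
  obtains B where "linear B" "\<And>a v. B (a *s v) = a *s B v" "\<And>v. A (B v) = v"
  using vec.linear_surjective_right_inverse[of A] assms that
  unfolding complex_linear_iff by (metis comp_apply id_apply)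

lemma complex_linear_left_inverse:
  fixes C :: "(complex, 'n::finite) vec \<Rightarrow> (complex, 'k::finite) vec"
  assumes "linear C" "\<And>a v. C (a *s v) = a *s C v" "inj C"
  obtains L where "linear L" "\<And>a v. L (a *s v) = a *s L v" "\<And>v. L (C v) = v"
  using vec.linear_injective_left_inverse[of C] assms that
  unfolding complex_linear_iff by (metis comp_apply id_apply)

text \<open>The inverse of a complex linear bijection is complex linear, so the local inverse provided by the real
  inverse function theorem is holomorphic.\<close>

lemma holomorphic_inverse_function:
  fixes \<Phi> :: "(complex, 'k::finite) vec \<Rightarrow> (complex, 'k) vec"
  assumes hol: "holomorphic_map_on \<Phi> S" and S: "open S" "x0 \<in> S"
    and id: "\<And>v. fderiv \<Phi> x0 v = v"
  obtains U V \<Psi> where "open U" "U \<subseteq> S" "x0 \<in> U" "open V" "\<forall>x\<in>U. \<Phi> x \<in> V \<and> \<Psi> (\<Phi> x) = x"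
    "\<forall>y\<in>V. \<Psi> y \<in> U \<and> \<Phi> (\<Psi> y) = y" "holomorphic_map_on \<Psi> V"
    "\<forall>y\<in>V. inj (fderiv \<Psi> y)"
proof -
  note h = holomorphic_map_onD[OF hol]
  have sm: "smooth_on \<Phi> S" by (rule holomorphic_map_on_imp_smooth_on[OF hol S(1)])
  define f' where "f' x = Blinfun (fderiv \<Phi> x)" for x
  have f': "blinfun_apply (f' x) = fderiv \<Phi> x" if "x \<in> S" for x
    unfolding f'_def by (rule bounded_linear_Blinfun_apply[OF has_derivative_bounded_linear[OF h(1)[OF that]]])
  have contf: "continuous_on S f'"
  proof (rule continuous_on_blinfun_componentwise)
    fix i :: "(complex, 'k) vec"
    have "continuous_on S (\<lambda>x. fderiv \<Phi> x i)"
      by (rule smooth_on_imp_continuous_on[OF smooth_on_derivative[OF sm S(1)]])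
    then show "continuous_on S (\<lambda>x. blinfun_apply (f' x) i)"
      by (rule continuous_on_eq) (simp add: f')
  qed
  have der: "(\<Phi> has_derivative blinfun_apply (f' x)) (at x)" if "x \<in> S" for x
    using h(1)[OF that] f'[OF that] by simp
  have invf: "id_blinfun o\<^sub>L f' x0 = id_blinfun"
    by (rule blinfun_eqI) (simp add: f'[OF S(2)] id)
  show ?thesis
  proof (rule inverse_function_theorem[where U = S and f = \<Phi> and f' = f', OF S(1) _ contf S(2) invf])
    show "(\<Phi> has_derivative blinfun_apply (f' x)) (at x)" if "x \<in> S" for x by (rule der[OF that])
  next
    fix U V \<Psi> g'
    assume *: "open U" "U \<subseteq> S" "x0 \<in> U" "open V" "\<Phi> x0 \<in> V" "homeomorphism U V \<Phi> \<Psi>"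
      "\<And>y. y \<in> V \<Longrightarrow> (\<Psi> has_derivative (g' y)) (at y)"
      "\<And>y. y \<in> V \<Longrightarrow> g' y = inv (blinfun_apply (f'(\<Psi> y)))"
      "\<And>y. y \<in> V \<Longrightarrow> bij (blinfun_apply (f'(\<Psi> y)))"
    have UV: "\<Phi> x \<in> V \<and> \<Psi> (\<Phi> x) = x" if "x \<in> U" for x
      using *(6) that unfolding homeomorphism_def by blast
    have VU: "\<Psi> y \<in> U \<and> \<Phi> (\<Psi> y) = y" if "y \<in> V" for y
      using *(6) that unfolding homeomorphism_def by blast
    have g': "g' y = inv (fderiv \<Phi> (\<Psi> y))" "bij (fderiv \<Phi> (\<Psi> y))" if "y \<in> V" for y
      using *(8,9)[OF that] f'[of "\<Psi> y"] VU[OF that] *(2) by auto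
    have sc: "g' y (a *s v) = a *s g' y v" if "y \<in> V" for y a v
    proof -
      have yS: "\<Psi> y \<in> S" using VU[OF that] *(2) by blast
      have s: "fderiv \<Phi> (\<Psi> y) (g' y w) = w" for w
        unfolding g'(1)[OF that] by (rule surj_f_inv_f[OF bij_is_surj[OF g'(2)[OF that]]])
      have "fderiv \<Phi> (\<Psi> y) (g' y (a *s v)) = fderiv \<Phi> (\<Psi> y) (a *s g' y v)"
        unfolding h(2)[OF yS] s ..
      then show ?thesis using bij_is_inj[OF g'(2)[OF that]] by (simp add: inj_eq)
    qed
    have "holomorphic_map_on \<Psi> V"
      unfolding holomorphic_map_on_def using *(7) sc by blast
    moreover have "inj (fderiv \<Psi> y)" if "y \<in> V" for y
    proof -
      have "fderiv \<Psi> y = g' y" using frechet_derivative_at[OF *(7)[OF that]] by simp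
      then show ?thesis using bij_imp_bij_inv[OF g'(2)[OF that]] g'(1)[OF that] by (simp add: bij_is_inj)
    qed
    ultimately show ?thesis using that[OF *(1-4)] UV VU by blast
  qed
qed

text \<open>With a right inverse \<open>B\<close> of the derivative \<open>A\<close> of the projection \<open>F\<close>, the map \<open>\<Phi> x = B (F x) + (x - B (A x))\<close>
  has the identity as derivative at the point and satisfies \<open>A (\<Phi> x) = F x\<close>. So it is locally invertible and
  flattens the fibres to translates of the kernel of \<open>A\<close>.\<close>

lemma adapted_coordinates_exist:
  fixes E :: "('p, 'k::finite) charted_space" and D :: "('q, 'm::finite) charted_space"
    and c0 :: "('p, 'n::finite) chart"
  assumes E: "complex_manifold E" and D: "complex_manifold D" and sub: "holomorphic_submersion E D \<pi>"
    and d: "d \<in> atlas E" "p0 \<in> fst d" and q: "q \<in> atlas D" "\<pi> p0 \<in> fst q"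
    and c0: "c0 \<in> atlas (fibre E \<pi> (\<pi> p0))" "p0 \<in> fst c0"
  obtains U V B and C :: "(complex, 'n) vec \<Rightarrow> (complex, 'k) vec" and L \<Psi>
    where "adapted_coordinates E D \<pi> d q U V B C L \<Psi>" "snd d p0 \<in> U"
proof -
  have \<pi>: "holomorphic_map E D \<pi>" using sub by (simp add: holomorphic_submersion_def)
  note chd = complex_manifold_chart[OF E d(1)] and chq = complex_manifold_chart[OF D q(1)]
  define S0 where "S0 = {x \<in> topspace (mtop E). \<pi> x = \<pi> p0}"
  have c0': "c0 \<in> atlas (induced_structure E S0)" using c0(1) by (simp only: fibre_def S0_def)
  then have chc: "topological_chart (subtopology (mtop E) S0) c0" by simp
  define F where "F = local_map \<pi> d q"
  define Dm where "Dm = local_domain \<pi> d q"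
  define x0 where "x0 = snd d p0"
  have Dm: "open Dm" unfolding Dm_def
    using local_domain_open[OF chd chq] \<pi> by (simp add: holomorphic_map_def)
  have x0: "x0 \<in> Dm" unfolding Dm_def x0_def using d q by (auto simp: local_domain_def)
  have hF: "holomorphic_map_on F Dm" unfolding F_def Dm_def by (rule holomorphic_mapD[OF \<pi> d(1) q(1)])
  note F = holomorphic_map_onD[OF hF]
  define A where "A = fderiv F x0"
  have A: "linear A" "\<And>a v. A (a *s v) = a *s A v" "surj A"
    using has_derivative_linear[OF F(1)[OF x0]] F(2)[OF x0] sub d(1) q(1) x0
    by (simp_all add: A_def holomorphic_submersion_def F_def Dm_def)
  obtain B where B: "linear B" "\<And>a v. B (a *s v) = a *s B v" "\<And>v. A (B v) = v"
    using complex_linear_right_inverse[OF A] by metis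
  have bA: "bounded_linear A" "bounded_linear B" using A(1) B(1) by (simp_all add: linear_conv_bounded_linear)
  define \<Phi> where "\<Phi> x = B (F x) + (x - B (A x))" for x
  have d\<Phi>: "(\<Phi> has_derivative (\<lambda>v. B (fderiv F x v) + (v - B (A v)))) (at x)" if "x \<in> Dm" for x
    unfolding \<Phi>_def
    by (intro has_derivative_add has_derivative_diff has_derivative_ident
        bounded_linear.has_derivative[OF bA(2)] F(1)[OF that] bounded_linear_imp_has_derivative[OF bA(1)])
  have h\<Phi>: "holomorphic_map_on \<Phi> Dm"
    unfolding holomorphic_map_on_def
  proof
    fix x assume x: "x \<in> Dm"
    show "\<exists>f'. (\<Phi> has_derivative f') (at x) \<and> (\<forall>a v. f' (a *s v) = a *s f' v)"
    proof (intro exI conjI allI)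
      show "(\<Phi> has_derivative (\<lambda>v. B (fderiv F x v) + (v - B (A v)))) (at x)" by (rule d\<Phi>[OF x])
      show "B (fderiv F x (a *s v)) + (a *s v - B (A (a *s v))) = a *s (B (fderiv F x v) + (v - B (A v)))" for a v
        by (simp add: F(2)[OF x] A(2) B(2) vec.scale_right_distrib vec.scale_right_diff_distrib)
    qed
  qed
  have "fderiv \<Phi> x0 v = v" for v
    using frechet_derivative_at[OF d\<Phi>[OF x0], symmetric] by (simp add: A_def[symmetric])
  then obtain U V \<Psi> where UV0: "open U" "U \<subseteq> Dm" "x0 \<in> U" "open V" "\<forall>x\<in>U. \<Phi> x \<in> V \<and> \<Psi> (\<Phi> x) = x"
    "\<forall>y\<in>V. \<Psi> y \<in> U \<and> \<Phi> (\<Psi> y) = y" "holomorphic_map_on \<Psi> V"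
    "\<forall>y\<in>V. inj (fderiv \<Psi> y)"
    by (rule holomorphic_inverse_function[OF h\<Phi> Dm x0])
  note UV = UV0(1-4) bspec[OF UV0(5)] bspec[OF UV0(6)] UV0(7) bspec[OF UV0(8)]
  have A\<Phi>: "A (\<Phi> x) = F x" for x
    by (simp add: \<Phi>_def linear_add[OF A(1)] linear_diff[OF A(1)] B(3))

  \<comment> \<open>The kernel of \<open>A\<close> is the tangent space of the fibre, and the derivative \<open>C\<close> of the inverse of the chart
    \<open>c0\<close> embeds the model space in it. That \<open>C\<close> is onto is a matter of dimensions, and \<open>c0\<close> itself is only known to be a
    homeomorphism: an open part of the kernel parametrises the fibre through \<open>pt\<close>, following this by \<open>c0\<close>
    gives a continuous injection into the model space, and invariance of dimension applies.\<close>
  define K where "K = {v. A v = 0}"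
  have K: "subspace K" unfolding K_def subspace_def
    by (simp add: linear_0[OF A(1)] linear_add[OF A(1)] linear_cmul[OF A(1)])
  have pS: "p0 \<in> topspace (mtop E)" by (rule chart_in_topspace[OF chd d(2)])
  define pt where "pt w = chart_inv d (\<Psi> (\<Phi> x0 + w))" for w
  define W where "W = {w \<in> K. \<Phi> x0 + w \<in> V}"
  have pt: "pt w \<in> fst d" "pt w \<in> S0" "snd d (pt w) = \<Psi> (\<Phi> x0 + w)" if "w \<in> W" for w
  proof -
    have y: "\<Phi> x0 + w \<in> V" and w: "A w = 0" using that by (auto simp: W_def K_def)
    let ?x = "\<Psi> (\<Phi> x0 + w)"
    have xDm: "?x \<in> Dm" using UV(2,6) y by blast
    then have xi: "?x \<in> chart_image d" and pq: "\<pi> (pt w) \<in> fst q"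
      unfolding Dm_def local_domain_iff[OF chd] pt_def by auto
    show pd: "pt w \<in> fst d" unfolding pt_def by (rule chart_inv_in[OF xi])
    show sx: "snd d (pt w) = ?x" unfolding pt_def by (rule chart_chart_inv[OF xi])
    have "F ?x = A (\<Phi> x0 + w)" using A\<Phi>[of ?x] UV(6)[OF y] by simp
    also have "\<dots> = F x0" by (simp add: linear_add[OF A(1)] w A\<Phi>)
    finally have "snd q (\<pi> (pt w)) = snd q (\<pi> p0)"
      using local_map_chart[where f = \<pi> and d = q, OF chd pd] local_map_chart[where f = \<pi> and d = q, OF chd d(2)] sx
      by (simp add: F_def x0_def)
    then have "\<pi> (pt w) = \<pi> p0" using chart_inj[OF chq] pq q(2) by (meson inj_onD)
    then show "pt w \<in> S0" using chart_in_topspace[OF chd pd] by (simp add: S0_def)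
  qed
  have Wd: "\<Psi> (\<Phi> x0 + w) \<in> chart_image d" if "w \<in> W" for w
    using pt[OF that] chart_in_image by metis
  have cpt: "continuous_map (top_of_set W) (subtopology (mtop E) S0) pt"
  proof -
    have "continuous_on W (\<lambda>w. \<Psi> (\<Phi> x0 + w))"
      by (rule continuous_on_compose2[OF smooth_on_imp_continuous_on[OF holomorphic_map_on_imp_smooth_on[OF UV(7,4)]]])
        (auto intro!: continuous_intros simp: W_def)
    then have "continuous_map (top_of_set W) (top_of_set (chart_image d)) (\<lambda>w. \<Psi> (\<Phi> x0 + w))"
      using Wd by (auto simp: continuous_map_in_subtopology)
    from continuous_map_compose[OF this chart_inv_continuous_map[OF chd]]
    have "continuous_map (top_of_set W) (mtop E) pt" by (simp add: o_def pt_def[abs_def])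
    then show ?thesis using pt(2) by (auto simp: continuous_map_in_subtopology)
  qed
  define W' where "W' = {w \<in> W. pt w \<in> fst c0}"
  have "openin (top_of_set W) W'"
    using openin_continuous_map_preimage[OF cpt, of "fst c0"] chc by (simp add: W'_def topological_chart_def)
  moreover have "openin (top_of_set K) W"
  proof -
    have "open ((\<lambda>w. \<Phi> x0 + w) -` V)" by (intro open_vimage UV(4) continuous_intros)
    moreover have "W = K \<inter> (\<lambda>w. \<Phi> x0 + w) -` V" by (auto simp: W_def)
    ultimately show ?thesis by auto
  qed
  ultimately have W': "openin (top_of_set K) W'" by (rule openin_trans)
  have "continuous_on W' (\<lambda>w. snd c0 (pt w))"
  proof -
    have "continuous_map (top_of_set W') (subtopology (subtopology (mtop E) S0) (fst c0)) pt"
      using continuous_map_from_subtopology_mono[OF cpt, of W'] by (auto simp: continuous_map_in_subtopology W'_def)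
    from continuous_map_compose[OF this chart_continuous_map[OF chc]] show ?thesis by (simp add: o_def)
  qed
  moreover have "inj_on (\<lambda>w. snd c0 (pt w)) W'"
  proof (rule inj_onI)
    fix w w' assume w: "w \<in> W'" "w' \<in> W'" and eq: "snd c0 (pt w) = snd c0 (pt w')"
    have "pt w = pt w'"
      using inj_onD[OF chart_inj[OF chc] eq] w by (simp add: W'_def)
    then have "\<Psi> (\<Phi> x0 + w) = \<Psi> (\<Phi> x0 + w')" using pt(3) w unfolding W'_def by (metis (mono_tags, lifting) mem_Collect_eq)
    then have "\<Phi> x0 + w = \<Phi> x0 + w'" using UV(6) w unfolding W'_def W_def by (metis (mono_tags, lifting) mem_Collect_eq)
    then show "w = w'" by simp
  qed
  moreover have "0 \<in> W'"
  proof -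
    have "\<Phi> x0 \<in> V" "\<Psi> (\<Phi> x0) = x0" using UV(3,5) by blast+
    then have "0 \<in> W" "pt 0 = p0"
      using linear_0[OF A(1)] chart_inv_chart[OF chd d(2)] by (simp_all add: W_def K_def pt_def x0_def)
    then show ?thesis using c0(2) by (simp add: W'_def)
  qed
  ultimately have dimK: "dim K \<le> dim (UNIV :: (complex, 'n) vec set)"
    using invariance_of_dimension_subspaces[OF W' K subspace_UNIV, of "\<lambda>w. snd c0 (pt w)"] by blast

  let ?G = "local_map id c0 d" and ?u0 = "snd c0 p0"
  have u0: "?u0 \<in> local_domain id c0 d" using c0(2) d(2) by (auto simp: local_domain_def)
  have hG: "holomorphic_map_on ?G (local_domain id c0 d)" and iG: "inj (fderiv ?G ?u0)"
    using c0' d(1) u0 by auto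
  note G = holomorphic_map_onD[OF hG u0]
  define C where "C = fderiv ?G ?u0"
  have C: "linear C" "\<And>a v. C (a *s v) = a *s C v" "inj C"
    using has_derivative_linear[OF G(1)] G(2) iG by (simp_all add: C_def)
  have AC: "A (C v) = 0" for v
  proof -
    have Gu0: "?G ?u0 = x0" using local_map_chart[where f = id and d = d, OF chc c0(2)] by (simp add: x0_def)
    have "((\<lambda>u. F (?G u)) has_derivative (\<lambda>v. A (C v))) (at ?u0)"
      unfolding A_def C_def by (rule has_derivative_compose[OF G(1)]) (simp add: Gu0 F(1)[OF x0])
    moreover have "((\<lambda>u. F (?G u)) has_derivative (\<lambda>v. 0)) (at ?u0)"
    proof (rule has_derivative_transform_within_open[OF has_derivative_const[of "snd q (\<pi> p0)"]])
      show "open (local_domain id c0 d)" by (rule local_domain_open[OF chc chd]) (simp add: continuous_map_id_subt)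
      fix u assume u: "u \<in> local_domain id c0 d"
      then have u': "u \<in> chart_image c0" "chart_inv c0 u \<in> fst d" unfolding local_domain_iff[OF chc] by auto
      have "\<pi> (chart_inv c0 u) = \<pi> p0"
        using chart_in_topspace[OF chc chart_inv_in[OF u'(1)]] by (simp add: S0_def)
      then show "snd q (\<pi> p0) = F (?G u)"
        using chart_inv_chart[OF chd u'(2)] by (simp add: F_def local_map_def)
    qed (rule u0)
    ultimately show ?thesis using has_derivative_unique by metis
  qed
  have "range C = K"
  proof (rule subspace_dim_equal)
    show "subspace (range C)" by (rule linear_subspace_image[OF C(1) subspace_UNIV])
    show "range C \<subseteq> K" using AC by (auto simp: K_def)
    have "dim (range C) = dim (UNIV :: (complex, 'n) vec set)"
      by (rule dim_image_eq[OF C(1)]) (use C(3) in auto)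
    then show "dim (range C) \<ge> dim K" using dimK by simp
  qed (rule K)
  obtain Li where Li: "linear Li" "\<And>a v. Li (a *s v) = a *s Li v" "\<And>v. Li (C v) = v"
    using complex_linear_left_inverse[OF C] by metis
  define L where "L x = Li (x - B (A x))" for x
  have CL: "C (L x) = x - B (A x)" for x
  proof -
    have "x - B (A x) \<in> range C"
      unfolding \<open>range C = K\<close> K_def by (simp add: linear_diff[OF A(1)] B(3))
    then show ?thesis unfolding L_def using Li(3) by (metis rangeE)
  qed
  have LC: "L (C v) = v" for v by (simp add: L_def AC linear_0[OF B(1)] Li(3))
  have LB: "L (B v) = 0" for v by (simp add: L_def B(3) linear_0[OF Li(1)])
  have linL: "linear L"
    unfolding L_def
    by (rule linearI) (simp_all add: linear_add[OF Li(1), symmetric] linear_add[OF A(1)] linear_add[OF B(1)]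
        linear_cmul[OF Li(1), symmetric] linear_cmul[OF A(1)] linear_cmul[OF B(1)] algebra_simps)
  have scL: "L (a *s v) = a *s L v" for a v
    by (simp add: L_def A(2) B(2) Li(2)[symmetric] vec.scale_right_diff_distrib)
  have \<Phi>_eq: "\<Phi> x = B (F x) + C (L x)" for x by (simp add: \<Phi>_def CL)
  have "adapted_coordinates E D \<pi> d q U V B C L \<Psi>"
  proof (rule adapted_coordinates.intro)
    show "\<And>x. x \<in> U \<Longrightarrow> B (local_map \<pi> d q x) + C (L x) \<in> V" "\<And>x. x \<in> U \<Longrightarrow> \<Psi> (B (local_map \<pi> d q x) + C (L x)) = x"
      using UV(5) by (simp_all add: \<Phi>_eq F_def)
    show "\<And>y. y \<in> V \<Longrightarrow> \<Psi> y \<in> U" using UV(6) by blast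
    fix \<tau> u assume y: "B \<tau> + C u \<in> V"
    let ?x = "\<Psi> (B \<tau> + C u)"
    have eq: "B (F ?x) + C (L ?x) = B \<tau> + C u" using UV(6)[OF y] \<Phi>_eq[of ?x] by simp
    have "A (B (F ?x) + C (L ?x)) = A (B \<tau> + C u)" unfolding eq ..
    then have 1: "F ?x = \<tau>" by (simp add: linear_add[OF A(1)] B(3) AC)
    have "L (B (F ?x) + C (L ?x)) = L (B \<tau> + C u)" unfolding eq ..
    then have "L ?x = u" by (simp add: linear_add[OF linL] LB LC)
    with 1 show "local_map \<pi> d q ?x = \<tau> \<and> L ?x = u" by (simp add: F_def)
  qed (use E D \<pi> d q UV B C linL scL in \<open>simp_all add: Dm_def[symmetric]\<close>)
  then show ?thesis using that UV(3) by (simp add: x0_def)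
qed

section \<open>Gluing smooth extensions\<close>

lemma smooth_near_cong:
  assumes M: "complex_manifold M" and U: "openin (mtop M) U" "p \<in> U" "\<And>q. q \<in> U \<Longrightarrow> R q = R' q"
    and R: "smooth_near M X R p"
  shows "smooth_near M X R' p"
proof -
  obtain c e where ce: "c \<in> atlas M" "e \<in> atlas X" "smooth_at R p c e"
    using R unfolding smooth_near_def by blast
  have "smooth_at R' p c e"
    by (rule smooth_at_cong[where R = R and U = U, OF complex_manifold_chart[OF M ce(1)] U ce(3)])
  then show ?thesis by (rule smooth_nearI[OF ce(1,2)])
qed

text \<open>Smooth extensions of \<open>g\<close> to neighbourhoods of a part \<open>A\<close> of \<open>S\<close>. The agreement with \<open>g\<close> on all of \<open>S\<close> where the
  extension is defined, and not only on \<open>A\<close>, is what allows it to be enlarged.\<close>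

definition extendable ::
    "('p, 'k::finite) charted_space \<Rightarrow> ('x, 'n::finite) charted_space \<Rightarrow> 'p set \<Rightarrow> ('p \<Rightarrow> 'x) \<Rightarrow> 'p set \<Rightarrow> bool" where
  "extendable E X S g A \<longleftrightarrow> (\<exists>V R. openin (mtop E) V \<and> A \<subseteq> V \<and> (\<forall>p\<in>V. smooth_near E X R p) \<and> (\<forall>p\<in>V \<inter> S. R p = g p))"

text \<open>Here the Hausdorff property of the manifold enters: the set is compact.\<close>

lemma chart_cball_closed:
  assumes M: "complex_manifold M" and d: "d \<in> atlas M" and b: "cball x0 \<rho> \<subseteq> chart_image d"
  shows "closedin (mtop M) {p \<in> fst d. snd d p \<in> cball x0 \<rho>}"
proof -
  have "compactin (top_of_set (chart_image d)) (cball x0 \<rho>)"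
    using b by (simp add: compactin_subtopology)
  from image_compactin[OF this chart_inv_continuous_map[OF complex_manifold_chart[OF M d]]]
  have "compactin (mtop M) (chart_inv d ` cball x0 \<rho>)" .
  moreover have "chart_inv d ` cball x0 \<rho> = {p \<in> fst d. snd d p \<in> cball x0 \<rho>}"
  proof
    show "chart_inv d ` cball x0 \<rho> \<subseteq> {p \<in> fst d. snd d p \<in> cball x0 \<rho>}"
    proof
      fix p assume "p \<in> chart_inv d ` cball x0 \<rho>"
      then obtain x where x: "x \<in> cball x0 \<rho>" "p = chart_inv d x" by blast
      then have "x \<in> chart_image d" using b by blast
      then show "p \<in> {p \<in> fst d. snd d p \<in> cball x0 \<rho>}"
        using x chart_inv_in[of x d] chart_chart_inv[of x d] by simp
    qed
    show "{p \<in> fst d. snd d p \<in> cball x0 \<rho>} \<subseteq> chart_inv d ` cball x0 \<rho>"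
    proof
      fix p assume "p \<in> {p \<in> fst d. snd d p \<in> cball x0 \<rho>}"
      then have "p \<in> fst d" "snd d p \<in> cball x0 \<rho>" by auto
      then show "p \<in> chart_inv d ` cball x0 \<rho>"
        using chart_inv_chart[OF complex_manifold_chart[OF M d]] by (metis image_eqI)
    qed
  qed
  ultimately show ?thesis
    using M compactin_imp_closedin unfolding complex_manifold_def by metis
qed

text \<open>Two smooth maps can be interpolated linearly in a chart of the target where both take values in a ball
  of that chart, since the ball is convex.\<close>

lemma smooth_at_interpolation:
  assumes d: "topological_chart T d" and e: "topological_chart T' e"
    and U: "openin T U" "p \<in> U" and ball: "ball z \<delta> \<subseteq> chart_image e"
    and Uball: "\<And>q. q \<in> U \<Longrightarrow> snd e (R q) \<in> ball z \<delta> \<and> snd e (r q) \<in> ball z \<delta>"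
    and R: "smooth_at R p d e" and r: "smooth_at r p d e"
    and \<phi>: "smooth_on \<phi> UNIV" "\<And>x. 0 \<le> \<phi> x \<and> \<phi> x \<le> 1"
  shows "smooth_at (\<lambda>q. chart_inv e ((1 - \<phi> (snd d q)) *\<^sub>R snd e (R q) + \<phi> (snd d q) *\<^sub>R snd e (r q))) p d e"
    (is "smooth_at ?I p d e")
proof -
  have pd: "p \<in> fst d" using R by (simp add: smooth_at_def)
  obtain N1 where N1: "open N1" "snd d p \<in> N1" "N1 \<subseteq> chart_image d" "smooth_on (local_map R d e) N1"
    using R unfolding smooth_at_def by blast
  obtain N2 where N2: "open N2" "snd d p \<in> N2" "N2 \<subseteq> chart_image d" "smooth_on (local_map r d e) N2"
    using r unfolding smooth_at_def by blast
  define N where "N = N1 \<inter> N2 \<inter> snd d ` (fst d \<inter> U)"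
  have N: "open N" "snd d p \<in> N" "N \<subseteq> chart_image d"
    unfolding N_def using N1 N2 chart_open_image[OF d U(1)] pd U(2) by auto
  have inU: "chart_inv d x \<in> U" if "x \<in> N" for x
    using that d by (auto simp: N_def)
  have comb: "(1 - \<phi> (snd d q)) *\<^sub>R snd e (R q) + \<phi> (snd d q) *\<^sub>R snd e (r q) \<in> chart_image e" if "q \<in> U" for q
  proof -
    have "(1 - \<phi> (snd d q)) *\<^sub>R snd e (R q) + \<phi> (snd d q) *\<^sub>R snd e (r q) \<in> ball z \<delta>"
      using Uball[OF that] \<phi>(2)[of "snd d q"] by (intro convexD[OF convex_ball]) auto
    then show ?thesis using ball by blast
  qed
  have I: "?I q \<in> fst e" "snd e (?I q) = (1 - \<phi> (snd d q)) *\<^sub>R snd e (R q) + \<phi> (snd d q) *\<^sub>R snd e (r q)" if "q \<in> U" for q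
    by (rule chart_inv_in[OF comb[OF that]], rule chart_chart_inv[OF comb[OF that]])
  have "smooth_on (\<lambda>x. (1 - \<phi> x) *\<^sub>R local_map R d e x + \<phi> x *\<^sub>R local_map r d e x) N"
  proof (rule smooth_on_add)
    have c: "smooth_on \<phi> N" by (rule smooth_on_subset[OF \<phi>(1)]) simp
    show "smooth_on (\<lambda>x. (1 - \<phi> x) *\<^sub>R local_map R d e x) N"
      by (rule smooth_on_scaleR[OF smooth_on_diff[OF smooth_on_const c] smooth_on_subset[OF N1(4)]]) (auto simp: N_def)
    show "smooth_on (\<lambda>x. \<phi> x *\<^sub>R local_map r d e x) N"
      by (rule smooth_on_scaleR[OF c smooth_on_subset[OF N2(4)]]) (auto simp: N_def)
  qed
  then have "smooth_on (local_map ?I d e) N"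
  proof (rule smooth_on_cong[OF N(1), rotated])
    fix x assume x: "x \<in> N"
    then have "snd d (chart_inv d x) = x" using N(3) chart_chart_inv by blast
    then show "(1 - \<phi> x) *\<^sub>R local_map R d e x + \<phi> x *\<^sub>R local_map r d e x = local_map ?I d e x"
      using I(2)[OF inU[OF x]] by (simp add: local_map_def)
  qed
  then show ?thesis
    unfolding smooth_at_def using pd N I(1)[OF U(2)] I(1)[OF inU] by blast
qed

text \<open>Given an extension \<open>R\<close> near \<open>A\<close> and the local one \<open>r\<close>, use \<open>R\<close> away from a compact coordinate ball \<open>K\<close>, use \<open>r\<close> on
  the concentric ball \<open>O'\<close> of half the radius, and interpolate in between wherever both values lie in a ball of the
  chart \<open>e\<close>. On \<open>S\<close> both values are \<open>g\<close>, so the points where this is possible include \<open>A \<inter> K\<close>. The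
  neighbourhood \<open>O'\<close> is independent of \<open>A\<close> and \<open>R\<close>, as the induction over a finite cover requires.\<close>

lemma extendable_step:
  fixes E :: "('p, 'k::finite) charted_space" and X :: "('x, 'n::finite) charted_space"
  assumes E: "complex_manifold E" and X: "complex_manifold X"
    and d: "d \<in> atlas E" and e: "e \<in> atlas X"
    and W: "openin (mtop E) W" "p0 \<in> W" and r: "\<And>p. p \<in> W \<Longrightarrow> smooth_at r p d e"
    and rg: "\<And>p. p \<in> W \<inter> S \<Longrightarrow> r p = g p"
  shows "\<exists>O'. openin (mtop E) O' \<and> p0 \<in> O' \<and> (\<forall>A\<subseteq>S. extendable E X S g A \<longrightarrow> extendable E X S g (A \<union> (O' \<inter> S)))"
proof -
  note chd = complex_manifold_chart[OF E d] and che = complex_manifold_chart[OF X e]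
  have Wd: "W \<subseteq> fst d" using r by (auto simp: smooth_at_def)
  define x0 where "x0 = snd d p0"
  have "open (snd d ` (fst d \<inter> W))" by (rule chart_open_image[OF chd W(1)])
  moreover have "x0 \<in> snd d ` (fst d \<inter> W)" using W(2) Wd by (auto simp: x0_def)
  ultimately obtain \<rho> where \<rho>: "\<rho> > 0" "cball x0 \<rho> \<subseteq> snd d ` (fst d \<inter> W)"
    using open_contains_cball by metis
  define K where "K = {p \<in> fst d. snd d p \<in> cball x0 \<rho>}"
  define O' where "O' = {p \<in> fst d. snd d p \<in> ball x0 (\<rho> / 2)}"
  have KW: "K \<subseteq> W"
  proof
    fix p assume p: "p \<in> K"
    then obtain p' where "p' \<in> fst d \<inter> W" "snd d p = snd d p'" using \<rho>(2) by (auto simp: K_def)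
    then show "p \<in> W" using inj_onD[OF chart_inj[OF chd], of p p'] p by (auto simp: K_def)
  qed
  have "cball x0 \<rho> \<subseteq> chart_image d" using \<rho>(2) by (auto simp: chart_image_def)
  then have K: "closedin (mtop E) K" unfolding K_def by (rule chart_cball_closed[OF E d])
  have O': "openin (mtop E) O'" unfolding O'_def by (rule chart_open_vimage[OF chd open_ball])
  have OK: "O' \<subseteq> K" using \<rho>(1) by (auto simp: O'_def K_def)
  have pO: "p0 \<in> O'" using W(2) Wd \<rho>(1) by (auto simp: O'_def x0_def)
  define \<phi> where "\<phi> x = smooth_step ((\<rho>/2)\<^sup>2) (\<rho>\<^sup>2) ((x - x0) \<bullet> (x - x0))" for x
  have lt: "(\<rho>/2)\<^sup>2 < \<rho>\<^sup>2" using \<rho>(1) by (intro power_strict_mono) auto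
  note st = smooth_step[OF lt]
  have \<phi>: "smooth_on \<phi> UNIV" "\<And>x. 0 \<le> \<phi> x \<and> \<phi> x \<le> 1"
  proof -
    have "smooth_on (\<lambda>x. x - x0) UNIV"
      by (rule smooth_on_diff[OF smooth_on_bounded_linear[OF bounded_linear_ident] smooth_on_const])
    then have "smooth_on (\<lambda>x. (x - x0) \<bullet> (x - x0)) UNIV" by (intro smooth_on_inner)
    then show "smooth_on \<phi> UNIV" unfolding \<phi>_def by (rule smooth_on_compose[OF _ st(1)]) simp
    show "\<And>x. 0 \<le> \<phi> x \<and> \<phi> x \<le> 1" unfolding \<phi>_def using st(4,5) by blast
  qed
  have \<phi>0: "\<phi> x = 0" if "x \<notin> cball x0 \<rho>" for x
  proof -
    have "\<rho> \<le> norm (x - x0)" using that by (simp add: dist_norm norm_minus_commute)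
    then have "\<rho>\<^sup>2 \<le> (norm (x - x0))\<^sup>2" using \<rho>(1) by (intro power_mono) auto
    then show ?thesis unfolding \<phi>_def by (intro st(3)) (simp add: power2_norm_eq_inner)
  qed
  have \<phi>1: "\<phi> x = 1" if "x \<in> ball x0 (\<rho>/2)" for x
  proof -
    have "norm (x - x0) \<le> \<rho>/2" using that by (simp add: dist_norm norm_minus_commute)
    then have "(norm (x - x0))\<^sup>2 \<le> (\<rho>/2)\<^sup>2" by (intro power_mono) auto
    then show ?thesis unfolding \<phi>_def by (intro st(2)) (simp add: power2_norm_eq_inner)
  qed
  have re: "r p \<in> fst e" if "p \<in> W" for p using r[OF that] by (simp add: smooth_at_def)
  have "extendable E X S g (A \<union> (O' \<inter> S))" if A: "A \<subseteq> S" and ext: "extendable E X S g A" for A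
  proof -
    obtain V R where V: "openin (mtop E) V" "A \<subseteq> V" and R: "\<And>p. p \<in> V \<Longrightarrow> smooth_near E X R p"
      and Rg: "\<And>p. p \<in> V \<inter> S \<Longrightarrow> R p = g p"
      using ext unfolding extendable_def by blast
    define I where "I p = chart_inv e ((1 - \<phi> (snd d p)) *\<^sub>R snd e (R p) + \<phi> (snd d p) *\<^sub>R snd e (r p))" for p
    define R' where "R' p = (if p \<in> V - K then R p else if p \<in> O' then r p else I p)" for p
    define near where "near M' \<longleftrightarrow> openin (mtop E) M' \<and> M' \<subseteq> V \<inter> W \<and> (\<exists>z \<delta>. ball z \<delta> \<subseteq> chart_image e \<and>
        (\<forall>p\<in>M'. R p \<in> fst e \<and> snd e (R p) \<in> ball z \<delta> \<and> snd e (r p) \<in> ball z \<delta>))" for M'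
    define V' where "V' = (V - K) \<union> O' \<union> \<Union>{M'. near M'}"
    \<comment> \<open>On the sets where interpolation is possible it agrees with the other two branches, because the
      weight is \<open>0\<close> off \<open>K\<close> and \<open>1\<close> on \<open>O'\<close>. So \<open>R'\<close> is locally given by a single smooth formula.\<close>
    have RI: "R' p = I p" if "near M'" "p \<in> M'" for p M'
    proof -
      have p: "p \<in> V" "p \<in> W" "R p \<in> fst e" using that unfolding near_def by blast+
      have Ir: "I p = R p" if "p \<notin> K"
      proof -
        have "\<phi> (snd d p) = 0" using that p(2) Wd by (intro \<phi>0) (auto simp: K_def)
        then show ?thesis using chart_inv_chart[OF che p(3)] by (simp add: I_def)
      qed
      have "I p = r p" if "p \<in> O'"
      proof -
        have "\<phi> (snd d p) = 1" using that by (intro \<phi>1) (auto simp: O'_def)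
        then show ?thesis using chart_inv_chart[OF che re[OF p(2)]] by (simp add: I_def)
      qed
      with Ir show ?thesis by (simp add: R'_def)
    qed
    have "openin (mtop E) V'"
      unfolding V'_def by (intro openin_Un openin_diff V(1) K O' openin_Union) (auto simp: near_def)
    moreover have "A \<union> (O' \<inter> S) \<subseteq> V'"
    proof
      fix p assume p: "p \<in> A \<union> (O' \<inter> S)"
      show "p \<in> V'"
      proof (cases "p \<in> A \<and> p \<in> K")
        case True
        then have pV: "p \<in> V" "p \<in> W" "p \<in> S" using V(2) KW A by auto
        have eq: "R p = r p" using Rg rg pV by simp
        have rp: "r p \<in> fst e" by (rule re[OF pV(2)])
        have sR: "smooth_at R p d e"
          by (rule smooth_nearD[OF E X R[OF pV(1)] d e]) (use Wd pV(2) eq rp in auto)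
        have "open (chart_image e)" using che by (simp add: topological_chart_def)
        then obtain \<delta> where \<delta>: "\<delta> > 0" "ball (snd e (r p)) \<delta> \<subseteq> chart_image e"
          using chart_in_image[OF rp] openE by blast
        have c: "snd e (r p) \<in> ball (snd e (r p)) \<delta>" "snd e (R p) \<in> ball (snd e (r p)) \<delta>" using \<delta>(1) eq by auto
        obtain U1 where U1: "openin (mtop E) U1" "p \<in> U1"
          "\<And>q. q \<in> U1 \<Longrightarrow> R q \<in> fst e \<and> snd e (R q) \<in> ball (snd e (r p)) \<delta> \<and> smooth_at R q d e"
          using smooth_at_open_preimage[OF chd sR open_ball c(2)] by metis
        obtain U2 where U2: "openin (mtop E) U2" "p \<in> U2"
          "\<And>q. q \<in> U2 \<Longrightarrow> r q \<in> fst e \<and> snd e (r q) \<in> ball (snd e (r p)) \<delta> \<and> smooth_at r q d e"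
          using smooth_at_open_preimage[OF chd r[OF pV(2)] open_ball c(1)] by metis
        have "near (U1 \<inter> U2 \<inter> (V \<inter> W))"
          unfolding near_def
        proof (intro conjI exI[of _ "snd e (r p)"] exI[of _ \<delta>] ballI)
          show "openin (mtop E) (U1 \<inter> U2 \<inter> (V \<inter> W))" by (intro openin_Int U1 U2 V W)
        qed (use U1(3) U2(3) \<delta>(2) in auto)
        then show ?thesis using U1(2) U2(2) pV by (auto simp: V'_def)
      next
        case False
        then show ?thesis using p V(2) by (auto simp: V'_def)
      qed
    qed
    moreover have "smooth_near E X R' p" if p: "p \<in> V'" for p
    proof -
      consider "p \<in> V - K" | "p \<in> O'" | M' where "near M'" "p \<in> M'" using p by (auto simp: V'_def)
      then show ?thesis
      proof cases
        case 1
        show ?thesis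
          by (rule smooth_near_cong[where R = R and U = "V - K", OF E openin_diff[OF V(1) K] 1 _ R])
            (use 1 in \<open>auto simp: R'_def\<close>)
      next
        case 2
        have "smooth_near E X r p" using OK KW 2 by (intro smooth_nearI[OF d e r]) auto
        then show ?thesis
          by (rule smooth_near_cong[where R = r and U = O', OF E O' 2, rotated]) (use OK in \<open>auto simp: R'_def\<close>)
      next
        case 3
        then obtain z \<delta> where near: "openin (mtop E) M'" "M' \<subseteq> V \<inter> W" "ball z \<delta> \<subseteq> chart_image e"
          "\<And>q. q \<in> M' \<Longrightarrow> R q \<in> fst e \<and> snd e (R q) \<in> ball z \<delta> \<and> snd e (r q) \<in> ball z \<delta>"
          unfolding near_def by blast
        have pVW: "p \<in> V" "p \<in> W" using near(2) 3(2) by auto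
        have sR: "smooth_at R p d e"
          by (rule smooth_nearD[OF E X R[OF pVW(1)] d e]) (use Wd pVW(2) near(4)[OF 3(2)] in auto)
        have "smooth_at I p d e"
          unfolding I_def
          by (rule smooth_at_interpolation[where R = R and r = r, OF chd che near(1) 3(2) near(3) _ sR r[OF pVW(2)] \<phi>]) (use near(4) in blast)
        then have "smooth_near E X I p" by (rule smooth_nearI[OF d e])
        then show ?thesis
          by (rule smooth_near_cong[where R = I and U = M', OF E near(1) 3(2), rotated]) (rule RI[OF 3(1), symmetric])
      qed
    qed
    moreover have "R' p = g p" if p: "p \<in> V' \<inter> S" for p
    proof -
      consider "p \<in> V - K" | "p \<in> O'" | M' where "near M'" "p \<in> M'" using p by (auto simp: V'_def)
      then show ?thesis
      proof cases
        case 1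
        then show ?thesis using Rg p by (simp add: R'_def)
      next
        case 2
        then show ?thesis using OK KW rg p by (auto simp: R'_def)
      next
        case 3
        then have pp: "p \<in> V" "p \<in> W" unfolding near_def by blast+
        then have eqs: "R p = g p" "r p = g p" using Rg rg p by auto
        then have "g p \<in> fst e" using re[OF pp(2)] by simp
        with eqs have "I p = g p"
          using chart_inv_chart[OF che, of "g p"] by (simp add: I_def scaleR_left_distrib[symmetric])
        then show ?thesis using RI[OF 3] by simp
      qed
    qed
    ultimately show ?thesis
      unfolding extendable_def by (intro exI[of _ V'] exI[of _ R'] conjI ballI)
  qed
  then show ?thesis using O' pO by blast
qed

lemma smooth_extension:
  fixes E :: "('p, 'k::finite) charted_space" and X :: "('x, 'n::finite) charted_space"
  assumes E: "complex_manifold E" and X: "complex_manifold X" and S: "compactin (mtop E) S"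
    and loc: "\<And>p0. p0 \<in> S \<Longrightarrow> \<exists>d\<in>atlas E. \<exists>e\<in>atlas X. \<exists>W r. openin (mtop E) W \<and> p0 \<in> W \<and>
        (\<forall>p\<in>W. smooth_at r p d e) \<and> (\<forall>p\<in>W \<inter> S. r p = g p)"
  shows "extendable E X S g S"
proof -
  define UU where "UU = {O'. openin (mtop E) O' \<and> (\<forall>A\<subseteq>S. extendable E X S g A \<longrightarrow> extendable E X S g (A \<union> (O' \<inter> S)))}"
  have "S \<subseteq> \<Union>UU"
  proof
    fix p0 assume p0: "p0 \<in> S"
    obtain d e W r where dW: "d \<in> atlas E" "e \<in> atlas X" "openin (mtop E) W" "p0 \<in> W"
        "\<forall>p\<in>W. smooth_at r p d e" "\<forall>p\<in>W \<inter> S. r p = g p"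
      using loc[OF p0] by blast
    obtain O' where "openin (mtop E) O'" "p0 \<in> O'" "\<forall>A\<subseteq>S. extendable E X S g A \<longrightarrow> extendable E X S g (A \<union> (O' \<inter> S))"
      using extendable_step[where r = r and g = g and S = S, OF E X dW(1-4) bspec[OF dW(5)] bspec[OF dW(6)]] by blast
    then show "p0 \<in> \<Union>UU" by (auto simp: UU_def)
  qed
  then obtain F where F: "finite F" "F \<subseteq> UU" "S \<subseteq> \<Union>F"
    using S unfolding compactin_def UU_def by (metis (no_types, lifting) mem_Collect_eq)
  have "extendable E X S g (\<Union>F \<inter> S)"
    using F(1,2)
  proof (induction F rule: finite_induct)
    case empty
    show ?case unfolding extendable_def by (auto intro!: exI[of _ "{}"])
  next
    case (insert O' F)
    have "extendable E X S g (\<Union>F \<inter> S \<union> (O' \<inter> S))"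
      using insert unfolding UU_def by blast
    moreover have "\<Union>F \<inter> S \<union> (O' \<inter> S) = \<Union>(insert O' F) \<inter> S" by blast
    ultimately show ?case by simp
  qed
  moreover have "\<Union>F \<inter> S = S" using F(3) by blast
  ultimately show ?thesis by simp
qed

section \<open>Stability\<close>

text \<open>For a closed map, the points whose whole fibre lies in an open set form an open set.\<close>

lemma openin_complement_image:
  assumes f: "closed_map T T' f" and U: "openin T U"
  shows "openin T' (topspace T' - f ` (topspace T - U))"
proof -
  have "closedin T (topspace T - U)" using U by (simp add: closedin_diff)
  then have "closedin T' (f ` (topspace T - U))" using f unfolding closed_map_def by blast
  then show ?thesis by (simp add: openin_diff)
qed

context adapted_coordinates
begin

lemma continuous_on_coordinates:
  "continuous_on U (\<lambda>x. B (local_map \<pi> d q x) + C (L x))"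
proof -
  have "continuous_on U (local_map \<pi> d q)"
    by (rule continuous_on_subset[OF smooth_on_imp_continuous_on[OF holomorphic_map_on_imp_smooth_on[OF holomorphic_mapD[OF \<pi> d q]]] U(2)])
      (use local_domain_open[OF chd chq] \<pi> in \<open>simp add: holomorphic_map_def\<close>)
  then have "continuous_on U (\<lambda>x. B (local_map \<pi> d q x))"
    using bounded_linear.continuous_on[of B U] B by (simp add: linear_conv_bounded_linear)
  moreover have "continuous_on U (\<lambda>x. C (L x))"
    by (rule linear_continuous_on) (use C(1) L in \<open>simp add: linear_conv_bounded_linear bounded_linear_compose\<close>)
  ultimately show ?thesis by (rule continuous_on_add)
qed

text \<open>The extension depends only on the fibre coordinate \<open>L\<close>: a point is moved to the point of the fibre through
  \<open>p0\<close> with the same value of \<open>L\<close> before \<open>g\<close> is applied.\<close>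

lemma local_extension:
  fixes X :: "('x, 'l::finite) charted_space"
  assumes p0: "p0 \<in> fst d" "snd d p0 \<in> U" and F: "complex_manifold (fibre E \<pi> (\<pi> p0) :: ('p, 'n) charted_space)"
    and X: "complex_manifold X" and g: "holomorphic_map (fibre E \<pi> (\<pi> p0) :: ('p, 'n) charted_space) X g"
    and e: "e \<in> atlas X" "g p0 \<in> fst e"
  shows "\<exists>W r. openin (mtop E) W \<and> p0 \<in> W \<and> (\<forall>p\<in>W. smooth_at r p d e) \<and> (\<forall>p\<in>W \<inter> Fib (\<pi> p0). r p = g p)"
proof -
  let ?t = "\<pi> p0"
  have t: "?t \<in> fst q" by (rule coordinates_of_point(1)[OF p0])
  let ?a = "slice ?t"
  have a: "?a \<in> atlas (fibre E \<pi> ?t)" by (rule slice_in_atlas[OF t])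
  have cha: "topological_chart (subtopology (mtop E) (Fib ?t)) ?a" by (rule slice_topological_chart[OF t])
  note che = complex_manifold_chart[OF X e(1)]
  have pa: "p0 \<in> fst ?a" using p0 by (simp add: slice_def)
  have sa: "snd ?a p = L (snd d p)" for p by (simp add: slice_def)
  let ?G = "local_map g ?a e"
  define Dom where "Dom = local_domain g ?a e"
  have cg: "continuous_map (subtopology (mtop E) (Fib ?t)) (mtop X) g"
    using g by (simp add: holomorphic_map_def fibre_def)
  have Dom: "open Dom" unfolding Dom_def by (rule local_domain_open[OF cha che cg])
  have smG: "smooth_on ?G Dom" unfolding Dom_def
    by (rule holomorphic_map_on_imp_smooth_on[OF holomorphic_mapD[OF g a e(1)] Dom[unfolded Dom_def]])
  have bL: "bounded_linear L" using L by (simp add: linear_conv_bounded_linear)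
  define N where "N = U \<inter> L -` Dom"
  have N: "open N" unfolding N_def
    by (intro open_Int U(1) open_vimage Dom linear_continuous_on bL)
  define W where "W = {p \<in> fst d. snd d p \<in> N}"
  define r where "r p = g (chart_inv ?a (L (snd d p)))" for p
  have W: "openin (mtop E) W" unfolding W_def by (rule chart_open_vimage[OF chd N])
  have rN: "r (chart_inv d x) \<in> fst e \<and> local_map r d e x = ?G (L x)" if x: "x \<in> N" for x
  proof -
    have "x \<in> chart_image d" using x U_image by (auto simp: N_def)
    then have "snd d (chart_inv d x) = x" by (rule chart_chart_inv)
    moreover have "g (chart_inv ?a (L x)) \<in> fst e"
      using x unfolding N_def Dom_def by (auto simp: local_domain_iff[OF cha])
    ultimately show ?thesis by (simp add: r_def local_map_def)
  qed
  have smN: "smooth_on (local_map r d e) N"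
  proof (rule smooth_on_cong[OF N])
    show "smooth_on (\<lambda>x. ?G (L x)) N"
      by (rule smooth_on_compose[OF smooth_on_bounded_linear[OF bL] smG]) (auto simp: N_def)
  qed (use rN in simp)
  have "smooth_at r p d e" if p: "p \<in> W" for p
    unfolding smooth_at_def
  proof (intro conjI exI[of _ N] ballI)
    show "p \<in> fst d" "snd d p \<in> N" using p by (auto simp: W_def)
    then show "r p \<in> fst e" using rN[of "snd d p"] chart_inv_chart[OF chd] by simp
    show "N \<subseteq> chart_image d" using U_image by (auto simp: N_def)
  qed (use N smN rN in auto)
  moreover have "p0 \<in> W"
  proof -
    have "snd ?a p0 \<in> Dom" unfolding Dom_def local_domain_def using pa e(2) by blast
    then show ?thesis using p0 sa by (simp add: W_def N_def)
  qed
  moreover have "r p = g p" if p: "p \<in> W \<inter> Fib ?t" for p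
  proof -
    have "p \<in> fst ?a" using p by (simp add: W_def N_def slice_def)
    then show ?thesis using chart_inv_chart[OF cha] sa by (metis r_def)
  qed
  ultimately show ?thesis using W by blast
qed

text \<open>In adapted coordinates the pulled back forms on all nearby fibres form one continuous family
  on the model space, indexed by the points of the total space; non-degeneracy is open in it.\<close>

lemma strongly_nondegenerate_nearby_fibres:
  fixes X :: "('x, 'l::finite) charted_space"
  assumes p0: "p0 \<in> fst d" "snd d p0 \<in> U" and X: "complex_manifold X" "smooth_two_form X \<Omega>"
    and e: "e \<in> atlas X" and R: "smooth_at R p0 d e"
    and good: "strongly_nondegenerate (pullback_form X \<Omega> R (slice (\<pi> p0)) (snd (slice (\<pi> p0)) p0))"
  shows "\<exists>O'. openin (mtop E) O' \<and> p0 \<in> O' \<and> (\<forall>p\<in>O'. \<exists>a\<in>atlas (fibre E \<pi> (\<pi> p) :: ('p, 'n) charted_space).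
      p \<in> fst a \<and> strongly_nondegenerate (pullback_form X \<Omega> R a (snd a p)))"
proof -
  note che = complex_manifold_chart[OF X(1) e]
  let ?h = "local_map R d e"
  obtain N where N: "open N" "snd d p0 \<in> N" "N \<subseteq> chart_image d" "\<forall>x\<in>N. R (chart_inv d x) \<in> fst e" "smooth_on ?h N"
    using R unfolding smooth_at_def by blast
  have sm\<Psi>: "smooth_on \<Psi> V" by (rule holomorphic_map_on_imp_smooth_on[OF \<Psi>_hol V])
  define V1 where "V1 = V \<inter> \<Psi> -` N"
  have V1: "open V1" unfolding V1_def
    by (rule continuous_open_preimage[OF smooth_on_imp_continuous_on[OF sm\<Psi>] V N(1)])
  define H where "H y = ?h (\<Psi> y)" for y
  have H: "smooth_on H V1"
    unfolding H_def by (rule smooth_on_compose[OF smooth_on_subset[OF sm\<Psi>] N(5)]) (auto simp: V1_def)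
  have He: "H ` V1 \<subseteq> chart_image e"
    using N(4) by (auto simp: H_def V1_def local_map_def chart_image_def)
  define \<beta> where "\<beta> y v w = \<Omega> e (H y) (fderiv H y (C v)) (fderiv H y (C w))" for y v w
  have bil: "bilinear (\<Omega> e y)" "\<Omega> e y u u = 0" if "y \<in> chart_image e" for y u
    using X(2) e that unfolding smooth_two_form_def by blast+
  have sm: "smooth_on (\<lambda>y. \<Omega> e y u v) (chart_image e)" for u v
    using X(2) e unfolding smooth_two_form_def by blast
  have \<beta>1: "bilinear (\<beta> y)" "\<beta> y u u = 0" if "y \<in> V1" for y u
  proof -
    have Hy: "H y \<in> chart_image e" using He that by blast
    have "linear (\<lambda>v. fderiv H y (C v))"
      using linear_compose[OF C(1) has_derivative_linear[OF smooth_on_has_derivative[OF H that]]] by (simp add: o_def)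
    from bilinear_compose_linear[OF bil(1)[OF Hy] this] show "bilinear (\<beta> y)" by (simp add: \<beta>_def[abs_def])
    show "\<beta> y u u = 0" using bil(2)[OF Hy] by (simp add: \<beta>_def)
  qed
  have \<beta>cont: "continuous_on V1 (\<lambda>y. \<beta> y u v)" for u v
    unfolding \<beta>_def
    by (rule smooth_on_imp_continuous_on[OF smooth_on_bilinear_form[where \<alpha> = "\<Omega> e" and h = H,
          OF bil(1) sm H V1 He smooth_on_derivative[OF H V1] smooth_on_derivative[OF H V1]]])
  \<comment> \<open>On the fibre through \<open>p\<close> the coordinate expression of \<open>R\<close> is \<open>u \<mapsto> H (B (q t) + C u)\<close>, so the pulled back
    form depends on \<open>p\<close> only through the point \<open>\<Phi>_map p\<close> of \<open>V1\<close>.\<close>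
  have key: "p \<in> fst (slice (\<pi> p)) \<and> slice (\<pi> p) \<in> atlas (fibre E \<pi> (\<pi> p)) \<and>
      pullback_form X \<Omega> R (slice (\<pi> p)) (snd (slice (\<pi> p)) p) = \<beta> (\<Phi>_map p)"
    if p: "p \<in> fst d" "snd d p \<in> U" "\<Phi>_map p \<in> V1" for p
  proof -
    let ?t = "\<pi> p" and ?a = "slice (\<pi> p)"
    have t: "?t \<in> fst q" by (rule coordinates_of_point(1)[OF p(1,2)])
    have a: "?a \<in> atlas (fibre E \<pi> ?t)" by (rule slice_in_atlas[OF t])
    then have a': "?a \<in> atlas (induced_structure E (Fib ?t))" by (simp only: fibre_def)
    have cha: "topological_chart (subtopology (mtop E) (Fib ?t)) ?a" by (rule slice_topological_chart[OF t])
    have pa: "p \<in> fst ?a" using p by (simp add: slice_def)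
    have xp: "\<Psi> (\<Phi>_map p) = snd d p" by (rule coordinates_of_point(4)[OF p(1,2)])
    then have xN: "snd d p \<in> N" using p(3) by (simp add: V1_def)
    have Rp: "R p \<in> fst e" using N(4) xN chart_inv_chart[OF chd p(1)] by metis
    have sR: "smooth_at R p d e"
      unfolding smooth_at_def using p(1) Rp N xN by blast
    have sRa: "smooth_at R p ?a e" by (rule smooth_at_restrict[OF E a' pa d sR])
    let ?y = "\<lambda>u. B (snd q ?t) + C u"
    have \<Phi>p: "\<Phi>_map p = ?y (snd ?a p)" by (simp add: \<Phi>_map_def slice_def)
    have y': "(?y has_derivative C) (at (snd ?a p))"
      using has_derivative_add[OF has_derivative_const[of "B (snd q ?t)"] linear_imp_has_derivative[OF C(1)]] by simp
    have HD: "(H has_derivative fderiv H (\<Phi>_map p)) (at (?y (snd ?a p)))"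
      using smooth_on_has_derivative[OF H p(3)] \<Phi>p by simp
    have "((\<lambda>u. H (?y u)) has_derivative (\<lambda>v. fderiv H (\<Phi>_map p) (C v))) (at (snd ?a p))"
      by (rule has_derivative_compose[OF y' HD])
    then have "(local_map R ?a e has_derivative (\<lambda>v. fderiv H (\<Phi>_map p) (C v))) (at (snd ?a p))"
    proof (rule has_derivative_transform_within_open[OF _ slice_image_open[OF t] chart_in_image[OF pa]])
      fix u assume u: "u \<in> chart_image ?a"
      then have "?y u \<in> V" unfolding slice_image[OF t] by simp
      then have "\<Psi> (?y u) \<in> chart_image d" using \<Psi>(1) U_image by blast
      then show "H (?y u) = local_map R ?a e u"
        using slice_topological_chart(2)[OF t u] by (simp add: H_def local_map_def)
    qed
    from frechet_derivative_at[OF this]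
    have D: "fderiv (local_map R ?a e) (snd ?a p) = (\<lambda>v. fderiv H (\<Phi>_map p) (C v))" by simp
    have Hp: "H (\<Phi>_map p) = snd e (R p)" unfolding H_def xp by (rule local_map_chart[OF chd p(1)])
    have "pullback_form X \<Omega> R ?a (snd ?a p) v w = \<beta> (\<Phi>_map p) v w" for v w
      unfolding pullback_form_eq[OF X cha e sRa] D \<beta>_def Hp ..
    then show ?thesis using pa a by blast
  qed
  let ?y0 = "\<Phi>_map p0"
  have y0: "?y0 \<in> V1" using coordinates_of_point(3,4)[OF p0] N(2) by (simp add: V1_def)
  have "strongly_nondegenerate (\<beta> ?y0)" using good key[OF p0 y0] by simp
  then obtain N' where N': "open N'" "?y0 \<in> N'" "N' \<subseteq> V1" "\<And>y. y \<in> N' \<Longrightarrow> strongly_nondegenerate (\<beta> y)"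
    using strongly_nondegenerate_open[of V1 ?y0 \<beta>, OF V1 y0 \<beta>1 \<beta>cont] by metis
  define U' where "U' = U \<inter> (\<lambda>x. B (local_map \<pi> d q x) + C (L x)) -` N'"
  have U': "open U'" unfolding U'_def
    by (rule continuous_open_preimage[OF continuous_on_coordinates U(1) N'(1)])
  have mem: "p \<in> fst d \<and> snd d p \<in> U \<and> \<Phi>_map p \<in> N'" if "p \<in> fst d" "snd d p \<in> U'" for p
    using that coordinates_of_point(2)[OF that(1)] by (simp add: U'_def \<Phi>_map_def)
  show ?thesis
  proof (intro exI[of _ "{p \<in> fst d. snd d p \<in> U'}"] conjI ballI)
    show "openin (mtop E) {p \<in> fst d. snd d p \<in> U'}" by (rule chart_open_vimage[OF chd U'])
    show "p0 \<in> {p \<in> fst d. snd d p \<in> U'}"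
      using p0 N'(2) coordinates_of_point(2)[OF p0] by (simp add: U'_def \<Phi>_map_def)
    fix p assume "p \<in> {p \<in> fst d. snd d p \<in> U'}"
    then have p: "p \<in> fst d" "snd d p \<in> U" "\<Phi>_map p \<in> N'" using mem[of p] by auto
    have "\<Phi>_map p \<in> V1" using p(3) N'(3) by blast
    from key[OF p(1,2) this] N'(4)[OF p(3)]
    show "\<exists>a\<in>atlas (fibre E \<pi> (\<pi> p) :: ('p, 'n) charted_space). p \<in> fst a \<and> strongly_nondegenerate (pullback_form X \<Omega> R a (snd a p))"
      by (intro bexI[of _ "slice (\<pi> p)"]) auto
  qed
qed

end

lemma pseudo_Hermitian_symplectic_iff:
  "pseudo_Hermitian_symplectic M \<longleftrightarrow> complex_manifold M \<and>
     (\<exists>\<Omega>. smooth_two_form M \<Omega> \<and> (\<forall>c\<in>atlas M. \<forall>x\<in>chart_image c.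
        strongly_nondegenerate (\<Omega> c x) \<and> (\<forall>u v w. exterior_derivative (\<Omega> c) x u v w = 0)))"
  unfolding pseudo_Hermitian_symplectic_def symplectic_form_def strongly_nondegenerate_def by blast

lemma pseudo_Kaehler_imp_pseudo_Hermitian_symplectic:
  assumes "pseudo_Kaehler M" shows "pseudo_Hermitian_symplectic M"
proof -
  obtain F where F: "complex_manifold M" "symplectic_form M F"
    "\<And>c x. c \<in> atlas M \<Longrightarrow> x \<in> chart_image c \<Longrightarrow> bidegree_1_1 (complexify (F c x))"
    using assms unfolding pseudo_Kaehler_def by blast
  have "nondegenerate (component_1_1 (complexify (F c x)))" if "c \<in> atlas M" "x \<in> chart_image c" for c x
  proof -
    have "nondegenerate (F c x)" using F(2) that unfolding symplectic_form_def by blast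
    then have "nondegenerate (complexify (F c x))" by (simp add: nondegenerate_def)
    then show ?thesis using component_1_1_bidegree_1_1[OF F(3)[OF that]] by simp
  qed
  then show ?thesis using F(1,2) unfolding pseudo_Hermitian_symplectic_def by blast
qed

lemma pseudo_Hermitian_symplectic_stable:
  fixes X :: "('x, 'n::finite) charted_space"
    and E :: "('p, 'k::finite) charted_space"
    and D :: "('q, 'm::finite) charted_space"
  assumes fam: "holomorphic_family E D \<pi>" and t0: "t0 \<in> topspace (mtop D)"
    and bih: "biholomorphic X (fibre E \<pi> t0 :: ('p, 'n) charted_space)"
    and phs: "pseudo_Hermitian_symplectic X"
  shows "\<exists>T. openin (mtop D) T \<and> t0 \<in> T \<and>
     (\<forall>t\<in>T. pseudo_Hermitian_symplectic (fibre E \<pi> t :: ('p, 'n) charted_space))"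
proof -
  let ?F = "\<lambda>t. fibre E \<pi> t :: ('p, 'n) charted_space"
  define Fib where "Fib t = {x \<in> topspace (mtop E). \<pi> x = t}" for t
  have fib: "?F t = induced_structure E (Fib t)" for t by (simp only: fibre_def Fib_def)
  have E: "complex_manifold E" and D: "complex_manifold D" and sub: "holomorphic_submersion E D \<pi>"
    and proper: "proper_map (mtop E) (mtop D) \<pi>"
    using fam by (auto simp: holomorphic_family_def)
  have \<pi>: "holomorphic_map E D \<pi>" using sub by (simp add: holomorphic_submersion_def)
  have \<pi>top: "\<pi> p \<in> topspace (mtop D)" if "p \<in> topspace (mtop E)" for p
    using \<pi> that unfolding holomorphic_map_def continuous_map_def by blast
  obtain f g where X: "complex_manifold X" and F0: "complex_manifold (?F t0)"
    and f: "holomorphic_map X (?F t0) f" and g: "holomorphic_map (?F t0) X g"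
    and fg: "\<And>y. y \<in> topspace (mtop (?F t0)) \<Longrightarrow> f (g y) = y"
    using bih unfolding biholomorphic_def by blast
  obtain \<Omega> where \<Omega>: "smooth_two_form X \<Omega>"
    "\<And>c x. c \<in> atlas X \<Longrightarrow> x \<in> chart_image c \<Longrightarrow> strongly_nondegenerate (\<Omega> c x)"
    "\<And>c x u v w. c \<in> atlas X \<Longrightarrow> x \<in> chart_image c \<Longrightarrow> exterior_derivative (\<Omega> c) x u v w = 0"
    using phs unfolding pseudo_Hermitian_symplectic_iff by blast
  have symp: "symplectic_form X \<Omega>"
    unfolding symplectic_form_def using \<Omega> by (auto simp: strongly_nondegenerate_def)
  have top0: "topspace (mtop (?F t0)) = Fib t0" by (auto simp: fib Fib_def)
  have gX: "g p \<in> topspace (mtop X)" if "p \<in> Fib t0" for p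
    using g that top0 unfolding holomorphic_map_def continuous_map_def by blast

  have charts: "\<exists>d q e U V B C L \<Psi>. adapted_coordinates E D \<pi> d q U V B (C :: (complex, 'n) vec \<Rightarrow> _) L \<Psi>
      \<and> p0 \<in> fst d \<and> snd d p0 \<in> U \<and> e \<in> atlas X \<and> g p0 \<in> fst e" if p0: "p0 \<in> Fib t0" for p0
  proof -
    have pE: "p0 \<in> topspace (mtop E)" and pt: "\<pi> p0 = t0" using p0 by (auto simp: Fib_def)
    obtain d where d: "d \<in> atlas E" "p0 \<in> fst d" by (rule complex_manifold_obtain_chart[OF E pE])
    obtain q where q: "q \<in> atlas D" "\<pi> p0 \<in> fst q" by (rule complex_manifold_obtain_chart[OF D \<pi>top[OF pE]])
    obtain e where e: "e \<in> atlas X" "g p0 \<in> fst e" by (rule complex_manifold_obtain_chart[OF X gX[OF p0]])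
    obtain c0 where c0: "c0 \<in> atlas (?F t0)" "p0 \<in> fst c0"
      by (rule complex_manifold_obtain_chart[OF F0, of p0]) (simp add: top0 p0)
    obtain U V B and C :: "(complex, 'n) vec \<Rightarrow> (complex, 'k) vec" and L \<Psi>
      where "adapted_coordinates E D \<pi> d q U V B C L \<Psi>" "snd d p0 \<in> U"
      by (rule adapted_coordinates_exist[OF E D sub d q, of c0]) (use c0 pt in auto)
    then show ?thesis using d e by blast
  qed

  have "extendable E X (Fib t0) g (Fib t0)"
  proof (rule smooth_extension[OF E X])
    show "compactin (mtop E) (Fib t0)" using proper t0 unfolding proper_map_def Fib_def by blast
    fix p0 assume p0: "p0 \<in> Fib t0"
    then have pt: "\<pi> p0 = t0" by (simp add: Fib_def)
    obtain d q e U V B L \<Psi> and C :: "(complex, 'n) vec \<Rightarrow> (complex, 'k) vec" where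
      ac: "adapted_coordinates E D \<pi> d q U V B C L \<Psi>" and pd: "p0 \<in> fst d" "snd d p0 \<in> U"
      and e: "e \<in> atlas X" "g p0 \<in> fst e"
      using charts[OF p0] by blast
    interpret adapted_coordinates E D \<pi> d q U V B C L \<Psi> by (rule ac)
    have "\<exists>W r. openin (mtop E) W \<and> p0 \<in> W \<and> (\<forall>p\<in>W. smooth_at r p d e) \<and> (\<forall>p\<in>W \<inter> {x \<in> topspace (mtop E). \<pi> x = \<pi> p0}. r p = g p)"
      by (rule local_extension[where g = g, OF pd _ X _ e]) (simp_all only: pt F0 g)
    then show "\<exists>d\<in>atlas E. \<exists>e\<in>atlas X. \<exists>W r. openin (mtop E) W \<and> p0 \<in> W \<and>
        (\<forall>p\<in>W. smooth_at r p d e) \<and> (\<forall>p\<in>W \<inter> Fib t0. r p = g p)"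
      using d e(1) unfolding pt Fib_def by blast
  qed
  then obtain W R where W: "openin (mtop E) W" "Fib t0 \<subseteq> W" and R: "\<And>p. p \<in> W \<Longrightarrow> smooth_near E X R p"
    and Rg: "\<And>p. p \<in> W \<inter> Fib t0 \<Longrightarrow> R p = g p"
    unfolding extendable_def by blast

  have near: "\<exists>O'. openin (mtop E) O' \<and> p0 \<in> O' \<and> (\<forall>p\<in>O'. \<exists>a\<in>atlas (?F (\<pi> p)).
      p \<in> fst a \<and> strongly_nondegenerate (pullback_form X \<Omega> R a (snd a p)))" if p0: "p0 \<in> Fib t0" for p0
  proof -
    have pt: "\<pi> p0 = t0" using p0 by (simp add: Fib_def)
    obtain d q e U V B L \<Psi> and C :: "(complex, 'n) vec \<Rightarrow> (complex, 'k) vec" where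
      ac: "adapted_coordinates E D \<pi> d q U V B C L \<Psi>" and pd: "p0 \<in> fst d" "snd d p0 \<in> U"
      and e: "e \<in> atlas X" "g p0 \<in> fst e"
      using charts[OF p0] by blast
    interpret adapted_coordinates E D \<pi> d q U V B C L \<Psi> by (rule ac)
    have pW: "p0 \<in> W" using W(2) p0 by blast
    have Rp: "R p0 = g p0" using Rg pW p0 by blast
    have sR: "smooth_at R p0 d e" by (rule smooth_nearD[OF E X R[OF pW] d e(1) pd(1)]) (simp add: Rp e(2))
    let ?a = "slice t0"
    have t0q: "t0 \<in> fst q" using coordinates_of_point(1)[OF pd] pt by simp
    have a: "?a \<in> atlas (?F t0)" by (rule slice_in_atlas[OF t0q])
    have pa: "p0 \<in> fst ?a" using pd pt by (simp add: slice_def)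
    have cha: "topological_chart (subtopology (mtop E) (Fib t0)) ?a"
      unfolding Fib_def by (rule slice_topological_chart[OF t0q])
    have a': "?a \<in> atlas (induced_structure E (Fib t0))" using a by (simp only: fib)
    have sRa: "smooth_at R p0 ?a e" by (rule smooth_at_restrict[OF E a' pa d sR])
    \<comment> \<open>The chart \<open>slice t0\<close> only sees points of the fibre over \<open>t0\<close>, where \<open>R\<close> is \<open>g\<close>.\<close>
    have DR: "fderiv (local_map R ?a e) (snd ?a p0) = fderiv (local_map g ?a e) (snd ?a p0)"
    proof (rule frechet_derivative_cong_open[OF slice_image_open[OF t0q] chart_in_image[OF pa]])
      fix u assume u: "u \<in> chart_image ?a"
      have "chart_inv ?a u \<in> Fib t0" using chart_in_topspace[OF cha chart_inv_in[OF u]] by simp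
      then show "local_map R ?a e u = local_map g ?a e u" using Rg W(2) by (auto simp: local_map_def)
    qed
    let ?Dg = "fderiv (local_map g ?a e) (snd ?a p0)"
    note Dg = bij_derivative_of_biholomorphic[OF F0 X g f fg a e(1) pa e(2)]
    have ge: "snd e (g p0) \<in> chart_image e" by (rule chart_in_image[OF e(2)])
    have bil: "bilinear (\<Omega> e (snd e (g p0)))" "\<And>u. \<Omega> e (snd e (g p0)) u u = 0"
      using \<Omega>(1) e(1) ge unfolding smooth_two_form_def by blast+
    have "strongly_nondegenerate (\<lambda>u v. \<Omega> e (snd e (g p0)) (?Dg u) (?Dg v))"
      by (rule strongly_nondegenerate_compose[OF bil Dg(1,2) Dg(3) \<Omega>(2)[OF e(1) ge]])
    moreover have "pullback_form X \<Omega> R ?a (snd ?a p0) u v = \<Omega> e (snd e (g p0)) (?Dg u) (?Dg v)" for u v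
      unfolding pullback_form_eq[OF X \<Omega>(1) cha e(1) sRa] DR Rp ..
    then have "pullback_form X \<Omega> R ?a (snd ?a p0) = (\<lambda>u v. \<Omega> e (snd e (g p0)) (?Dg u) (?Dg v))" by blast
    ultimately have "strongly_nondegenerate (pullback_form X \<Omega> R ?a (snd ?a p0))" by simp
    then show ?thesis
      by (intro strongly_nondegenerate_nearby_fibres[OF pd X \<Omega>(1) e(1) sR]) (simp only: pt)
  qed

  define G where "G = \<Union>{O'. openin (mtop E) O' \<and> (\<forall>p\<in>O'. \<exists>a\<in>atlas (?F (\<pi> p)).
      p \<in> fst a \<and> strongly_nondegenerate (pullback_form X \<Omega> R a (snd a p)))} \<inter> W"
  have G: "openin (mtop E) G" unfolding G_def by (intro openin_Int W(1) openin_Union) auto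
  have G_props: "p \<in> W \<and> (\<exists>a\<in>atlas (?F (\<pi> p)). p \<in> fst a \<and> strongly_nondegenerate (pullback_form X \<Omega> R a (snd a p)))" if "p \<in> G" for p
    using that unfolding G_def by blast
  have FO: "Fib t0 \<subseteq> G" unfolding G_def using near W(2) by blast
  define T where "T = topspace (mtop D) - \<pi> ` (topspace (mtop E) - G)"
  have T: "openin (mtop D) T"
    unfolding T_def using proper G by (intro openin_complement_image) (simp_all add: proper_map_def)
  have t0T: "t0 \<in> T" using t0 FO by (auto simp: T_def Fib_def)
  have "pseudo_Hermitian_symplectic (?F t)" if t: "t \<in> T" for t
  proof -
    have FtO: "Fib t \<subseteq> G" using t by (auto simp: T_def Fib_def)
    have loc: "p \<in> W" "\<exists>a\<in>atlas (?F t). p \<in> fst a \<and> strongly_nondegenerate (pullback_form X \<Omega> R a (snd a p))" if "p \<in> Fib t" for p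
      using G_props[of p] FtO that by (auto simp: Fib_def)
    have M: "complex_manifold (?F t)"
      unfolding fib by (rule complex_manifold_induced_structure[OF E]) (use loc(2) fib in auto)
    have top: "topspace (mtop (?F t)) = Fib t" by (auto simp: fib Fib_def)
    have sm: "\<exists>e\<in>atlas X. smooth_at R p c e" if "c \<in> atlas (?F t)" "p \<in> fst c" for c p
    proof -
      have "p \<in> Fib t" using chart_in_topspace[OF complex_manifold_chart[OF M that(1)] that(2)] top by simp
      then have "smooth_near E X R p" using R loc(1) by blast
      then obtain d e where de: "d \<in> atlas E" "e \<in> atlas X" "smooth_at R p d e"
        unfolding smooth_near_def by blast
      have "smooth_at R p c e"
        by (rule smooth_at_restrict[OF E _ that(2) de(1,3)]) (use that(1) in \<open>simp only: fib\<close>)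
      then show ?thesis using de(2) by blast
    qed
    have "smooth_map (?F t) X R"
      unfolding smooth_map_def smooth_near_def top using loc(2) sm by blast
    then have form: "smooth_two_form (?F t) (pullback_form X \<Omega> R)"
      by (rule smooth_two_form_pullback[OF M X \<Omega>(1)])
    have "strongly_nondegenerate (pullback_form X \<Omega> R c x) \<and> (\<forall>u v w. exterior_derivative (pullback_form X \<Omega> R c) x u v w = 0)"
      if c: "c \<in> atlas (?F t)" and x: "x \<in> chart_image c" for c x
    proof -
      obtain p where p: "p \<in> fst c" "x = snd c p" using x by (auto simp: chart_image_def)
      obtain e where e: "e \<in> atlas X" "smooth_at R p c e" using sm[OF c p(1)] by blast
      note chc = complex_manifold_chart[OF M c]
      have "p \<in> Fib t" using chart_in_topspace[OF chc p(1)] top by simp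
      then obtain a where a: "a \<in> atlas (?F t)" "p \<in> fst a" "strongly_nondegenerate (pullback_form X \<Omega> R a (snd a p))"
        using loc(2) by blast
      have "strongly_nondegenerate (pullback_form X \<Omega> R c (snd c p))"
        by (rule strongly_nondegenerate_change_chart[OF M form c a(1) p(1) a(2,3)])
      moreover have "exterior_derivative (pullback_form X \<Omega> R c) (snd c p) u v w = 0" for u v w
        by (rule exterior_derivative_pullback_form[OF X symp chc e])
      ultimately show ?thesis by (simp add: p(2))
    qed
    then show ?thesis unfolding pseudo_Hermitian_symplectic_iff using M form by blast
  qed
  then show ?thesis using T t0T by blast
qed

theorem proposition4p5:
  fixes X :: "('x, 'n::finite) charted_space"
    and E :: "('p, 'k::finite) charted_space"
    and D :: "('q, 'm::finite) charted_space"
    and \<pi> :: "'p \<Rightarrow> 'q" and t0 :: 'q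
  assumes "compact_complex_manifold X"
    and "holomorphic_family E D \<pi>"
    and "t0 \<in> topspace (mtop D)"
    and "biholomorphic X (fibre E \<pi> t0 :: ('p, 'n) charted_space)"
  shows "(pseudo_Hermitian_symplectic X \<longrightarrow>
            (\<exists>T. openin (mtop D) T \<and> t0 \<in> T \<and>
               (\<forall>t\<in>T. pseudo_Hermitian_symplectic (fibre E \<pi> t :: ('p, 'n) charted_space)))) \<and>
         (pseudo_Kaehler X \<longrightarrow>
            (\<exists>T. openin (mtop D) T \<and> t0 \<in> T \<and>
               (\<forall>t\<in>T. pseudo_Hermitian_symplectic (fibre E \<pi> t :: ('p, 'n) charted_space))))"
  using pseudo_Hermitian_symplectic_stable[OF assms(2-4)] pseudo_Kaehler_imp_pseudo_Hermitian_symplectic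
  by blast

end
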